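(* The graded $\mathrm{GL}(n,\mathbb{Q})$-homomorphism $$F_*=\bigoplus_{i\ge0}F_i:H_*(U,\mathbb{Q})\to S^*(U_* )$$ is a coalgebra map.
   Context: Basic objects. $H=\mathbb{Q}^n$ is the standard representation of $\mathrm{GL}(n,\mathbb{Q})$, $H^*$ its dual, $U=\mathrm{Hom}(H,\bigwedge^2H)\cong(\bigwedge^2H)\otimes H^*$, and $H_i(U,\mathbb{Q})=\bigwedge^iU$. The coalgebra structure on $H_*(U,\mathbb{Q})=\bigwedge^*U$ is $$\Delta^U_*(x_1\wedge\cdots\wedge x_i)=\sum_{p=0}^i\sum_{\sigma\in\mathrm{Sh}(p,i-p)}\mathrm{sgn}(\sigma)(x_{\sigma(1)}\wedge\cdots\wedge x_{\sigma(p)})\otimes(x_{\sigma(p+1)}\wedge\cdots\wedge x_{\sigma(i)}),$$ with $\mathrm{Sh}(p,i-p)\subset\mathfrak{S}_i$ the $(p,i-p)$-shuffles, and counit the projection to degree $0$. The representations $U_i$. For $i\ge1$, $U_i=\mathrm{Hom}(H,\bigwedge^{i+1}H)\cong(\bigwedge^{i+1}H)\otimes H^*$ ($U_i=0$ for $n\le i$, and then all maps into it are zero). For $n\ge i+1$, $U_i=U_i^{\mathrm{tree}}\oplus U_i^{\mathrm{wheel}}$, where $U_i^{\mathrm{wheel}}$ is the subrepresentation isomorphic to $\bigwedge^iH$ (and identified with $\bigwedge^iH$) and $U_i^{\mathrm{tree}}$ is the kernel of the contraction $(\bigwedge^{i+1}H)\otimes H^*\to\bigwedge^iH$ (irreducible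 of type $V_{1^{i+1},1}$, zero if $n=i+1$). Let $U_*=\bigoplus_{i\ge1}U_i$, with $U_i$ in degree $i$, and let $S^*(U_* )$ be its graded-symmetric algebra ($yx=(-1)^{jk}xy$ for $x\in U_j$, $y\in U_k$), with coproduct $$\Delta(x_1\cdots x_k)=\sum_{p=0}^k\sum_{\sigma\in\mathrm{Sh}(p,k-p)}\mathrm{sgn}(\sigma;x)\,x_{\sigma(1)}\cdots x_{\sigma(p)}\otimes x_{\sigma(p+1)}\cdots x_{\sigma(k)},$$ for homogeneous $x_j\in U_{i_j}$, where $\mathrm{sgn}(\sigma;x)\in\{\pm1\}$ is the Koszul sign satisfying $x_{\sigma(1)}\cdots x_{\sigma(k)}=\mathrm{sgn}(\sigma;x)x_1\cdots x_k$; the counit is the projection to degree $0$. The map $F_i$. Let $M_i=(H^{\otimes2}\otimes H^* )^{\otimes i}$ and $\varphi:U\to H^{\otimes2}\otimes H^*$, $(a\wedge b)\otimes d^*\mapsto(a\otimes b-b\otimes a)\otimes d^*$, and let $\iota_i:\bigwedge^iU\hookrightarrow M_i$, $u_1\wedge\cdots\wedge u_i\mapsto\sum_{\sigma\in\mathfrak{S}_i}\mathrm{sgn}(\sigma)\varphi(u_{\sigma(1)})\otimes\cdots\otimes\varphi(u_{\sigma(i)})$. Define $c_i:M_i\to U_i$ by $$c_i\Bigl(\bigotimes_{j=1}^i(a_j\otimes b_j\otimes d_j^* )\Bigr)=\Bigl(\prod_{j=2}^id_j^*(b_{j-1})\Bigr)\,a_1\wedge\cdots\wedge a_i\wedge b_i\otimes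 d_1^*,$$ $c_i^{\mathrm{tree}}:M_i\to U_i^{\mathrm{tree}}$ as $c_i$ followed by the projection $U_i\to U_i^{\mathrm{tree}}$, and $c_i^{\mathrm{wheel}}:M_i\to U_i^{\mathrm{wheel}}=\bigwedge^iH$ by $$c_i^{\mathrm{wheel}}\Bigl(\bigotimes_{j=1}^i(a_j\otimes b_j\otimes d_j^* )\Bigr)=\Bigl(\prod_{j=1}^id_j^*(b_{j-1})\Bigr)\,a_1\wedge\cdots\wedge a_i,\qquad b_0:=b_i.$$ A pair of partitions $(\mu,\nu)\vdash i$ means $|\mu|+|\nu|=i$; write $\mu=(\mu_1^{k'_1},\dots,\mu_r^{k'_r})$, $\nu=(\nu_1^{k''_1},\dots,\nu_s^{k''_s})$ with distinct decreasing parts and positive multiplicities. Put $U^{\mathrm{tree}}_\mu=\bigotimes_jS^{k'_j}(U^{\mathrm{tree}}_{\mu_j})$ and $U^{\mathrm{wheel}}_\nu=\bigotimes_jS^{k''_j}(U^{\mathrm{wheel}}_{\nu_j})$ (graded-symmetric powers), so $S^*(U_* )_i=\bigoplus_{(\mu,\nu)\vdash i}U^{\mathrm{tree}}_\mu\otimes U^{\mathrm{wheel}}_\nu$. Let $F_{(\mu,\nu)}:\bigwedge^iU\to U^{\mathrm{tree}}_\mu\otimes U^{\mathrm{wheel}}_\nu$ be $\iota_i$ followed by $$\Bigl(\bigotimes_{j=1}^r\tfrac1{k'_j!}\prod^{k'_j}c^{\mathrm{tree}}_{\mu_j}\Bigr)\otimes\Bigl(\bigotimes_{j=1}^s\tfrac1{k''_j!}\prod^{k''_j}c^{\mathrm{wheel}}_{\nu_j}\Bigr),$$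 where the $i$ factors of $M_i$ are split into consecutive blocks of sizes $\mu_1$ ($k_1'$ times), $\dots$, $\mu_r$ ($k'_r$ times), $\nu_1$ ($k''_1$ times), $\dots$, $\nu_s$ ($k''_s$ times), the indicated contraction is applied to each block, and $\prod$ is the product in the graded-symmetric algebra. Finally $F_i=\bigoplus_{(\mu,\nu)\vdash i}F_{(\mu,\nu)}:H_i(U,\mathbb{Q})\to S^*(U_* )_i$ ($F_0$ is the identity of $\mathbb{Q}$). *)

theory Defs
  imports
    "HOL-Analysis.Cartesian_Space"
    "HOL-Combinatorics.Permutations"
    "HOL-Library.Poly_Mapping"
begin

section \<open>Rational vector spaces\<close>

class rat_vector = ab_group_add +
  fixes scaleQ :: "rat \<Rightarrow> 'a \<Rightarrow> 'a" (infixr "*\<^sub>Q" 75)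
  assumes scaleQ_add_right: "c *\<^sub>Q (x + y) = c *\<^sub>Q x + c *\<^sub>Q y"
    and scaleQ_add_left: "(c + d) *\<^sub>Q x = c *\<^sub>Q x + d *\<^sub>Q x"
    and scaleQ_scaleQ: "c *\<^sub>Q d *\<^sub>Q x = (c * d) *\<^sub>Q x"
    and scaleQ_one: "1 *\<^sub>Q x = x"

global_interpretation Q: vector_space "scaleQ :: rat \<Rightarrow> 'a \<Rightarrow> 'a::rat_vector"
  by unfold_locales (simp_all add: scaleQ_add_right scaleQ_add_left scaleQ_scaleQ scaleQ_one)

abbreviation linear_Q :: "('a::rat_vector \<Rightarrow> 'b::rat_vector) \<Rightarrow> bool" where
  "linear_Q \<equiv> Vector_Spaces.linear scaleQ scaleQ"

lemma linear_Q_iff: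
  "linear_Q f \<longleftrightarrow> (\<forall>x y. f (x + y) = f x + f y) \<and> (\<forall>c x. f (c *\<^sub>Q x) = c *\<^sub>Q f x)"
  by (auto simp: Vector_Spaces.linear_def module_hom_def module_hom_axioms_def Q.module_axioms
      Q.vector_space_axioms)

instantiation rat :: rat_vector
begin
definition "scaleQ_rat (c::rat) (x::rat) = c * x"
instance by standard (simp_all add: scaleQ_rat_def algebra_simps)
end

instantiation vec :: (rat_vector, finite) rat_vector
begin
definition "scaleQ_vec c x = (\<chi> i. c *\<^sub>Q (x $ i))"
instance by standard
  (simp_all add: scaleQ_vec_def vec_eq_iff scaleQ_add_right scaleQ_add_left scaleQ_scaleQ scaleQ_one)
end

instantiation poly_mapping :: (type, rat_vector) rat_vector
begin
lift_definition scaleQ_poly_mapping :: "rat \<Rightarrow> ('a \<Rightarrow>\<^sub>0 'b) \<Rightarrow> 'a \<Rightarrow>\<^sub>0 'b"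
  is "\<lambda>c f x. c *\<^sub>Q f x"
  by (erule finite_subset[rotated]) (auto simp: Q.scale_zero_right)
instance by standard
  (transfer; simp add: fun_eq_iff scaleQ_add_right scaleQ_add_left scaleQ_scaleQ scaleQ_one)+
end

typedef (overloaded) 'a dual = "{f :: 'a::rat_vector \<Rightarrow> rat. linear_Q f}"
  morphisms dual_apply Abs_dual
  by (rule exI[of _ "\<lambda>_. 0"]) (simp add: linear_Q_iff Q.scale_zero_right)

setup_lifting type_definition_dual

instantiation dual :: (rat_vector) rat_vector
begin
lift_definition zero_dual :: "'a dual" is "\<lambda>_. 0"
  by (simp add: linear_Q_iff Q.scale_zero_right)
lift_definition plus_dual :: "'a dual \<Rightarrow> 'a dual \<Rightarrow> 'a dual" is "\<lambda>f g x. f x + g x"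
  by (simp add: linear_Q_iff Q.scale_right_distrib)
lift_definition minus_dual :: "'a dual \<Rightarrow> 'a dual \<Rightarrow> 'a dual" is "\<lambda>f g x. f x - g x"
  by (simp add: linear_Q_iff Q.scale_right_diff_distrib)
lift_definition uminus_dual :: "'a dual \<Rightarrow> 'a dual" is "\<lambda>f x. - f x"
  by (simp add: linear_Q_iff Q.scale_minus_right)
lift_definition scaleQ_dual :: "rat \<Rightarrow> 'a dual \<Rightarrow> 'a dual" is "\<lambda>c f x. c *\<^sub>Q f x"
  by (simp add: linear_Q_iff Q.scale_right_distrib Q.scale_left_commute)
instance by standard
  (transfer; simp add: fun_eq_iff scaleQ_add_right scaleQ_add_left scaleQ_scaleQ scaleQ_one)+
end


section \<open>Vector spaces given by generators and relations\<close>

text \<open>Tensor products, exterior algebras and graded-symmetric algebras are all built as the free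
  vector space on a type of symbols, modulo the span of a set of relations.\<close>

class presented =
  fixes relations :: "('a \<Rightarrow>\<^sub>0 rat) set"

abbreviation symb :: "'a \<Rightarrow> 'a \<Rightarrow>\<^sub>0 rat" where
  "symb x \<equiv> Poly_Mapping.single x 1"

quotient_type (overloaded) 'a pres = "'a::presented \<Rightarrow>\<^sub>0 rat" /
  "\<lambda>p q. p - q \<in> Q.span relations"
  morphisms rep_pres abs_pres
proof (rule equivpI)
  show "reflp (\<lambda>p q :: 'a \<Rightarrow>\<^sub>0 rat. p - q \<in> Q.span relations)"
    by (simp add: reflp_def Q.span_zero)
  show "symp (\<lambda>p q :: 'a \<Rightarrow>\<^sub>0 rat. p - q \<in> Q.span relations)"
    by (metis (no_types, lifting) Q.span_neg minus_diff_eq sympI)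
  show "transp (\<lambda>p q :: 'a \<Rightarrow>\<^sub>0 rat. p - q \<in> Q.span relations)"
  proof (rule transpI)
    fix p q r :: "'a \<Rightarrow>\<^sub>0 rat"
    assume "p - q \<in> Q.span relations" "q - r \<in> Q.span relations"
    then have "(p - q) + (q - r) \<in> Q.span relations" by (rule Q.span_add)
    then show "p - r \<in> Q.span relations" by simp
  qed
qed

instantiation pres :: (presented) rat_vector
begin
lift_definition zero_pres :: "'a pres" is 0 .
lift_definition plus_pres :: "'a pres \<Rightarrow> 'a pres \<Rightarrow> 'a pres" is "(+)"
  by (metis Q.span_add add_diff_add)
lift_definition minus_pres :: "'a pres \<Rightarrow> 'a pres \<Rightarrow> 'a pres" is "(-)"
proof -
  fix p p' q q' :: "'a \<Rightarrow>\<^sub>0 rat"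
  assume "p - p' \<in> Q.span relations" "q - q' \<in> Q.span relations"
  then have "(p - p') - (q - q') \<in> Q.span relations" by (rule Q.span_diff)
  then show "(p - q) - (p' - q') \<in> Q.span relations" by (simp add: algebra_simps)
qed
lift_definition uminus_pres :: "'a pres \<Rightarrow> 'a pres" is "uminus"
proof -
  fix p q :: "'a \<Rightarrow>\<^sub>0 rat"
  assume "p - q \<in> Q.span relations"
  then have "- (p - q) \<in> Q.span relations" by (rule Q.span_neg)
  then show "- p - - q \<in> Q.span relations" by simp
qed
lift_definition scaleQ_pres :: "rat \<Rightarrow> 'a pres \<Rightarrow> 'a pres" is "scaleQ"
  by (metis Q.scale_right_diff_distrib Q.span_scale)
instance
proof
  fix a b c :: "'a pres" and r s :: rat
  show "a + b + c = a + (b + c)" by transfer (simp add: add.assoc Q.span_zero)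
  show "a + b = b + a" by transfer (simp add: add.commute Q.span_zero)
  show "0 + a = a" by transfer (simp add: Q.span_zero)
  show "- a + a = 0" by transfer (simp add: Q.span_zero)
  show "a - b = a + - b" by transfer (simp add: Q.span_zero)
  show "r *\<^sub>Q (a + b) = r *\<^sub>Q a + r *\<^sub>Q b"
    by transfer (simp add: scaleQ_add_right Q.span_zero)
  show "(r + s) *\<^sub>Q a = r *\<^sub>Q a + s *\<^sub>Q a"
    by transfer (simp add: scaleQ_add_left Q.span_zero)
  show "r *\<^sub>Q s *\<^sub>Q a = (r * s) *\<^sub>Q a" by transfer (simp add: scaleQ_scaleQ Q.span_zero)
  show "1 *\<^sub>Q a = a" by transfer (simp add: scaleQ_one Q.span_zero)
qed
end

definition gen :: "'a::presented \<Rightarrow> 'a pres" where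
  "gen x = abs_pres (symb x)"

definition free_extend :: "('a \<Rightarrow> 'b::rat_vector) \<Rightarrow> ('a \<Rightarrow>\<^sub>0 rat) \<Rightarrow> 'b" where
  "free_extend g p = (\<Sum>x\<in>Poly_Mapping.keys p. Poly_Mapping.lookup p x *\<^sub>Q g x)"

text \<open>The map induced on the quotient by values on the symbols. It is only meaningful if the values
  respect the relations (then it does not depend on the representative, see \<open>lift_gen\<close> and
  \<open>linear_lift\<close> below); this is the case in every use in this theory.\<close>

definition lift :: "('a::presented \<Rightarrow> 'b::rat_vector) \<Rightarrow> 'a pres \<Rightarrow> 'b" where
  "lift g z = free_extend g (rep_pres z)"

definition compatible :: "('a::presented \<Rightarrow> 'b::rat_vector) \<Rightarrow> bool" where
  "compatible g \<longleftrightarrow> (\<forall>r\<in>relations. free_extend g r = 0)"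

lemma free_extend_superset:
  assumes "finite A" "Poly_Mapping.keys p \<subseteq> A"
  shows "free_extend g p = (\<Sum>x\<in>A. Poly_Mapping.lookup p x *\<^sub>Q g x)"
  unfolding free_extend_def using assms
  by (intro sum.mono_neutral_left) (auto simp: in_keys_iff Q.scale_zero_left)

lemma lookup_scaleQ: "Poly_Mapping.lookup (c *\<^sub>Q p) x = c *\<^sub>Q Poly_Mapping.lookup p x"
  by transfer simp

lemma linear_free_extend: "linear_Q (free_extend g)"
  unfolding linear_Q_iff
proof (intro conjI allI)
  fix p q :: "'a \<Rightarrow>\<^sub>0 rat" and c :: rat
  let ?A = "Poly_Mapping.keys p \<union> Poly_Mapping.keys q"
  have "free_extend g (p + q) = (\<Sum>x\<in>?A. Poly_Mapping.lookup (p + q) x *\<^sub>Q g x)"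
    by (rule free_extend_superset) (auto dest: Poly_Mapping.keys_add[THEN subsetD])
  also have "\<dots> = (\<Sum>x\<in>?A. Poly_Mapping.lookup p x *\<^sub>Q g x) + (\<Sum>x\<in>?A. Poly_Mapping.lookup q x *\<^sub>Q g x)"
    by (simp add: lookup_add scaleQ_add_left sum.distrib)
  also have "\<dots> = free_extend g p + free_extend g q"
    by (simp add: free_extend_superset[of ?A])
  finally show "free_extend g (p + q) = free_extend g p + free_extend g q" .
  have "free_extend g (c *\<^sub>Q p) = (\<Sum>x\<in>Poly_Mapping.keys p. Poly_Mapping.lookup (c *\<^sub>Q p) x *\<^sub>Q g x)"
    by (rule free_extend_superset) (auto simp: in_keys_iff lookup_scaleQ Q.scale_zero_right)
  then show "free_extend g (c *\<^sub>Q p) = c *\<^sub>Q free_extend g p"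
    by (simp add: free_extend_def Q.scale_sum_right lookup_scaleQ scaleQ_rat_def scaleQ_scaleQ)
qed

lemma free_extend_symb: "free_extend g (symb x) = g x"
  by (simp add: free_extend_def scaleQ_one)

lemma lift_abs:
  assumes "compatible g"
  shows "lift g (abs_pres p) = free_extend g p"
proof -
  interpret L: Vector_Spaces.linear scaleQ scaleQ "free_extend g" by (rule linear_free_extend)
  have "rep_pres (abs_pres p) - p \<in> Q.span relations"
    using Quotient_rep_abs[OF Quotient_pres] Q.span_zero by (metis diff_self)
  then have "free_extend g (rep_pres (abs_pres p) - p) = 0"
    using L.eq_0_on_span[of relations] assms by (auto simp: compatible_def)
  then show ?thesis by (simp add: lift_def L.diff)
qed

lemma lift_gen: "compatible g \<Longrightarrow> lift g (gen x) = g x"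
  by (simp add: gen_def lift_abs free_extend_symb)

lemma linear_lift:
  assumes "compatible g"
  shows "linear_Q (lift g)"
  unfolding linear_Q_iff
proof (intro conjI allI)
  fix x y :: "'a pres" and c :: rat
  have abs: "abs_pres (rep_pres z) = z" for z :: "'a pres"
    by (rule Quotient_abs_rep[OF Quotient_pres])
  have "x + y = abs_pres (rep_pres x + rep_pres y)"
    by (metis abs plus_pres.abs_eq)
  then have "lift g (x + y) = free_extend g (rep_pres x + rep_pres y)"
    by (simp only: lift_abs[OF assms])
  then show "lift g (x + y) = lift g x + lift g y"
    using linear_free_extend[of g] by (simp add: linear_Q_iff lift_def)
  have "c *\<^sub>Q x = abs_pres (c *\<^sub>Q rep_pres x)"
    by (metis abs scaleQ_pres.abs_eq)
  then have "lift g (c *\<^sub>Q x) = free_extend g (c *\<^sub>Q rep_pres x)"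
    by (simp only: lift_abs[OF assms])
  then show "lift g (c *\<^sub>Q x) = c *\<^sub>Q lift g x"
    using linear_free_extend[of g] by (simp add: linear_Q_iff lift_def)
qed


section \<open>Tensor products and exterior algebras\<close>

datatype ('a, 'b) tensor_sym = Tensor 'a 'b

instantiation tensor_sym :: (rat_vector, rat_vector) presented
begin
definition relations_tensor_sym :: "(('a, 'b) tensor_sym \<Rightarrow>\<^sub>0 rat) set" where
  "relations_tensor_sym =
     {symb (Tensor (x + x') y) - symb (Tensor x y) - symb (Tensor x' y) | x x' y. True} \<union>
     {symb (Tensor x (y + y')) - symb (Tensor x y) - symb (Tensor x y') | x y y'. True} \<union>
     {symb (Tensor (c *\<^sub>Q x) y) - c *\<^sub>Q symb (Tensor x y) | c x y. True} \<union>
     {symb (Tensor x (c *\<^sub>Q y)) - c *\<^sub>Q symb (Tensor x y) | c x y. True}"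
instance ..
end

type_synonym ('a, 'b) tensor = "('a, 'b) tensor_sym pres"

definition tensor :: "'a::rat_vector \<Rightarrow> 'b::rat_vector \<Rightarrow> ('a, 'b) tensor" (infixr "\<otimes>" 70) where
  "x \<otimes> y = gen (Tensor x y)"

definition tensor_lift ::
  "('a::rat_vector \<Rightarrow> 'b::rat_vector \<Rightarrow> 'c::rat_vector) \<Rightarrow> ('a, 'b) tensor \<Rightarrow> 'c" where
  "tensor_lift h = lift (\<lambda>t. case t of Tensor x y \<Rightarrow> h x y)"

definition tensor_map ::
  "('a::rat_vector \<Rightarrow> 'c::rat_vector) \<Rightarrow> ('b::rat_vector \<Rightarrow> 'd::rat_vector) \<Rightarrow>
   ('a, 'b) tensor \<Rightarrow> ('c, 'd) tensor" where
  "tensor_map f g = tensor_lift (\<lambda>x y. f x \<otimes> g y)"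

datatype 'a wedge_sym = Wedge "'a list"

instantiation wedge_sym :: (rat_vector) presented
begin
definition relations_wedge_sym :: "('a wedge_sym \<Rightarrow>\<^sub>0 rat) set" where
  "relations_wedge_sym =
     {symb (Wedge (xs @ [x + y] @ ys)) - symb (Wedge (xs @ [x] @ ys)) - symb (Wedge (xs @ [y] @ ys))
       | xs x y ys. True} \<union>
     {symb (Wedge (xs @ [c *\<^sub>Q x] @ ys)) - c *\<^sub>Q symb (Wedge (xs @ [x] @ ys)) | c xs x ys. True} \<union>
     {symb (Wedge (xs @ [x, x] @ ys)) | xs x ys. True}"
instance ..
end

type_synonym 'a ext = "'a wedge_sym pres"

text \<open>\<open>wedge [x\<^sub>1, \<dots>, x\<^sub>i]\<close> is the exterior monomial of the \<open>x\<^sub>j\<close>, and \<open>wedge []\<close> is the unit.\<close>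

definition wedge :: "'a::rat_vector list \<Rightarrow> 'a ext" where
  "wedge xs = gen (Wedge xs)"

definition ext_lift :: "('a::rat_vector list \<Rightarrow> 'b::rat_vector) \<Rightarrow> 'a ext \<Rightarrow> 'b" where
  "ext_lift h = lift (\<lambda>w. case w of Wedge xs \<Rightarrow> h xs)"

definition ext_part :: "nat \<Rightarrow> 'a::rat_vector ext set" where
  "ext_part i = Q.span {wedge xs | xs. length xs = i}"

definition ext_map :: "('a::rat_vector \<Rightarrow> 'b::rat_vector) \<Rightarrow> 'a ext \<Rightarrow> 'b ext" where
  "ext_map f = ext_lift (\<lambda>xs. wedge (map f xs))"

text \<open>Shuffles as permutations of \<open>{..<p + q}\<close>: positions are counted from 0.\<close>

definition Sh :: "nat \<Rightarrow> nat \<Rightarrow> (nat \<Rightarrow> nat) set" where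
  "Sh p q = {\<sigma>. \<sigma> permutes {..<p + q} \<and> strict_mono_on {..<p} \<sigma> \<and> strict_mono_on {p..<p + q} \<sigma>}"

definition ext_coprod :: "'a::rat_vector ext \<Rightarrow> ('a ext, 'a ext) tensor" where
  "ext_coprod = ext_lift (\<lambda>xs. let i = length xs in
     \<Sum>p\<le>i. \<Sum>\<sigma>\<in>Sh p (i - p). of_int (sign \<sigma>) *\<^sub>Q
       (wedge (map (\<lambda>j. xs ! \<sigma> j) [0..<p]) \<otimes> wedge (map (\<lambda>j. xs ! \<sigma> j) [p..<i])))"

definition ext_counit :: "'a::rat_vector ext \<Rightarrow> rat" where
  "ext_counit = ext_lift (\<lambda>xs. if xs = [] then 1 else 0)"

definition coalgebra_map ::
  "('a::rat_vector \<Rightarrow> ('a, 'a) tensor) \<Rightarrow> ('a \<Rightarrow> rat) \<Rightarrow>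
   ('b::rat_vector \<Rightarrow> ('b, 'b) tensor) \<Rightarrow> ('b \<Rightarrow> rat) \<Rightarrow> ('a \<Rightarrow> 'b) \<Rightarrow> bool" where
  "coalgebra_map \<Delta>A \<epsilon>A \<Delta>B \<epsilon>B f \<longleftrightarrow>
     linear_Q f \<and> (\<forall>z. \<Delta>B (f z) = tensor_map f f (\<Delta>A z)) \<and> (\<forall>z. \<epsilon>B (f z) = \<epsilon>A z)"


section \<open>The representations \<open>U\<^sub>i\<close>\<close>

type_synonym 'n H = "rat ^ 'n"
type_synonym 'n ext_dual = "('n H ext, 'n H dual) tensor"

text \<open>\<open>U\<^sub>i\<close> is the subspace \<open>\<Lambda>\<^sup>i\<^sup>+\<^sup>1H \<otimes> H\<^sup>*\<close> of \<open>\<Lambda>\<^sup>*H \<otimes> H\<^sup>*\<close>.\<close>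

definition Upart :: "nat \<Rightarrow> 'n::finite ext_dual set" where
  "Upart i = Q.span {wedge as \<otimes> d | as d. length as = Suc i}"

typedef 'n U = "Upart 1 :: 'n::finite ext_dual set"
  by (rule exI[of _ 0]) (simp add: Upart_def Q.span_zero)

setup_lifting type_definition_U

instantiation U :: (finite) rat_vector
begin
lift_definition zero_U :: "'a U" is 0 by (simp add: Upart_def Q.span_zero)
lift_definition plus_U :: "'a U \<Rightarrow> 'a U \<Rightarrow> 'a U" is "(+)" by (simp add: Upart_def Q.span_add)
lift_definition minus_U :: "'a U \<Rightarrow> 'a U \<Rightarrow> 'a U" is "(-)" by (simp add: Upart_def Q.span_diff)
lift_definition uminus_U :: "'a U \<Rightarrow> 'a U" is "uminus" by (simp add: Upart_def Q.span_neg)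
lift_definition scaleQ_U :: "rat \<Rightarrow> 'a U \<Rightarrow> 'a U" is "scaleQ" by (simp add: Upart_def Q.span_scale)
instance by standard
  (transfer; simp add: scaleQ_add_right scaleQ_add_left scaleQ_scaleQ scaleQ_one)+
end

text \<open>The contraction \<open>\<Lambda>\<^sup>i\<^sup>+\<^sup>1H \<otimes> H\<^sup>* \<rightarrow> \<Lambda>\<^sup>iH\<close> (with the sign convention of the interior product; only
  its kernel matters).\<close>

definition contraction :: "'n::finite ext_dual \<Rightarrow> 'n H ext" where
  "contraction = tensor_lift (\<lambda>w d. ext_lift (\<lambda>as.
     \<Sum>j<length as. ((- 1) ^ j * dual_apply d (as ! j)) *\<^sub>Q wedge (take j as @ drop (Suc j) as)) w)"

definition Utree :: "nat \<Rightarrow> 'n::finite ext_dual set" where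
  "Utree i = {u \<in> Upart i. contraction u = 0}"

text \<open>Actions of an invertible matrix \<open>g\<close>.\<close>

lift_definition gl_dual :: "rat ^ 'n ^ 'n \<Rightarrow> 'n::finite H dual \<Rightarrow> 'n H dual"
  is "\<lambda>g d h. d (matrix_inv g *v h)"
proof -
  fix g :: "rat ^ 'n ^ 'n" and d :: "'n H \<Rightarrow> rat"
  have "g *v (c *\<^sub>Q x) = c *\<^sub>Q (g *v x)" for g :: "rat ^ 'n ^ 'n" and c x
    by (simp add: vec_eq_iff scaleQ_vec_def scaleQ_rat_def matrix_vector_mult_def sum_distrib_left
        mult_ac)
  then show "linear_Q d \<Longrightarrow> linear_Q (\<lambda>h. d (matrix_inv g *v h))"
    by (simp add: linear_Q_iff matrix_vector_right_distrib)
qed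

definition gl_extH :: "rat ^ 'n ^ 'n \<Rightarrow> 'n::finite H ext \<Rightarrow> 'n H ext" where
  "gl_extH g = ext_map ((*v) g)"

definition gl_ext_dual :: "rat ^ 'n ^ 'n \<Rightarrow> 'n::finite ext_dual \<Rightarrow> 'n ext_dual" where
  "gl_ext_dual g = tensor_map (gl_extH g) (gl_dual g)"

definition gl_U :: "rat ^ 'n ^ 'n \<Rightarrow> 'n::finite U \<Rightarrow> 'n U" where
  "gl_U g u = Abs_U (gl_ext_dual g (Rep_U u))"

definition gl_extU :: "rat ^ 'n ^ 'n \<Rightarrow> 'n::finite U ext \<Rightarrow> 'n U ext" where
  "gl_extU g = ext_map (gl_U g)"

text \<open>\<open>\<theta> i\<close> identifies \<open>\<Lambda>\<^sup>iH\<close> with \<open>U\<^sub>i\<^sup>w\<^sup>h\<^sup>e\<^sup>e\<^sup>l\<close>, which is the image of \<open>\<theta> i\<close>; such an identification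
  is unique only up to a nonzero scalar for each \<open>i\<close>, and none is preferred. One exists by
  \<open>wheel_identification_wheel_embedding\<close> below.\<close>

definition wheel_identification :: "(nat \<Rightarrow> 'n::finite H ext \<Rightarrow> 'n ext_dual) \<Rightarrow> bool" where
  "wheel_identification \<theta> \<longleftrightarrow> (\<forall>i. 1 \<le> i \<and> i < CARD('n) \<longrightarrow>
     (\<forall>x\<in>ext_part i. \<forall>y\<in>ext_part i. \<theta> i (x + y) = \<theta> i x + \<theta> i y) \<and>
     (\<forall>c. \<forall>x\<in>ext_part i. \<theta> i (c *\<^sub>Q x) = c *\<^sub>Q \<theta> i x) \<and>
     (\<forall>g. invertible g \<longrightarrow> (\<forall>x\<in>ext_part i. \<theta> i (gl_extH g x) = gl_ext_dual g (\<theta> i x))) \<and>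
     inj_on (\<theta> i) (ext_part i) \<and>
     Upart i = {t + w | t w. t \<in> Utree i \<and> w \<in> \<theta> i ` ext_part i} \<and>
     Utree i \<inter> \<theta> i ` ext_part i = {0})"

section \<open>The graded-symmetric algebra of \<open>U\<^sub>*\<close>\<close>

text \<open>Homogeneous elements of \<open>U\<^sub>*\<close>, as pairs of a degree and an element of that degree.\<close>

typedef 'n Uhom = "{(i, u :: 'n::finite ext_dual). 1 \<le> i \<and> u \<in> Upart i}"
  by (rule exI[of _ "(1, 0)"]) (simp add: Upart_def Q.span_zero)

definition deg :: "'n::finite Uhom \<Rightarrow> nat" where "deg x = fst (Rep_Uhom x)"
definition val :: "'n::finite Uhom \<Rightarrow> 'n ext_dual" where "val x = snd (Rep_Uhom x)"
definition hom_elt :: "nat \<Rightarrow> 'n::finite ext_dual \<Rightarrow> 'n Uhom" where "hom_elt i u = Abs_Uhom (i, u)"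

datatype 'n S_sym = Mono "'n Uhom list"

text \<open>Words in homogeneous elements, linear in each letter within each degree, modulo
  \<open>y x = (- 1) ^ (j * k) x y\<close>.\<close>

instantiation S_sym :: (finite) presented
begin
definition relations_S_sym :: "('a S_sym \<Rightarrow>\<^sub>0 rat) set" where
  "relations_S_sym =
     {symb (Mono (xs @ [z] @ ys)) - symb (Mono (xs @ [x] @ ys)) - symb (Mono (xs @ [y] @ ys))
       | xs x y z ys. deg x = deg z \<and> deg y = deg z \<and> val z = val x + val y} \<union>
     {symb (Mono (xs @ [z] @ ys)) - c *\<^sub>Q symb (Mono (xs @ [x] @ ys))
       | c xs x z ys. deg x = deg z \<and> val z = c *\<^sub>Q val x} \<union>
     {symb (Mono (xs @ [y, x] @ ys)) - (- 1) ^ (deg x * deg y) *\<^sub>Q symb (Mono (xs @ [x, y] @ ys))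
       | xs x y ys. True}"
instance ..
end

type_synonym 'n S = "'n S_sym pres"

definition sprod :: "'n::finite Uhom list \<Rightarrow> 'n S" where
  "sprod xs = gen (Mono xs)"

definition S_lift :: "('n::finite Uhom list \<Rightarrow> 'b::rat_vector) \<Rightarrow> 'n S \<Rightarrow> 'b" where
  "S_lift h = lift (\<lambda>m. case m of Mono xs \<Rightarrow> h xs)"

definition S_part :: "nat \<Rightarrow> 'n::finite S set" where
  "S_part i = Q.span {sprod xs | xs. sum_list (map deg xs) = i}"

definition koszul_sign :: "(nat \<Rightarrow> nat) \<Rightarrow> 'n::finite Uhom list \<Rightarrow> rat" where
  "koszul_sign \<sigma> xs =
     (\<Prod>(a, b) \<in> {(a, b). a < b \<and> b < length xs \<and> \<sigma> b < \<sigma> a}.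
        (- 1) ^ (deg (xs ! \<sigma> a) * deg (xs ! \<sigma> b)))"

definition S_coprod :: "'n::finite S \<Rightarrow> ('n S, 'n S) tensor" where
  "S_coprod = S_lift (\<lambda>xs. let k = length xs in
     \<Sum>p\<le>k. \<Sum>\<sigma>\<in>Sh p (k - p). koszul_sign \<sigma> xs *\<^sub>Q
       (sprod (map (\<lambda>j. xs ! \<sigma> j) [0..<p]) \<otimes> sprod (map (\<lambda>j. xs ! \<sigma> j) [p..<k])))"

definition S_counit :: "'n::finite S \<Rightarrow> rat" where
  "S_counit = S_lift (\<lambda>xs. if xs = [] then 1 else 0)"

definition gl_S :: "rat ^ 'n ^ 'n \<Rightarrow> 'n::finite S \<Rightarrow> 'n S" where
  "gl_S g = S_lift (\<lambda>xs. sprod (map (\<lambda>x. hom_elt (deg x) (gl_ext_dual g (val x))) xs))"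


section \<open>The spaces \<open>M\<^sub>i\<close> and the contractions\<close>

text \<open>The symbol \<open>MSym [(a\<^sub>1, b\<^sub>1, d\<^sub>1), \<dots>, (a\<^sub>i, b\<^sub>i, d\<^sub>i)]\<close> stands for the pure tensor
  \<open>(a\<^sub>1 \<otimes> b\<^sub>1 \<otimes> d\<^sub>1) \<otimes> \<cdots> \<otimes> (a\<^sub>i \<otimes> b\<^sub>i \<otimes> d\<^sub>i)\<close> in \<open>M\<^sub>i = (H \<otimes> H \<otimes> H\<^sup>*)\<^sup>\<otimes>\<^sup>i\<close>, subject to
  linearity in each of the \<open>3 i\<close> arguments; the quotient is the sum of all \<open>M\<^sub>i\<close>.\<close>

datatype 'n M_sym = MSym "('n H \<times> 'n H \<times> 'n H dual) list"

instantiation M_sym :: (finite) presented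
begin
definition relations_M_sym :: "('a M_sym \<Rightarrow>\<^sub>0 rat) set" where
  "relations_M_sym =
     {symb (MSym (xs @ [(a + a', b, d)] @ ys)) - symb (MSym (xs @ [(a, b, d)] @ ys))
       - symb (MSym (xs @ [(a', b, d)] @ ys)) | xs a a' b d ys. True} \<union>
     {symb (MSym (xs @ [(a, b + b', d)] @ ys)) - symb (MSym (xs @ [(a, b, d)] @ ys))
       - symb (MSym (xs @ [(a, b', d)] @ ys)) | xs a b b' d ys. True} \<union>
     {symb (MSym (xs @ [(a, b, d + d')] @ ys)) - symb (MSym (xs @ [(a, b, d)] @ ys))
       - symb (MSym (xs @ [(a, b, d')] @ ys)) | xs a b d d' ys. True} \<union>
     {symb (MSym (xs @ [(c *\<^sub>Q a, b, d)] @ ys)) - c *\<^sub>Q symb (MSym (xs @ [(a, b, d)] @ ys))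
       | c xs a b d ys. True} \<union>
     {symb (MSym (xs @ [(a, c *\<^sub>Q b, d)] @ ys)) - c *\<^sub>Q symb (MSym (xs @ [(a, b, d)] @ ys))
       | c xs a b d ys. True} \<union>
     {symb (MSym (xs @ [(a, b, c *\<^sub>Q d)] @ ys)) - c *\<^sub>Q symb (MSym (xs @ [(a, b, d)] @ ys))
       | c xs a b d ys. True}"
instance ..
end

type_synonym 'n M = "'n M_sym pres"

definition mtensor :: "('n::finite H \<times> 'n H \<times> 'n H dual) list \<Rightarrow> 'n M" where
  "mtensor ts = gen (MSym ts)"

definition M_lift ::
  "(('n::finite H \<times> 'n H \<times> 'n H dual) list \<Rightarrow> 'b::rat_vector) \<Rightarrow> 'n M \<Rightarrow> 'b" where
  "M_lift h = lift (\<lambda>m. case m of MSym ts \<Rightarrow> h ts)"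

definition M_mult :: "'n::finite M \<Rightarrow> 'n M \<Rightarrow> 'n M" where
  "M_mult x y = M_lift (\<lambda>ss. M_lift (\<lambda>ts. mtensor (ss @ ts)) y) x"

definition \<phi> :: "'n::finite U \<Rightarrow> 'n M" where
  "\<phi> u = tensor_lift (\<lambda>w d. ext_lift (\<lambda>as. case as of
       [a, b] \<Rightarrow> mtensor [(a, b, d)] - mtensor [(b, a, d)] | _ \<Rightarrow> 0) w) (Rep_U u)"

definition \<iota> :: "'n::finite U ext \<Rightarrow> 'n M" where
  "\<iota> = ext_lift (\<lambda>us. \<Sum>\<sigma> | \<sigma> permutes {..<length us}. of_int (sign \<sigma>) *\<^sub>Q
     foldr M_mult (map (\<lambda>j. \<phi> (us ! \<sigma> j)) [0..<length us]) (mtensor []))"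

text \<open>Maps out of \<open>M\<^sub>i\<close> are extended by 0 to the other summands of \<^typ>\<open>'n M\<close>. Triples are indexed
  from 0, so \<open>ts ! (j - 1)\<close> is the \<open>j\<close>-th factor.\<close>

abbreviation fac_a :: "('n::finite H \<times> 'n H \<times> 'n H dual) \<Rightarrow> 'n H" where
  "fac_a t \<equiv> fst t"
abbreviation fac_b :: "('n::finite H \<times> 'n H \<times> 'n H dual) \<Rightarrow> 'n H" where
  "fac_b t \<equiv> fst (snd t)"
abbreviation fac_d :: "('n::finite H \<times> 'n H \<times> 'n H dual) \<Rightarrow> 'n H dual" where
  "fac_d t \<equiv> snd (snd t)"

definition c_map :: "nat \<Rightarrow> 'n::finite M \<Rightarrow> 'n ext_dual" where
  "c_map i = M_lift (\<lambda>ts. if length ts = i then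
     (\<Prod>j\<in>{1..<i}. dual_apply (fac_d (ts ! j)) (fac_b (ts ! (j - 1)))) *\<^sub>Q
     (wedge (map fac_a ts @ [fac_b (last ts)]) \<otimes> fac_d (hd ts)) else 0)"

definition c_tree :: "(nat \<Rightarrow> 'n::finite H ext \<Rightarrow> 'n ext_dual) \<Rightarrow> nat \<Rightarrow> 'n M \<Rightarrow> 'n ext_dual" where
  "c_tree \<theta> i z = (if i < CARD('n)
     then THE t. t \<in> Utree i \<and> c_map i z - t \<in> \<theta> i ` ext_part i else 0)"

definition c_wheel_ext :: "nat \<Rightarrow> 'n::finite M \<Rightarrow> 'n H ext" where
  "c_wheel_ext i = M_lift (\<lambda>ts. if length ts = i then
     (dual_apply (fac_d (hd ts)) (fac_b (last ts)) *
      (\<Prod>j\<in>{1..<i}. dual_apply (fac_d (ts ! j)) (fac_b (ts ! (j - 1))))) *\<^sub>Q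
     wedge (map fac_a ts) else 0)"

definition c_wheel :: "(nat \<Rightarrow> 'n::finite H ext \<Rightarrow> 'n ext_dual) \<Rightarrow> nat \<Rightarrow> 'n M \<Rightarrow> 'n ext_dual" where
  "c_wheel \<theta> i z = (if i < CARD('n) then \<theta> i (c_wheel_ext i z) else 0)"


section \<open>The map \<open>F\<^sub>*\<close>\<close>

text \<open>Partitions are weakly decreasing lists of positive parts.\<close>

definition bipartitions :: "nat \<Rightarrow> (nat list \<times> nat list) set" where
  "bipartitions i = {(\<mu>, \<nu>). sorted_wrt (\<ge>) \<mu> \<and> sorted_wrt (\<ge>) \<nu> \<and> 0 \<notin> set \<mu> \<and> 0 \<notin> set \<nu> \<and>
     sum_list \<mu> + sum_list \<nu> = i}"

fun blocks :: "nat list \<Rightarrow> 'a list \<Rightarrow> 'a list list" where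
  "blocks [] ts = []"
| "blocks (m # ms) ts = take m ts # blocks ms (drop m ts)"

text \<open>\<open>mult_factor \<mu>\<close> is the product of the \<open>1 / k!\<close> over the multiplicities \<open>k\<close> of the distinct parts.\<close>

definition mult_factor :: "nat list \<Rightarrow> rat" where
  "mult_factor \<mu> = (\<Prod>m\<in>set \<mu>. 1 / fact (count_list \<mu> m))"

text \<open>\<open>U\<^sup>t\<^sup>r\<^sup>e\<^sup>e\<^sub>\<mu> \<otimes> U\<^sup>w\<^sup>h\<^sup>e\<^sup>e\<^sup>l\<^sub>\<nu>\<close> is regarded as a summand of \<open>S\<^sup>*(U\<^sub>*)\<close> via multiplication.\<close>

definition F_pair ::
  "(nat \<Rightarrow> 'n::finite H ext \<Rightarrow> 'n ext_dual) \<Rightarrow> nat list \<times> nat list \<Rightarrow> 'n U ext \<Rightarrow> 'n S" where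
  "F_pair \<theta> = (\<lambda>(\<mu>, \<nu>) z. M_lift (\<lambda>ts. if length ts = sum_list \<mu> + sum_list \<nu> then
     (mult_factor \<mu> * mult_factor \<nu>) *\<^sub>Q sprod
       (map2 (\<lambda>m t. hom_elt m (c_tree \<theta> m (mtensor t))) \<mu> (blocks \<mu> ts) @
        map2 (\<lambda>m t. hom_elt m (c_wheel \<theta> m (mtensor t))) \<nu> (blocks \<nu> (drop (sum_list \<mu>) ts)))
     else 0) (\<iota> z))"

definition F_deg :: "(nat \<Rightarrow> 'n::finite H ext \<Rightarrow> 'n ext_dual) \<Rightarrow> nat \<Rightarrow> 'n U ext \<Rightarrow> 'n S" where
  "F_deg \<theta> i z = (\<Sum>\<mu>\<nu>\<in>bipartitions i. F_pair \<theta> \<mu>\<nu> z)"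

definition F_star :: "(nat \<Rightarrow> 'n::finite H ext \<Rightarrow> 'n ext_dual) \<Rightarrow> 'n U ext \<Rightarrow> 'n S" where
  "F_star \<theta> = ext_lift (\<lambda>us. F_deg \<theta> (length us) (wedge us))"


section \<open>Existence of a wheel identification\<close>

lemma free_extend_add: "free_extend g (p + q) = free_extend g p + free_extend g q"
  and free_extend_scale: "free_extend g (c *\<^sub>Q p) = c *\<^sub>Q free_extend g p"
  using linear_free_extend[of g] by (auto simp: linear_Q_iff)

lemma free_extend_diff: "free_extend g (p - q) = free_extend g p - free_extend g q"
  using free_extend_add[of g "p - q" q] by simp

lemmas free_extend_simps = free_extend_diff free_extend_scale free_extend_symb

lemma linear_Q_D:
  assumes "linear_Q f"
  shows "f (x + y) = f x + f y" "f (c *\<^sub>Q x) = c *\<^sub>Q f x" "f 0 = 0" "f (x - y) = f x - f y"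
    "f (sum h A) = (\<Sum>a\<in>A. f (h a))"
proof -
  interpret Vector_Spaces.linear scaleQ scaleQ f by fact
  show "f (x + y) = f x + f y" "f (c *\<^sub>Q x) = c *\<^sub>Q f x" "f 0 = 0" "f (x - y) = f x - f y"
    "f (sum h A) = (\<Sum>a\<in>A. f (h a))"
    by (simp_all add: add scale diff sum zero)
qed

lemma linear_Q_eq_on_span:
  assumes "linear_Q f" "linear_Q g" "\<And>x. x \<in> B \<Longrightarrow> f x = g x" "x \<in> Q.span B"
  shows "f x = g x"
proof -
  interpret f: Vector_Spaces.linear scaleQ scaleQ f by fact
  interpret g: Vector_Spaces.linear scaleQ scaleQ g by fact
  interpret vector_space_pair "scaleQ :: rat \<Rightarrow> 'a \<Rightarrow> 'a" "scaleQ :: rat \<Rightarrow> 'b \<Rightarrow> 'b" ..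
  from assms(4) show ?thesis
    by (induction rule: Q.span_induct_alt)
       (simp_all add: linear_Q_D[OF assms(1)] linear_Q_D[OF assms(2)] assms(3))
qed

lemma linear_Q_span_subset:
  assumes "linear_Q f" "\<And>x. x \<in> B \<Longrightarrow> f x \<in> Q.span C" "x \<in> Q.span B"
  shows "f x \<in> Q.span C"
  using assms(3)
  by (induction rule: Q.span_induct_alt)
     (simp_all add: linear_Q_D[OF assms(1)] assms(2) Q.span_zero Q.span_add Q.span_scale)

definition bilinear_Q :: "('a::rat_vector \<Rightarrow> 'b::rat_vector \<Rightarrow> 'c::rat_vector) \<Rightarrow> bool" where
  "bilinear_Q h \<longleftrightarrow> (\<forall>y. linear_Q (\<lambda>x. h x y)) \<and> (\<forall>x. linear_Q (h x))"

lemma compatible_tensor: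
  "bilinear_Q h \<Longrightarrow> compatible (\<lambda>t. case t of Tensor x y \<Rightarrow> h x y)"
  unfolding compatible_def relations_tensor_sym_def
  by (auto simp: free_extend_simps bilinear_Q_def linear_Q_iff)

lemma tensor_lift_tensor: "bilinear_Q h \<Longrightarrow> tensor_lift h (x \<otimes> y) = h x y"
  by (simp add: tensor_lift_def tensor_def lift_gen compatible_tensor)

lemma linear_tensor_lift: "bilinear_Q h \<Longrightarrow> linear_Q (tensor_lift h)"
  by (simp add: tensor_lift_def linear_lift compatible_tensor)

lemma gen_relation_zero: "p \<in> Q.span relations \<Longrightarrow> abs_pres p = 0"
  by (simp add: zero_pres_def pres.abs_eq_iff)

lemma bilinear_tensor: "bilinear_Q (\<otimes>)"
proof -
  have "abs_pres p = abs_pres q" if "p - q \<in> relations" for p q :: "('a, 'b) tensor_sym \<Rightarrow>\<^sub>0 rat"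
    using that by (simp add: pres.abs_eq_iff Q.span_base)
  note * = this
  show ?thesis
    unfolding bilinear_Q_def linear_Q_iff tensor_def gen_def plus_pres.abs_eq scaleQ_pres.abs_eq
    by (intro conjI allI *; force simp: relations_tensor_sym_def diff_diff_eq)
qed

definition alternating :: "('a::rat_vector list \<Rightarrow> 'b::rat_vector) \<Rightarrow> bool" where
  "alternating h \<longleftrightarrow> (\<forall>xs ys. linear_Q (\<lambda>x. h (xs @ x # ys))) \<and> (\<forall>xs x ys. h (xs @ x # x # ys) = 0)"

lemma compatible_wedge:
  "alternating h \<Longrightarrow> compatible (\<lambda>w. case w of Wedge xs \<Rightarrow> h xs)"
  unfolding compatible_def relations_wedge_sym_def
  by (auto simp: free_extend_simps alternating_def linear_Q_iff)

lemma ext_lift_wedge: "alternating h \<Longrightarrow> ext_lift h (wedge xs) = h xs"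
  by (simp add: ext_lift_def wedge_def lift_gen compatible_wedge)

lemma linear_ext_lift: "alternating h \<Longrightarrow> linear_Q (ext_lift h)"
  by (simp add: ext_lift_def linear_lift compatible_wedge)

lemma alternating_wedge: "alternating wedge"
proof -
  have *: "abs_pres p = abs_pres q" if "p - q \<in> relations" for p q :: "'a wedge_sym \<Rightarrow>\<^sub>0 rat"
    using that by (simp add: pres.abs_eq_iff Q.span_base)
  show ?thesis
    unfolding alternating_def linear_Q_iff wedge_def gen_def plus_pres.abs_eq scaleQ_pres.abs_eq
      zero_pres_def
    by (intro conjI allI *; force simp: relations_wedge_sym_def diff_diff_eq)
qed

lemma linear_wedge_slot: "linear_Q (\<lambda>x. wedge (xs @ x # ys))"
  using alternating_wedge unfolding alternating_def by blast

lemma wedge_eq: "wedge (xs @ x # x # ys) = 0"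
  using alternating_wedge unfolding alternating_def by blast

lemma wedge_swap: "wedge (xs @ x # y # ys) = - wedge (xs @ y # x # ys)"
proof -
  have "0 = wedge (xs @ (x + y) # (x + y) # ys)" by (simp add: wedge_eq)
  also have "\<dots> = wedge (xs @ x # (x + y) # ys) + wedge (xs @ y # (x + y) # ys)"
    by (rule linear_Q_D(1)[OF linear_wedge_slot])
  also have "\<dots> = wedge (xs @ x # x # ys) + wedge (xs @ x # y # ys)
      + (wedge (xs @ y # x # ys) + wedge (xs @ y # y # ys))"
    using linear_Q_D(1)[OF linear_wedge_slot[of "xs @ [x]" ys], of x y]
      linear_Q_D(1)[OF linear_wedge_slot[of "xs @ [y]" ys], of x y] by simp
  finally show ?thesis by (simp add: wedge_eq eq_neg_iff_add_eq_0)
qed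

lemma minus_one_scale: "(- 1) *\<^sub>Q x = - (x :: 'a::rat_vector)"
  by (simp add: Q.scale_minus_left scaleQ_one)

lemma wedge_move: "wedge (xs @ x # ys) = (- 1) ^ length ys *\<^sub>Q wedge (xs @ ys @ [x])"
proof (induction ys arbitrary: xs)
  case Nil
  then show ?case by (simp add: scaleQ_one)
next
  case (Cons y ys)
  have "wedge (xs @ x # y # ys) = - wedge ((xs @ [y]) @ x # ys)"
    by (simp add: wedge_swap[of xs x y])
  also have "\<dots> = (- 1) ^ length (y # ys) *\<^sub>Q wedge (xs @ (y # ys) @ [x])"
    by (subst Cons) (simp add: Q.scale_minus_left)
  finally show ?case .
qed

lemma linear_Q_compose: "linear_Q f \<Longrightarrow> linear_Q g \<Longrightarrow> linear_Q (\<lambda>x. f (g x))"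
  by (simp add: linear_Q_iff)

lemma linear_Q_sum: "(\<And>a. a \<in> A \<Longrightarrow> linear_Q (f a)) \<Longrightarrow> linear_Q (\<lambda>x. \<Sum>a\<in>A. f a x)"
  by (simp add: linear_Q_iff sum.distrib Q.scale_sum_right)

lemma linear_Q_scaled: "linear_Q f \<Longrightarrow> linear_Q (\<lambda>x. c *\<^sub>Q f x)"
  by (simp add: linear_Q_iff scaleQ_add_right Q.scale_left_commute)

lemma linear_Q_scale_by: "linear_Q d \<Longrightarrow> linear_Q (\<lambda>x. (c * d x) *\<^sub>Q w)"
  by (simp add: linear_Q_iff scaleQ_rat_def scaleQ_add_left scaleQ_scaleQ algebra_simps)

lemma linear_dual_apply: "linear_Q (dual_apply d)"
  using dual_apply[of d] by simp

abbreviation contr_list :: "'a::rat_vector dual \<Rightarrow> 'a list \<Rightarrow> 'a ext" where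
  "contr_list d as \<equiv>
    (\<Sum>j<length as. ((- 1) ^ j * dual_apply d (as ! j)) *\<^sub>Q wedge (take j as @ drop (Suc j) as))"

lemma alternating_contr_list: "alternating (contr_list d)"
  unfolding alternating_def
proof (intro conjI allI)
  fix xs ys :: "'a list"
  show "linear_Q (\<lambda>x. contr_list d (xs @ x # ys))"
  proof -
    have "linear_Q (\<lambda>x. ((- 1) ^ j * dual_apply d ((xs @ x # ys) ! j)) *\<^sub>Q
        wedge (take j (xs @ x # ys) @ drop (Suc j) (xs @ x # ys)))" for j
    proof -
      consider "j < length xs" | "j = length xs" | "j > length xs" by linarith
      then show ?thesis
      proof cases
        case 1
        then show ?thesis
          using linear_Q_scaled[OF linear_wedge_slot[of "take j xs @ drop (Suc j) xs" ys],
              of "(- 1) ^ j * dual_apply d (xs ! j)"]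
          by (simp add: nth_append Suc_le_eq)
      next
        case 2
        then show ?thesis
          using linear_Q_scale_by[OF linear_dual_apply] by simp
      next
        case 3
        then obtain k where k: "j = Suc (length xs + k)"
          by (metis add.commute add_Suc_right less_imp_Suc_add)
        show ?thesis
          using linear_Q_scaled[OF linear_wedge_slot[of xs "take k ys @ drop (Suc k) ys"],
              of "(- 1) ^ j * dual_apply d (ys ! k)"]
          by (simp add: k nth_append)
      qed
    qed
    then have "linear_Q (\<lambda>x. \<Sum>j<length (xs @ undefined # ys).
        ((- 1) ^ j * dual_apply d ((xs @ x # ys) ! j)) *\<^sub>Q
        wedge (take j (xs @ x # ys) @ drop (Suc j) (xs @ x # ys)))"
      by (intro linear_Q_sum)
    then show ?thesis by simp
  qed
next
  fix xs ys :: "'a list" and x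
  let ?as = "xs @ x # x # ys" and ?p = "length xs"
  let ?t = "\<lambda>j. ((- 1) ^ j * dual_apply d (?as ! j)) *\<^sub>Q wedge (take j ?as @ drop (Suc j) ?as)"
  have "?t j = 0" if "j \<noteq> ?p" "j \<noteq> Suc ?p" for j
  proof (cases "j < ?p")
    case True
    then show ?thesis
      using wedge_eq[of "take j xs @ drop (Suc j) xs" x ys] by (simp add: Suc_le_eq Q.scale_zero_right)
  next
    case False
    with that obtain k where k: "j = Suc (Suc (length xs + k))"
      by (metis add.commute add_Suc_right less_imp_Suc_add linorder_neqE_nat not_less_eq)
    show ?thesis
      using wedge_eq[of xs x "take k ys @ drop (Suc k) ys"]
      by (simp add: k numeral_3_eq_3 Q.scale_zero_right)
  qed
  then have "contr_list d ?as = (\<Sum>j\<in>{?p, Suc ?p}. ?t j)"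
    by (intro sum.mono_neutral_right) auto
  also have "\<dots> = ?t ?p + ?t (Suc ?p)"
    by (subst sum.insert) (simp_all only: finite.intros sum.insert sum.empty add_0_right, simp_all)
  also have "?t (Suc ?p) = - ?t ?p"
    by (simp add: nth_append Q.scale_minus_left)
  finally show "contr_list d ?as = 0" by (simp only: add.right_inverse)
qed

lemma bilinear_contraction: "bilinear_Q (\<lambda>w d. ext_lift (contr_list d) w)"
  unfolding bilinear_Q_def
proof (intro conjI allI)
  fix d :: "'a dual"
  show "linear_Q (ext_lift (contr_list d))"
    by (rule linear_ext_lift[OF alternating_contr_list])
next
  fix w :: "'a ext"
  have add: "ext_lift h w + ext_lift h' w = ext_lift (\<lambda>x. h x + h' x) w"
    and scale: "c *\<^sub>Q ext_lift h w = ext_lift (\<lambda>x. c *\<^sub>Q h x) w"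
    for h h' :: "'a list \<Rightarrow> 'a ext" and c
    unfolding ext_lift_def lift_def free_extend_def
    by (simp_all only: sum.distrib[symmetric] scaleQ_add_right[symmetric] Q.scale_sum_right)
      (auto intro!: sum.cong simp: Q.scale_left_commute scaleQ_scaleQ mult.commute split: wedge_sym.split)
  show "linear_Q (\<lambda>d. ext_lift (contr_list d) w)"
    unfolding linear_Q_iff add scale
    by (simp add: plus_dual.rep_eq scaleQ_dual.rep_eq scaleQ_rat_def algebra_simps
        scaleQ_add_left sum.distrib Q.scale_sum_right scaleQ_scaleQ)
qed

lemma linear_contraction: "linear_Q contraction"
  and contraction_wedge: "contraction (wedge as \<otimes> d) = contr_list d as"
  unfolding contraction_def
  by (simp_all add: linear_tensor_lift[OF bilinear_contraction]
      tensor_lift_tensor[OF bilinear_contraction] ext_lift_wedge[OF alternating_contr_list])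

lift_definition coord :: "'n \<Rightarrow> 'n::finite H dual" is "\<lambda>k h. h $ k"
  by (simp add: linear_Q_iff scaleQ_vec_def)

definition ext_snoc :: "'a::rat_vector \<Rightarrow> 'a ext \<Rightarrow> 'a ext" where
  "ext_snoc h = ext_lift (\<lambda>as. wedge (as @ [h]))"

lemma alternating_snoc: "alternating (\<lambda>as. wedge (as @ [h]))"
  unfolding alternating_def by (simp add: linear_wedge_slot wedge_eq)

lemma linear_ext_snoc: "linear_Q (ext_snoc h)"
  and ext_snoc_wedge: "ext_snoc h (wedge as) = wedge (as @ [h])"
  unfolding ext_snoc_def
  by (simp_all add: linear_ext_lift ext_lift_wedge alternating_snoc)

definition wheel_embedding :: "'n::finite H ext \<Rightarrow> 'n ext_dual" where
  "wheel_embedding w = (\<Sum>k\<in>UNIV. ext_snoc (axis k 1) w \<otimes> coord k)"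

lemma linear_wheel_embedding: "linear_Q wheel_embedding"
  unfolding wheel_embedding_def
  using bilinear_tensor
  by (intro linear_Q_sum) (auto simp: bilinear_Q_def intro: linear_Q_compose[OF _ linear_ext_snoc])

lemma wheel_embedding_wedge:
  "wheel_embedding (wedge as) = (\<Sum>k\<in>UNIV. wedge (as @ [axis k 1]) \<otimes> coord k)"
  by (simp add: wheel_embedding_def ext_snoc_wedge)

lemma vec_basis: "(\<Sum>k\<in>UNIV. (x $ k) *\<^sub>Q axis k 1) = (x :: rat ^ 'n)"
  by (simp add: vec_eq_iff scaleQ_vec_def scaleQ_rat_def axis_def if_distrib cong: if_cong)

lemma contraction_wheel_embedding:
  fixes w :: "'n::finite H ext"
  assumes "w \<in> ext_part i"
  shows "contraction (wheel_embedding w) = ((- 1) ^ i * (of_nat CARD('n) - of_nat i)) *\<^sub>Q w"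
proof (rule linear_Q_eq_on_span[OF _ _ _ assms[unfolded ext_part_def]])
  show "linear_Q (\<lambda>w. contraction (wheel_embedding w))"
    by (rule linear_Q_compose[OF linear_contraction linear_wheel_embedding])
  show "linear_Q (\<lambda>w :: 'n H ext. ((- 1) ^ i * (of_nat CARD('n) - of_nat i)) *\<^sub>Q w)"
    by (rule linear_Q_scaled) (simp add: linear_Q_iff)
  fix w :: "'n H ext"
  assume "w \<in> {wedge xs | xs. length xs = i}"
  then obtain as where w: "w = wedge as" and len: "length as = i" by auto
  have term_k: "contr_list (coord k) (as @ [axis k 1]) =
      (\<Sum>j<i. (- 1) ^ j *\<^sub>Q (as ! j $ k) *\<^sub>Q wedge (take j as @ drop (Suc j) as @ [axis k 1]))
      + (- 1) ^ i *\<^sub>Q w" for k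
    by (simp add: len w nth_append coord.rep_eq scaleQ_scaleQ)
  have slot: "(\<Sum>k\<in>UNIV. (as ! j $ k) *\<^sub>Q wedge (take j as @ drop (Suc j) as @ [axis k 1]))
      = (- 1) ^ (i - Suc j) *\<^sub>Q w" if "j < i" for j
  proof -
    let ?L = "\<lambda>x. wedge ((take j as @ drop (Suc j) as) @ x # [])"
    have "(\<Sum>k\<in>UNIV. (as ! j $ k) *\<^sub>Q ?L (axis k 1)) = ?L (\<Sum>k\<in>UNIV. (as ! j $ k) *\<^sub>Q axis k 1)"
      by (simp only: linear_Q_D[OF linear_wedge_slot])
    also have "\<dots> = ?L (as ! j)" by (simp only: vec_basis)
    also have "\<dots> = (- 1) ^ (i - Suc j) *\<^sub>Q (- 1) ^ (i - Suc j) *\<^sub>Q ?L (as ! j)"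
      by (simp add: scaleQ_scaleQ scaleQ_one flip: power_mult_distrib)
    also have "(- 1) ^ (i - Suc j) *\<^sub>Q ?L (as ! j) = wedge (take j as @ as ! j # drop (Suc j) as)"
      using wedge_move[of "take j as" "as ! j" "drop (Suc j) as"] by (simp add: len)
    also have "take j as @ as ! j # drop (Suc j) as = as"
      using that len by (simp add: id_take_nth_drop[symmetric])
    finally show ?thesis by (simp add: w)
  qed
  have "contraction (wheel_embedding w) =
      (\<Sum>k\<in>UNIV. contr_list (coord k) (as @ [axis k 1]))"
    by (simp only: w wheel_embedding_wedge linear_Q_D[OF linear_contraction] contraction_wedge)
  also have "\<dots> = (\<Sum>j<i. (- 1) ^ j *\<^sub>Q
      (\<Sum>k\<in>UNIV. (as ! j $ k) *\<^sub>Q wedge (take j as @ drop (Suc j) as @ [axis k 1])))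
      + (\<Sum>k\<in>(UNIV::'n set). (- 1) ^ i *\<^sub>Q w)"
    unfolding term_k sum.distrib by (subst sum.swap) (simp add: Q.scale_sum_right)
  also have "(\<Sum>j<i. (- 1) ^ j *\<^sub>Q
      (\<Sum>k\<in>UNIV. (as ! j $ k) *\<^sub>Q wedge (take j as @ drop (Suc j) as @ [axis k 1])))
      = (\<Sum>j<i. ((- 1) ^ (i - 1)) *\<^sub>Q w)"
    by (intro sum.cong refl) (simp add: slot scaleQ_scaleQ flip: power_add)
  also have "\<dots> = (of_nat i * (- 1) ^ (i - 1)) *\<^sub>Q w"
    by (simp only: Q.scale_sum_left[symmetric] sum_constant card_lessThan)
  also have "(\<Sum>k\<in>(UNIV::'n set). (- 1) ^ i *\<^sub>Q w) = (of_nat CARD('n) * (- 1) ^ i) *\<^sub>Q w"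
    by (simp only: Q.scale_sum_left[symmetric] sum_constant)
  also have "(of_nat i * (- 1) ^ (i - 1)) *\<^sub>Q w + (of_nat CARD('n) * (- 1) ^ i) *\<^sub>Q w
      = ((- 1) ^ i * (of_nat CARD('n) - of_nat i)) *\<^sub>Q w"
  proof -
    have "of_nat i * (- 1) ^ (i - 1) + of_nat CARD('n) * (- 1) ^ i
        = (- 1) ^ i * (of_nat CARD('n) - of_nat i :: rat)"
      by (cases i) (simp_all add: algebra_simps)
    then show ?thesis by (simp only: scaleQ_add_left[symmetric])
  qed
  finally show "contraction (wheel_embedding w)
      = ((- 1) ^ i * (of_nat CARD('n) - of_nat i)) *\<^sub>Q w" .
qed

lemma linear_matrix: "linear_Q ((*v) (g :: rat ^ 'n ^ 'm))"
  by (simp add: linear_Q_iff matrix_vector_right_distrib)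
     (simp add: vec_eq_iff scaleQ_vec_def scaleQ_rat_def matrix_vector_mult_def sum_distrib_left mult_ac)

lemma alternating_map: "linear_Q f \<Longrightarrow> alternating (\<lambda>as. wedge (map f as))"
  unfolding alternating_def by (simp add: linear_Q_compose[OF linear_wedge_slot] wedge_eq)

lemma linear_gl_extH: "linear_Q (gl_extH g)"
  and gl_extH_wedge: "gl_extH g (wedge as) = wedge (map ((*v) g) as)"
  unfolding gl_extH_def ext_map_def
  by (simp_all add: linear_ext_lift ext_lift_wedge alternating_map linear_matrix)

lemma linear_gl_dual: "linear_Q (gl_dual g)"
  unfolding linear_Q_iff by (intro conjI allI; transfer; simp)

lemma bilinear_gl: "bilinear_Q (\<lambda>x y. gl_extH g x \<otimes> gl_dual g y)"
  using bilinear_tensor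
  by (auto simp: bilinear_Q_def intro: linear_Q_compose linear_gl_extH linear_gl_dual
     linear_Q_compose[OF _ linear_gl_extH, of "\<lambda>x. x \<otimes> y" for y])

lemma linear_gl_ext_dual: "linear_Q (gl_ext_dual g)"
  and gl_ext_dual_tensor: "gl_ext_dual g (w \<otimes> d) = gl_extH g w \<otimes> gl_dual g d"
  unfolding gl_ext_dual_def tensor_map_def
  by (simp_all add: linear_tensor_lift tensor_lift_tensor bilinear_gl)

lemma gl_dual_coord: "gl_dual g (coord k) = (\<Sum>l\<in>UNIV. (matrix_inv g $ k $ l) *\<^sub>Q coord l)"
proof -
  have sum: "dual_apply (\<Sum>l\<in>A. f l) h = (\<Sum>l\<in>A. dual_apply (f l) h)" for f :: "'a \<Rightarrow> 'a H dual" and A h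
    by (induction A rule: infinite_finite_induct) (simp_all add: zero_dual.rep_eq plus_dual.rep_eq)
  show ?thesis
    by (rule dual_apply_inject[THEN iffD1])
       (simp add: fun_eq_iff sum gl_dual.rep_eq coord.rep_eq scaleQ_dual.rep_eq scaleQ_rat_def
         matrix_vector_mult_def)
qed

lemma wheel_embedding_equivariant:
  fixes w :: "'n::finite H ext"
  assumes "invertible g" "w \<in> ext_part i"
  shows "wheel_embedding (gl_extH g w) = gl_ext_dual g (wheel_embedding w)"
proof (rule linear_Q_eq_on_span[OF _ _ _ assms(2)[unfolded ext_part_def]])
  show "linear_Q (\<lambda>w. wheel_embedding (gl_extH g w))"
    by (rule linear_Q_compose[OF linear_wheel_embedding linear_gl_extH])
  show "linear_Q (\<lambda>w. gl_ext_dual g (wheel_embedding w))"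
    by (rule linear_Q_compose[OF linear_gl_ext_dual linear_wheel_embedding])
  fix w :: "'n H ext"
  assume "w \<in> {wedge xs | xs. length xs = i}"
  then obtain as where w: "w = wedge as" by auto
  define bs where "bs = map ((*v) g) as"
  have tl: "linear_Q (\<lambda>d. x \<otimes> d)" and tr: "linear_Q (\<lambda>x. x \<otimes> d)"
    for x :: "'n H ext" and d :: "'n H dual"
    using bilinear_tensor by (auto simp: bilinear_Q_def)
  have "gl_ext_dual g (wheel_embedding w) =
      (\<Sum>k\<in>UNIV. wedge (bs @ [g *v axis k 1]) \<otimes> (\<Sum>l\<in>UNIV. (matrix_inv g $ k $ l) *\<^sub>Q coord l))"
    by (simp add: w wheel_embedding_wedge linear_Q_D[OF linear_gl_ext_dual] gl_ext_dual_tensor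
        gl_extH_wedge gl_dual_coord bs_def)
  also have "\<dots> = (\<Sum>k\<in>UNIV. \<Sum>l\<in>UNIV. (matrix_inv g $ k $ l) *\<^sub>Q (wedge (bs @ [g *v axis k 1]) \<otimes> coord l))"
    by (simp add: linear_Q_D[OF tl])
  also have "\<dots> = (\<Sum>l\<in>UNIV. \<Sum>k\<in>UNIV. (matrix_inv g $ k $ l) *\<^sub>Q (wedge (bs @ [g *v axis k 1]) \<otimes> coord l))"
    by (rule sum.swap)
  also have "\<dots> = (\<Sum>l\<in>UNIV. (\<Sum>k\<in>UNIV. (matrix_inv g $ k $ l) *\<^sub>Q wedge (bs @ [g *v axis k 1])) \<otimes> coord l)"
    by (simp add: linear_Q_D[OF tr])
  also have "\<dots> = (\<Sum>l\<in>UNIV. wedge (bs @ [axis l 1]) \<otimes> coord l)"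
  proof (rule sum.cong[OF refl])
    fix l :: 'n
    have "(\<Sum>k\<in>UNIV. (matrix_inv g $ k $ l) *\<^sub>Q wedge (bs @ [g *v axis k 1])) =
       wedge (bs @ [\<Sum>k\<in>UNIV. (matrix_inv g $ k $ l) *\<^sub>Q (g *v axis k 1)])"
      by (simp only: linear_Q_D[OF linear_wedge_slot])
    also have "(\<Sum>k\<in>UNIV. (matrix_inv g $ k $ l) *\<^sub>Q (g *v axis k 1)) =
        g *v (\<Sum>k\<in>UNIV. ((matrix_inv g *v axis l 1) $ k) *\<^sub>Q axis k 1)"
    proof -
      have "(matrix_inv g *v axis l 1) $ k = matrix_inv g $ k $ l" for k
        by (simp add: matrix_vector_mult_def axis_def if_distrib cong: if_cong)
      then show ?thesis by (simp only: linear_Q_D[OF linear_matrix])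
    qed
    also have "\<dots> = (g ** matrix_inv g) *v axis l 1"
      by (simp add: vec_basis matrix_vector_mul_assoc)
    also have "\<dots> = axis l 1" 
    proof -
      have "g ** matrix_inv g = mat 1"
        using assms(1) unfolding invertible_def matrix_inv_def by (rule someI2_ex) blast
      then show ?thesis by simp
    qed
    finally show "(\<Sum>k\<in>UNIV. (matrix_inv g $ k $ l) *\<^sub>Q wedge (bs @ [g *v axis k 1])) \<otimes> coord l
       = wedge (bs @ [axis l 1]) \<otimes> coord l" by simp
  qed
  also have "\<dots> = wheel_embedding (gl_extH g w)"
    by (simp add: w gl_extH_wedge wheel_embedding_wedge bs_def)
  finally show "wheel_embedding (gl_extH g w) = gl_ext_dual g (wheel_embedding w)" by simp
qed

lemma wheel_embedding_in:
  assumes "w \<in> ext_part i"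
  shows "wheel_embedding w \<in> Upart i"
  unfolding Upart_def
proof (rule linear_Q_span_subset[OF linear_wheel_embedding _ assms[unfolded ext_part_def]])
  fix w :: "'a H ext" assume "w \<in> {wedge xs | xs. length xs = i}"
  then obtain as where "w = wedge as" "length as = i" by auto
  then show "wheel_embedding w \<in> Q.span {wedge as \<otimes> d | as d. length as = Suc i}"
    unfolding \<open>w = wedge as\<close> wheel_embedding_wedge
    by (intro Q.span_sum Q.span_base CollectI exI[of _ "as @ [axis _ 1]"] exI[of _ "coord _"]) simp
qed

lemma contraction_in:
  assumes "u \<in> Upart i"
  shows "contraction u \<in> ext_part i"
  unfolding ext_part_def
proof (rule linear_Q_span_subset[OF linear_contraction _ assms[unfolded Upart_def]])
  fix u :: "'a ext_dual" assume "u \<in> {wedge as \<otimes> d | as d. length as = Suc i}"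
  then obtain as d where u: "u = wedge as \<otimes> d" and len: "length as = Suc i" by auto
  have "wedge (take j as @ drop (Suc j) as) \<in> {wedge xs | xs. length xs = i}" if "j < Suc i" for j
    using that len by (intro CollectI exI[of _ "take j as @ drop (Suc j) as"]) auto
  then show "contraction u \<in> Q.span {wedge xs | xs. length xs = i}"
    unfolding u contraction_wedge len
    by (intro Q.span_sum Q.span_scale Q.span_base) simp
qed

lemma wheel_identification_wheel_embedding:
  "wheel_identification (\<lambda>i. wheel_embedding :: 'n::finite H ext \<Rightarrow> 'n ext_dual)"
  unfolding wheel_identification_def
proof (intro allI impI conjI ballI)
  fix i :: nat
  assume i: "1 \<le> i \<and> i < CARD('n)"
  let ?\<theta> = "wheel_embedding :: 'n H ext \<Rightarrow> 'n ext_dual"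
  define c :: rat where "c = (- 1) ^ i * (of_nat CARD('n) - of_nat i)"
  have c: "c \<noteq> 0" using i by (simp add: c_def)
  have inv: "contraction (?\<theta> w) = c *\<^sub>Q w" if "w \<in> ext_part i" for w
    using contraction_wheel_embedding[OF that] by (simp add: c_def)
  show "?\<theta> (x + y) = ?\<theta> x + ?\<theta> y" "?\<theta> (r *\<^sub>Q x) = r *\<^sub>Q ?\<theta> x" for x y r
    by (simp_all add: linear_Q_D[OF linear_wheel_embedding])
  show "?\<theta> (gl_extH g x) = gl_ext_dual g (?\<theta> x)" if "invertible g" "x \<in> ext_part i" for g x
    using that by (rule wheel_embedding_equivariant)
  show "inj_on ?\<theta> (ext_part i)"
    by (rule inj_onI) (metis Q.scale_left_imp_eq c inv)
  show "Utree i \<inter> ?\<theta> ` ext_part i = {0}"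
  proof (intro equalityI subsetI)
    fix u assume "u \<in> Utree i \<inter> ?\<theta> ` ext_part i"
    then obtain w where "u = ?\<theta> w" "w \<in> ext_part i" "contraction u = 0" by (auto simp: Utree_def)
    then have "c *\<^sub>Q w = 0" by (simp add: inv)
    then have "w = 0" using c by (simp add: Q.scale_eq_0_iff)
    then show "u \<in> {0}" by (simp add: \<open>u = ?\<theta> w\<close> linear_Q_D[OF linear_wheel_embedding])
  next
    fix u :: "'n ext_dual" assume "u \<in> {0}"
    moreover have "(0 :: 'n ext_dual) = ?\<theta> 0" "(0 :: 'n H ext) \<in> ext_part i"
      by (simp_all add: linear_Q_D[OF linear_wheel_embedding] ext_part_def Q.span_zero)
    ultimately show "u \<in> Utree i \<inter> ?\<theta> ` ext_part i"
      by (auto simp: Utree_def Upart_def Q.span_zero linear_Q_D[OF linear_contraction])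
  qed
  show "Upart i = {t + w | t w. t \<in> Utree i \<and> w \<in> ?\<theta> ` ext_part i}"
  proof (intro equalityI subsetI)
    fix u :: "'n ext_dual" assume u: "u \<in> Upart i"
    define w where "w = (1 / c) *\<^sub>Q contraction u"
    have w: "w \<in> ext_part i"
      using contraction_in[OF u] by (simp add: w_def ext_part_def Q.span_scale)
    have "u - ?\<theta> w \<in> Upart i"
      using u wheel_embedding_in[OF w] by (simp add: Upart_def Q.span_diff)
    moreover have "contraction (u - ?\<theta> w) = 0"
      using c by (simp add: linear_Q_D[OF linear_contraction] inv[OF w])
        (simp add: w_def scaleQ_scaleQ scaleQ_one)
    ultimately have "u - ?\<theta> w \<in> Utree i" by (simp add: Utree_def)
    then show "u \<in> {t + w | t w. t \<in> Utree i \<and> w \<in> ?\<theta> ` ext_part i}"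
      using w by (intro CollectI exI[of _ "u - ?\<theta> w"] exI[of _ "?\<theta> w"]) simp
  next
    fix u :: "'n ext_dual" assume "u \<in> {t + w | t w. t \<in> Utree i \<and> w \<in> ?\<theta> ` ext_part i}"
    then show "u \<in> Upart i"
      using wheel_embedding_in unfolding Utree_def Upart_def by (blast intro: Q.span_add)
  qed
qed

end

theory Submission
  imports Defs "HOL-Combinatorics.Multiset_Permutations"
begin

text \<open>Write \<open>f\<^sub>z : \<Lambda>\<^sup>mU \<rightarrow> U\<^sub>m\<close> for the composite of \<open>\<iota>\<close> with the tree or wheel contraction of a
  block of size \<open>m\<close> (so \<open>z\<close> records the kind and \<open>m\<close>). Splitting a permutation of \<open>us\<close> into its first
  \<open>m\<close> letters and the rest shows that the component of \<open>F\<close> belonging to a word \<open>L = z\<^sub>1 \<dots> z\<^sub>k\<close> of parts is the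
  convolution product \<open>f\<^bsub>z\<^sub>1\<^esub> * \<cdots> * f\<^bsub>z\<^sub>k\<^esub>\<close>, up to the factor \<open>1 / \<Prod>k\<^sub>j!\<close>; hence \<open>F\<close> is a product of convolution
  exponentials of the maps \<open>f\<^sub>z\<close>. Since elements of \<open>U\<^sub>*\<close> are primitive in \<open>S\<^sup>*(U\<^sub>*)\<close> and \<open>\<Lambda>\<^sup>*U\<close> is graded
  cocommutative, the coproduct of the component of \<open>L\<close> is the sum over all ways of distributing
  the letters of \<open>L\<close> over two subwords. The binomial multiplicities with which a given pair of
  subwords occurs are absorbed by the factorials, exactly as in \<open>exp (x + y) = exp x * exp y\<close>.\<close>

section \<open>Koszul-signed sums over splittings of a list\<close>

text \<open>The obstacle is sign bookkeeping: shuffles, permutations and Koszul signs occur in three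
  algebras, and explicit sums over permutations offer no induction. They are therefore rewritten in
  terms of \<open>ksum\<close>, which recurses on the list; coassociativity and graded
  cocommutativity become facts about \<open>ksum\<close> alone. The signs on the two sides agree
  because f_z preserves degree: it sends m letters of U to degree m, so the Koszul sign for moving
  its value past an element obtained from j letters is (-1)^(m j), which is also the sign for moving
  m letters of U past j letters. The factors 1/k! arise because the letters of a word L are
  distributed as if they were distinguishable: the coefficient of L times the number of ways to
  obtain the subwords L1 and L2 must be the product of the coefficients of L1 and L2, and inverse
  factorials of the multiplicities solve this equation. Equivariance follows the same recursion over
  words of parts as the coproduct, with \<theta> an arbitrary identification throughout.\<close>

text \<open>\<open>ksum d us X\<close> sums \<open>X A B\<close> over all splittings of \<open>us\<close> into a subword \<open>A\<close> and the complementary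
  subword \<open>B\<close>, with the Koszul sign of the degrees \<open>d\<close>. The coproduct of \<open>\<Lambda>\<^sup>*U\<close> is the case \<open>d = 1\<close>, that of
  \<open>S\<^sup>*(U\<^sub>*)\<close> is \<open>d = deg\<close>, and \<open>d = 0\<close> gives unsigned subwords.\<close>

fun ksum :: "('a \<Rightarrow> nat) \<Rightarrow> 'a list \<Rightarrow> ('a list \<Rightarrow> 'a list \<Rightarrow> 'b::rat_vector) \<Rightarrow> 'b" where
  "ksum d [] X = X [] []"
| "ksum d (u # us) X = ksum d us (\<lambda>A B. X (u # A) B)
     + ksum d us (\<lambda>A B. (- 1) ^ (d u * sum_list (map d A)) *\<^sub>Q X A (u # B))"

text \<open>Splittings are never listed one by one. The multiset equation is what later proofs know
  about \<open>A\<close> and \<open>B\<close>; lengths, degrees and sets of letters are read off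
  from it.\<close>

lemma ksum_cong:
  "(\<And>A B. mset A + mset B = mset us \<Longrightarrow> X A B = Y A B) \<Longrightarrow> ksum d us X = ksum d us Y"
proof (induction us arbitrary: X Y)
  case (Cons u us)
  show ?case
    unfolding ksum.simps
    by (intro arg_cong2[of _ _ _ _ plus] Cons.IH) (simp_all add: Cons.prems)
qed simp

lemma linear_ksum: "linear_Q f \<Longrightarrow> f (ksum d us X) = ksum d us (\<lambda>A B. f (X A B))"
  by (induction us arbitrary: X) (simp_all add: linear_Q_D)

lemma ksum_add: "ksum d us (\<lambda>A B. X A B + Y A B) = ksum d us X + ksum d us Y"
  by (induction us arbitrary: X Y) (simp_all add: scaleQ_add_right)

lemma linear_Q_scale: "linear_Q (\<lambda>x. c *\<^sub>Q x)"
  by (simp add: linear_Q_iff scaleQ_add_right Q.scale_left_commute)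

lemmas ksum_scale = linear_ksum[OF linear_Q_scale]

lemma ksum_zero: "ksum d us (\<lambda>A B. 0) = 0"
  by (induction us) (simp_all add: Q.scale_zero_right)

lemma ksum_sum: "ksum d us (\<lambda>A B. \<Sum>i\<in>I. X i A B) = (\<Sum>i\<in>I. ksum d us (X i))"
  by (induction I rule: infinite_finite_induct) (simp_all add: ksum_add ksum_zero)

lemma linear_Q_ksum:
  assumes "\<And>A B. linear_Q (\<lambda>x. X x A B)"
  shows "linear_Q (\<lambda>x. ksum d us (X x))"
proof -
  have "X (x + y) = (\<lambda>A B. X x A B + X y A B)" "X (c *\<^sub>Q x) = (\<lambda>A B. c *\<^sub>Q X x A B)" for c x y
    using assms by (simp_all add: linear_Q_iff fun_eq_iff)
  then show ?thesis by (simp add: linear_Q_iff ksum_add ksum_scale)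
qed

lemma ksum_fubini:
  "ksum d us (\<lambda>A B. ksum e vs (X A B)) = ksum e vs (\<lambda>C D. ksum d us (\<lambda>A B. X A B C D))"
  by (induction us arbitrary: X) (simp_all add: ksum_add ksum_scale)

lemma sum_list_mset_deg:
  "mset A + mset B = mset us \<Longrightarrow> sum_list (map d A) + sum_list (map d B) = (sum_list (map d us) :: nat)"
  by (metis image_mset_union mset_map sum_mset.union sum_mset_sum_list)

text \<open>Both sides distribute the letters over three subwords. A letter sent to the last one
  passes the first two, either one after the other or as one subword, and degrees add up.\<close>

lemma ksum_coassoc:
  "ksum d us (\<lambda>A E. ksum d E (X A)) = ksum d us (\<lambda>E C. ksum d E (\<lambda>A B. X A B C))"
proof (induction us arbitrary: X)
  case (Cons u us)
  let ?s = "\<lambda>A. (- 1) ^ (d u * sum_list (map d A)) :: rat"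
  \<comment> \<open>The head lands in the third subword; in the other two cases both sides carry the
    same sign already.\<close>
  have "ksum d us (\<lambda>E C. ?s E *\<^sub>Q ksum d E (\<lambda>A B. X A B (u # C)))
      = ksum d us (\<lambda>E C. ksum d E (\<lambda>A B. ?s A *\<^sub>Q ?s B *\<^sub>Q X A B (u # C)))"
  proof (rule ksum_cong)
    fix E C assume "mset E + mset C = mset us"
    show "?s E *\<^sub>Q ksum d E (\<lambda>A B. X A B (u # C)) = ksum d E (\<lambda>A B. ?s A *\<^sub>Q ?s B *\<^sub>Q X A B (u # C))"
      unfolding ksum_scale
      by (rule ksum_cong)
        (simp add: sum_list_mset_deg[symmetric] scaleQ_scaleQ distrib_left power_add)
  qed
  then show ?case
    by (simp add: ksum_add ksum_scale Cons.IH[symmetric] scaleQ_add_right)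
qed simp

text \<open>Graded cocommutativity. The exchange swaps the two summands of the recursion, and the
  sign by which the head passes \<open>A\<close> cancels what its degree adds to the product of the
  total degrees.\<close>

lemma ksum_cocomm:
  "ksum d us X = ksum d us (\<lambda>A B. (- 1) ^ (sum_list (map d A) * sum_list (map d B)) *\<^sub>Q X B A)"
proof (induction us arbitrary: X)
  case (Cons u us)
  show ?case
    unfolding ksum.simps Cons.IH[of "\<lambda>A B. X (u # A) B"]
      Cons.IH[of "\<lambda>A B. (- 1) ^ (d u * sum_list (map d A)) *\<^sub>Q X A (u # B)"]
    by (subst add.commute, intro arg_cong2[of _ _ _ _ plus])
      (auto intro!: ksum_cong simp: scaleQ_scaleQ algebra_simps minus_one_power_iff simp flip: power_add)
qed (simp add: scaleQ_one)

text \<open>Without signs nothing is paid for moving letters of \<open>L'\<close> past letters of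
  \<open>L\<close>, so the two lists split independently. This separates tree parts from wheel
  parts.\<close>

lemma ksum_append_unsigned:
  "ksum (\<lambda>_. 0) (L @ L') X =
     ksum (\<lambda>_. 0) L (\<lambda>A B. ksum (\<lambda>_. 0) L' (\<lambda>A' B'. X (A @ A') (B @ B')))"
  by (induction L arbitrary: X) (simp_all add: scaleQ_one)

lemma ksum_map: "ksum d (map f us) X = ksum (\<lambda>x. d (f x)) us (\<lambda>A B. X (map f A) (map f B))"
  by (induction us arbitrary: X) (simp_all add: comp_def)

text \<open>Counit law: one splitting has an empty left subword, and its sign is 1.\<close>

lemma ksum_nil: "ksum d us (\<lambda>A B. if A = [] then X B else 0) = X us"
  by (induction us arbitrary: X) (simp_all add: ksum_zero scaleQ_one if_distrib[of "scaleQ _"] cong: if_cong)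

section \<open>Signs of permutations and shuffles\<close>

definition inversions :: "nat \<Rightarrow> (nat \<Rightarrow> nat) \<Rightarrow> (nat \<times> nat) set" where
  "inversions n \<sigma> = {(a, b). a < b \<and> b < n \<and> \<sigma> b < \<sigma> a}"

text \<open>The product runs over all pairs, with factor 1 at non-inversions, so that the products
  of two permutations can be multiplied pair by pair.\<close>

definition inv_sign :: "nat \<Rightarrow> (nat \<Rightarrow> nat) \<Rightarrow> rat" where
  "inv_sign n \<sigma> = (\<Prod>(a, b)\<in>{(a, b). a < b \<and> b < n}. if \<sigma> b < \<sigma> a then - 1 else 1)"

lemma finite_pairs: "finite {(a, b). a < b \<and> b < (n::nat)}"
  by (rule finite_subset[of _ "{..<n} \<times> {..<n}"]) auto

lemma inv_sign_inversions: "inv_sign n \<sigma> = (\<Prod>_\<in>inversions n \<sigma>. - 1)"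
  unfolding inv_sign_def inversions_def
  by (rule prod.mono_neutral_cong_right) (auto simp: finite_pairs split: if_splits)

text \<open>A pair is inverted by \<sigma> \<circ> \<tau> when exactly one of two things happens:
  \<tau> inverts it, or \<sigma> inverts its image under \<tau>.\<close>

lemma inv_sign_compose:
  assumes \<tau>: "\<tau> permutes {..<n}"
    and \<sigma>: "\<sigma> permutes {..<n}"
  shows "inv_sign n (\<sigma> \<circ> \<tau>) = inv_sign n \<sigma> * inv_sign n \<tau>"
proof -
  let ?P = "{(a, b). a < b \<and> b < n}"
  let ?h = "\<lambda>\<sigma> (a, b). if \<sigma> b < \<sigma> a then - 1 else (1::rat)"
  \<comment> \<open>The action of \<open>f\<close> on two-element sets, each stored as an increasing
    pair. For \<tau> it permutes the index set of the product.\<close>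
  define srt :: "(nat \<Rightarrow> nat) \<Rightarrow> nat \<times> nat \<Rightarrow> nat \<times> nat"
    where "srt f = (\<lambda>(a, b). (min (f a) (f b), max (f a) (f b)))" for f
  have inj: "\<sigma> a = \<sigma> b \<longleftrightarrow> a = b" "\<tau> a = \<tau> b \<longleftrightarrow> a = b" for a b
    using \<sigma> \<tau> by (meson permutes_inj injD)+
  have lt: "\<tau> a < n \<longleftrightarrow> a < n" "inv \<tau> a < n \<longleftrightarrow> a < n" for a
    using permutes_in_image[OF \<tau>, of a] permutes_in_image[OF permutes_inv[OF \<tau>], of a] by auto
  have inv: "\<tau> (inv \<tau> a) = a" "inv \<tau> (\<tau> a) = a" for a
    using permutes_inverses[OF \<tau>] by auto
  then have inj_inv: "inv \<tau> a = inv \<tau> b \<longleftrightarrow> a = b" for a b by metis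
  have "bij_betw (srt \<tau>) ?P ?P"
  proof (rule bij_betw_byWitness[of _ "srt (inv \<tau>)"])
    show "\<forall>p\<in>?P. srt (inv \<tau>) (srt \<tau> p) = p" "\<forall>p\<in>?P. srt \<tau> (srt (inv \<tau>) p) = p"
      by (auto simp: srt_def min_def max_def inv)
    show "srt \<tau> ` ?P \<subseteq> ?P"
      using inj(2) by (auto simp: srt_def min_def max_def lt le_neq_implies_less)
    show "srt (inv \<tau>) ` ?P \<subseteq> ?P"
      using inj_inv by (auto simp: srt_def min_def max_def lt le_neq_implies_less)
  qed
  then have "inv_sign n \<sigma> = (\<Prod>p\<in>?P. ?h \<sigma> (srt \<tau> p))"
    unfolding inv_sign_def by (rule prod.reindex_bij_betw[symmetric])
  then have "inv_sign n \<sigma> * inv_sign n \<tau> = (\<Prod>p\<in>?P. ?h \<sigma> (srt \<tau> p) * ?h \<tau> p)"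
    by (simp add: inv_sign_def prod.distrib)
  also have "\<dots> = inv_sign n (\<sigma> \<circ> \<tau>)"
    unfolding inv_sign_def
  proof (rule prod.cong[OF refl])
    fix p assume "p \<in> ?P"
    then obtain a b where p: "p = (a, b)" "a < b" by auto
    have "\<sigma> (\<tau> a) \<noteq> \<sigma> (\<tau> b)" "\<tau> a \<noteq> \<tau> b" using p inj by auto
    then show "?h \<sigma> (srt \<tau> p) * ?h \<tau> p = ?h (\<sigma> \<circ> \<tau>) p"
      unfolding p by (auto simp: srt_def min_def max_def)
  qed
  finally show ?thesis ..
qed

text \<open>An adjacent transposition has one inversion. Any other is conjugate, by an adjacent one,
  to a shorter one, and conjugation does not change a multiplicative sign.\<close>

lemma inv_sign_transpose: "i < j \<Longrightarrow> j < n \<Longrightarrow> inv_sign n (Transposition.transpose i j) = - 1"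
proof (induction j)
  case (Suc j)
  have adj: "inv_sign n (Transposition.transpose j (Suc j)) = - 1"
  proof -
    have "inversions n (Transposition.transpose j (Suc j)) = {(j, Suc j)}"
      using Suc.prems by (auto simp: inversions_def Transposition.transpose_def split: if_splits)
    then show ?thesis by (simp add: inv_sign_inversions)
  qed
  show ?case
  proof (cases "i = j")
    case False
    with Suc.prems have ij: "i < j" by simp
    have perm: "Transposition.transpose a b permutes {..<n}" if "a < n" "b < n" for a b
      using that by (simp add: permutes_swap_id)
    have dec: "Transposition.transpose i (Suc j) = Transposition.transpose j (Suc j) \<circ> Transposition.transpose i j \<circ> Transposition.transpose j (Suc j)"
      using ij by (auto simp: fun_eq_iff Transposition.transpose_def)
    have "inv_sign n (Transposition.transpose i (Suc j)) =
        inv_sign n (Transposition.transpose j (Suc j) \<circ> Transposition.transpose i j) * - 1"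
      using Suc.prems ij adj by (subst dec, subst inv_sign_compose) (simp_all add: perm permutes_compose)
    also have "\<dots> = - 1"
      using Suc ij adj by (subst inv_sign_compose) (simp_all add: perm)
    finally show ?thesis .
  qed (simp add: adj)
qed simp

text \<open>Both signs are multiplicative and equal -1 on transpositions, which generate all
  permutations.\<close>

lemma sign_eq_inv_sign:
  assumes "\<sigma> permutes {..<n}"
  shows "of_int (sign \<sigma>) = inv_sign n \<sigma>"
  using assms finite_lessThan
proof (induction rule: permutes_induct)
  case id
  have "inversions n id = {}" by (auto simp: inversions_def)
  then show ?case by (simp only: inv_sign_inversions sign_id prod.empty of_int_1)
next
  case (swap a b p)
  have "inv_sign n (Transposition.transpose a b) = - 1"
    using swap(1-3) inv_sign_transpose[of a b n] inv_sign_transpose[of b a n]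
    by (cases "a < b") (auto simp: transpose_commute)
  moreover have sgn: "sign (Transposition.transpose a b \<circ> p) = - sign p"
    using swap by (subst sign_compose)
      (auto simp: sign_swap_id intro: permutation_swap_id permutes_imp_permutation[OF finite_lessThan])
  ultimately show ?case
    unfolding sgn using swap by (subst inv_sign_compose) (simp_all add: permutes_swap_id)
qed

text \<open>Koszul sign of bringing the positions in \<open>A\<close> in front of those in
  \<open>B\<close>: one factor for each element of \<open>B\<close> that an element of
  \<open>A\<close> has to overtake.\<close>

definition split_sign :: "(nat \<Rightarrow> nat) \<Rightarrow> nat set \<Rightarrow> nat set \<Rightarrow> rat" where
  "split_sign d A B = (\<Prod>a\<in>A. \<Prod>b\<in>{b \<in> B. b < a}. (- 1) ^ (d a * d b))"

lemma sorted_list_of_set_insert_min: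
  assumes "finite A" "\<And>a. a \<in> A \<Longrightarrow> x < (a::nat)"
  shows "sorted_list_of_set (insert x A) = x # sorted_list_of_set A"
proof -
  have "x \<notin> A" using assms(2) by blast
  then show ?thesis
    using assms by (simp add: sorted_list_of_set_insert_remove insort_is_Cons less_imp_le)
qed

text \<open>Links the recursion to explicit sums. The head is the minimum of the list, so putting it
  into \<open>A\<close> creates no crossing, while putting it into \<open>B\<close> makes every
  element of \<open>A\<close> cross it.\<close>

lemma ksum_subsets:
  fixes "is" :: "nat list"
  assumes "sorted_wrt (<) is"
  shows "ksum d is X = (\<Sum>A\<in>Pow (set is). split_sign d A (set is - A) *\<^sub>Q
    X (sorted_list_of_set A) (sorted_list_of_set (set is - A)))"
  using assms
proof (induction "is" arbitrary: X)
  case Nil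
  show ?case by (simp add: split_sign_def scaleQ_one)
next
  case (Cons x xs)
  let ?S = "set xs"
  have x: "a \<in> ?S \<Longrightarrow> x < a" for a using Cons.prems by auto
  have xS: "x \<notin> ?S" using x[of x] by auto
  have nlt: "a \<in> ?S \<Longrightarrow> \<not> a < x" for a using x[of a] by simp
  have fin: "A \<subseteq> ?S \<Longrightarrow> finite A" for A using finite_subset by blast
  have *: "insert x ?S - insert x A = ?S - A" "?S - insert x A = ?S - A" "A \<subseteq> ?S \<Longrightarrow> insert x ?S - A = insert x (?S - A)" for A
    using xS by auto
  have list_ins: "sorted_list_of_set (insert x A) = x # sorted_list_of_set A" if "A \<subseteq> ?S" for A
    using that x fin by (intro sorted_list_of_set_insert_min) auto
  have ws: "split_sign d (insert x A) (?S - A) = split_sign d A (?S - A)" if "A \<subseteq> ?S" for A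
  proof -
    have "x \<notin> A" "{b \<in> ?S - A. b < x} = {}" using that xS nlt by auto
    then show ?thesis using fin[OF that] by (simp add: split_sign_def del: Collect_empty_eq)
  qed
  have wi: "split_sign d A (insert x (?S - A)) =
      split_sign d A (?S - A) * (- 1) ^ (d x * sum_list (map d (sorted_list_of_set A)))" if "A \<subseteq> ?S" for A
  proof -
    have "(\<Prod>b\<in>{b \<in> insert x (?S - A). b < a}. (- 1) ^ (d a * d b)) =
        (\<Prod>b\<in>{b \<in> ?S - A. b < a}. (- 1) ^ (d a * d b)) * (- 1 :: rat) ^ (d x * d a)" if "a \<in> A" for a
    proof -
      have "{b \<in> insert x (?S - A). b < a} = insert x {b \<in> ?S - A. b < a}"
        using x[of a] that \<open>A \<subseteq> ?S\<close> by auto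
      moreover have "x \<notin> {b \<in> ?S - A. b < a}" using xS by auto
      ultimately show ?thesis by (simp add: mult.commute)
    qed
    moreover have "(\<Prod>a\<in>A. (- 1 :: rat) ^ (d x * d a)) = (- 1) ^ (d x * (\<Sum>a\<in>A. d a))"
      by (simp add: power_sum sum_distrib_left)
    moreover have "(\<Sum>a\<in>A. d a) = sum_list (map d (sorted_list_of_set A))"
      using fin[OF that] sum.distinct_set_conv_list[of "sorted_list_of_set A" d] by simp
    ultimately show ?thesis
      by (simp add: split_sign_def prod.distrib)
  qed
  have Pow: "Pow (set (x # xs)) = insert x ` Pow ?S \<union> Pow ?S" by (simp add: Pow_insert Un_commute)
  have disj: "insert x ` Pow ?S \<inter> Pow ?S = {}" using xS by auto
  have inj: "inj_on (insert x) (Pow ?S)" 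
    by (rule inj_onI) (use xS in \<open>simp add: Pow_def insert_ident subset_iff, metis insert_ident\<close>)
  have "(\<Sum>A\<in>Pow (set (x # xs)). f A) = (\<Sum>A\<in>Pow ?S. f (insert x A)) + (\<Sum>A\<in>Pow ?S. f A)"
    for f :: "nat set \<Rightarrow> 'a"
    by (simp only: Pow sum.union_disjoint[OF _ _ disj] finite_Pow_iff finite_imageI finite_set
        sum.reindex[OF inj] o_def)
  from this[of "\<lambda>A. split_sign d A (set (x # xs) - A) *\<^sub>Q
    X (sorted_list_of_set A) (sorted_list_of_set (set (x # xs) - A))"]
  have "(\<Sum>A\<in>Pow (set (x # xs)). split_sign d A (set (x # xs) - A) *\<^sub>Q
    X (sorted_list_of_set A) (sorted_list_of_set (set (x # xs) - A)))
    = (\<Sum>A\<in>Pow ?S. split_sign d (insert x A) (set (x # xs) - insert x A) *\<^sub>Q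
      X (sorted_list_of_set (insert x A)) (sorted_list_of_set (set (x # xs) - insert x A)))
    + (\<Sum>A\<in>Pow ?S. split_sign d A (set (x # xs) - A) *\<^sub>Q
      X (sorted_list_of_set A) (sorted_list_of_set (set (x # xs) - A)))" .
  also have "(\<Sum>A\<in>Pow ?S. split_sign d (insert x A) (set (x # xs) - insert x A) *\<^sub>Q
      X (sorted_list_of_set (insert x A)) (sorted_list_of_set (set (x # xs) - insert x A)))
      = (\<Sum>A\<in>Pow ?S. split_sign d A (?S - A) *\<^sub>Q
      X (x # sorted_list_of_set A) (sorted_list_of_set (?S - A)))"
    by (rule sum.cong[OF refl])
      (use x in \<open>simp add: * ws list_ins del: sorted_list_of_set_insert_remove\<close>)
  also have "(\<Sum>A\<in>Pow ?S. split_sign d A (set (x # xs) - A) *\<^sub>Q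
      X (sorted_list_of_set A) (sorted_list_of_set (set (x # xs) - A)))
      = (\<Sum>A\<in>Pow ?S. split_sign d A (?S - A) *\<^sub>Q (- 1) ^ (d x * sum_list (map d (sorted_list_of_set A))) *\<^sub>Q
      X (sorted_list_of_set A) (x # sorted_list_of_set (?S - A)))"
    by (rule sum.cong[OF refl])
      (use x in \<open>simp add: * wi list_ins scaleQ_scaleQ del: sorted_list_of_set_insert_remove\<close>)
  finally show ?case
    using Cons.prems by (simp only: ksum.simps sorted_wrt.simps Cons.IH Q.scale_left_commute)
qed

section \<open>Shuffles as subsets of positions\<close>

lemma Sh_lists:
  assumes "p \<le> k" "\<sigma> \<in> Sh p (k - p)"
  shows "sorted_list_of_set (\<sigma> ` {..<p}) = map \<sigma> [0..<p]"
    "sorted_list_of_set ({..<k} - \<sigma> ` {..<p}) = map \<sigma> [p..<k]"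
    "card (\<sigma> ` {..<p}) = p"
proof -
  have perm: "\<sigma> permutes {..<k}" and m1: "strict_mono_on {..<p} \<sigma>" and m2: "strict_mono_on {p..<k} \<sigma>"
    using assms by (auto simp: Sh_def)
  have inj: "inj_on \<sigma> A" for A using perm by (rule permutes_inj_on)
  have s: "sorted_wrt (<) (map \<sigma> [0..<p])" "sorted_wrt (<) (map \<sigma> [p..<k])"
    using m1 m2 by (auto simp: sorted_wrt_iff_nth_less strict_mono_on_def less_diff_conv add.commute)
  show "sorted_list_of_set (\<sigma> ` {..<p}) = map \<sigma> [0..<p]"
    by (rule strict_sorted_equal[OF s(1)]) (simp_all add: atLeast0LessThan)
  have "{..<k} - \<sigma> ` {..<p} = \<sigma> ` ({..<k} - {..<p})"
    by (simp only: image_set_diff[OF permutes_inj[OF perm]] permutes_image[OF perm])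
  also have "{..<k} - {..<p} = {p..<k}" by auto
  finally show "sorted_list_of_set ({..<k} - \<sigma> ` {..<p}) = map \<sigma> [p..<k]"
    by (intro strict_sorted_equal[OF s(2)]) simp_all
  show "card (\<sigma> ` {..<p}) = p" by (simp add: card_image inj)
qed

text \<open>A shuffle increases on both of its blocks, so an inversion takes one position from each;
  inversions thus correspond to the crossings counted by \<open>split_sign\<close>.\<close>

lemma split_sign_Sh:
  assumes "p \<le> k" "\<sigma> \<in> Sh p (k - p)"
  shows "split_sign d (\<sigma> ` {..<p}) ({..<k} - \<sigma> ` {..<p})
    = (\<Prod>(a, b)\<in>inversions k \<sigma>. (- 1) ^ (d (\<sigma> a) * d (\<sigma> b)))"
proof -
  have perm: "\<sigma> permutes {..<k}" and m1: "strict_mono_on {..<p} \<sigma>" and m2: "strict_mono_on {p..<k} \<sigma>"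
    using assms by (auto simp: Sh_def)
  have inv: "\<sigma> (inv \<sigma> x) = x" "inv \<sigma> (\<sigma> x) = x" for x
    using permutes_inverses[OF perm] by auto
  have inj: "\<sigma> x = \<sigma> y \<longleftrightarrow> x = y" for x y using inv by metis
  have lt: "\<sigma> x < k \<longleftrightarrow> x < k" "inv \<sigma> x < k \<longleftrightarrow> x < k" for x
    using permutes_in_image[OF perm, of x] permutes_in_image[OF permutes_inv[OF perm], of x] by auto
  have ab: "a < p \<and> p \<le> b" if "(a, b) \<in> inversions k \<sigma>" for a b
  proof -
    have *: "a < b" "b < k" "\<sigma> b < \<sigma> a" using that by (auto simp: inversions_def)
    have "\<not> b < p" using * strict_mono_onD[OF m1, of a b] by auto
    moreover have "\<not> p \<le> a" using * strict_mono_onD[OF m2, of a b] by auto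
    ultimately show ?thesis by simp
  qed
  let ?A = "\<sigma> ` {..<p}" and ?B = "{..<k} - \<sigma> ` {..<p}"
  have "split_sign d ?A ?B = (\<Prod>(x, y)\<in>(SIGMA x:?A. {y \<in> ?B. y < x}). (- 1) ^ (d x * d y))"
    unfolding split_sign_def by (rule prod.Sigma) auto
  also have "\<dots> = (\<Prod>(a, b)\<in>inversions k \<sigma>. (- 1) ^ (d (\<sigma> a) * d (\<sigma> b)))"
  proof (rule prod.reindex_bij_witness[of _ "\<lambda>(a, b). (\<sigma> a, \<sigma> b)" "\<lambda>(x, y). (inv \<sigma> x, inv \<sigma> y)"])
    fix q assume "q \<in> (SIGMA x:?A. {y \<in> ?B. y < x})"
    then obtain a y where q: "q = (\<sigma> a, y)" "a < p" "y < k" "y \<notin> ?A" "y < \<sigma> a" by auto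
    then have "p \<le> inv \<sigma> y" using inv(1)[of y] by (metis imageI lessThan_iff not_le)
    then show "(case q of (x, y) \<Rightarrow> (inv \<sigma> x, inv \<sigma> y)) \<in> inversions k \<sigma>"
      using q by (auto simp: inversions_def inv lt)
  next
    fix q assume q: "q \<in> inversions k \<sigma>"
    then show "(case q of (a, b) \<Rightarrow> (\<sigma> a, \<sigma> b)) \<in> (SIGMA x:?A. {y \<in> ?B. y < x})"
    proof (cases q)
      case (Pair a b)
      then have "a < p" "p \<le> b" "b < k" "\<sigma> b < \<sigma> a" using ab q by (auto simp: inversions_def)
      then show ?thesis by (auto simp: Pair lt inj)
    qed
  qed (auto simp: inv)
  finally show ?thesis .
qed

text \<open>The permutation with one-line notation \<open>xs\<close>, when \<open>xs\<close>
  rearranges its own indices. Beyond the list it is the identity, as \<open>permutes\<close>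
  demands.\<close>

definition perm_of_list :: "nat list \<Rightarrow> nat \<Rightarrow> nat" where
  "perm_of_list xs j = (if j < length xs then xs ! j else j)"

lemma map_perm_of_list: "b \<le> length xs \<Longrightarrow> map (perm_of_list xs) [a..<b] = take (b - a) (drop a xs)"
  by (rule nth_equalityI) (auto simp: perm_of_list_def)

lemma perm_of_list_Sh:
  assumes "A \<subseteq> {..<k}"
  defines "xs \<equiv> sorted_list_of_set A @ sorted_list_of_set ({..<k} - A)"
  shows "perm_of_list xs \<in> Sh (card A) (k - card A)" "card A \<le> k" "perm_of_list xs ` {..<card A} = A"
proof -
  have fin: "finite A" using assms(1) finite_subset by blast
  show le: "card A \<le> k" using card_mono[OF _ assms(1)] by simp
  have len: "length xs = k"
    using le by (simp add: xs_def card_Diff_subset[OF fin assms(1)])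
  have set: "set xs = {..<k}" using assms(1) fin by (auto simp: xs_def)
  have "distinct xs" using fin by (auto simp: xs_def)
  then have "bij_betw ((!) xs) {..<k} {..<k}" using bij_betw_nth len set by blast
  then have "bij_betw (perm_of_list xs) {..<k} {..<k}"
    by (rule bij_betw_cong[THEN iffD1, rotated]) (simp add: perm_of_list_def len)
  then have perm: "perm_of_list xs permutes {..<k}"
    by (rule bij_imp_permutes) (simp add: perm_of_list_def len)
  have s: "sorted_wrt (<) (sorted_list_of_set B)" for B :: "nat set" by simp
  have "perm_of_list xs i < perm_of_list xs j" if "i < j" "j < card A" for i j
    using that sorted_wrt_nth_less[OF s, of i j A] le
    by (simp add: perm_of_list_def len) (simp add: xs_def nth_append)
  moreover have "perm_of_list xs i < perm_of_list xs j" if "i < j" "card A \<le> i" "j < k" for i j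
    using that sorted_wrt_nth_less[OF s, of "i - card A" "j - card A" "{..<k} - A"] le
    by (simp add: perm_of_list_def len)
       (simp add: xs_def nth_append card_Diff_subset[OF fin assms(1)])
  ultimately show "perm_of_list xs \<in> Sh (card A) (k - card A)"
    using perm le by (auto simp: Sh_def strict_mono_on_def)
  have "perm_of_list xs ` {..<card A} = set (map (perm_of_list xs) [0..<card A])"
    by (simp add: atLeast0LessThan)
  also have "map (perm_of_list xs) [0..<card A] = sorted_list_of_set A"
    using le len by (simp only: map_perm_of_list) (simp add: xs_def)
  finally show "perm_of_list xs ` {..<card A} = A" using fin by simp
qed

text \<open>A shuffle is determined by the set of its first \<open>p\<close> values, and
  \<open>p\<close> is the size of that set. So the double sum over \<open>p\<close> and shuffles is
  one sum over all subsets.\<close>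

lemma ksum_Sh_upt:
  "(\<Sum>p\<le>k. \<Sum>\<sigma>\<in>Sh p (k - p). (\<Prod>(a, b)\<in>inversions k \<sigma>. (- 1) ^ (d (\<sigma> a) * d (\<sigma> b))) *\<^sub>Q
     X (map \<sigma> [0..<p]) (map \<sigma> [p..<k])) = ksum d [0..<k] X"
proof -
  have fin: "finite (Sh p q)" for p q
    by (rule finite_subset[OF _ finite_permutations[of "{..<p + q}"]]) (auto simp: Sh_def)
  let ?L = "\<lambda>A. sorted_list_of_set A @ sorted_list_of_set ({..<k} - A)"
  have "ksum d [0..<k] X = (\<Sum>A\<in>Pow {..<k}. split_sign d A ({..<k} - A) *\<^sub>Q
      X (sorted_list_of_set A) (sorted_list_of_set ({..<k} - A)))"
    by (subst ksum_subsets) (simp_all add: atLeast0LessThan)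
  also have "\<dots> = (\<Sum>(p, \<sigma>)\<in>(SIGMA p:{..k}. Sh p (k - p)).
      (\<Prod>(a, b)\<in>inversions k \<sigma>. (- 1) ^ (d (\<sigma> a) * d (\<sigma> b))) *\<^sub>Q X (map \<sigma> [0..<p]) (map \<sigma> [p..<k]))"
  proof (rule sum.reindex_bij_witness[symmetric,
        of _ "\<lambda>A. (card A, perm_of_list (?L A))" "\<lambda>(p, \<sigma>). \<sigma> ` {..<p}"])
    fix q assume "q \<in> (SIGMA p:{..k}. Sh p (k - p))"
    then obtain p \<sigma> where q: "q = (p, \<sigma>)" and *: "p \<le> k" "\<sigma> \<in> Sh p (k - p)" by auto
    have perm: "\<sigma> permutes {..<k}" using * by (simp add: Sh_def)
    have "?L (\<sigma> ` {..<p}) = map \<sigma> ([0..<p] @ [p..<k])"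
      by (simp add: Sh_lists[OF *])
    also have "[0..<p] @ [p..<k] = [0..<k]" using *(1) upt_add_eq_append[of 0 p "k - p"] by simp
    finally have "perm_of_list (?L (\<sigma> ` {..<p})) = \<sigma>"
      using permutes_not_in[OF perm] by (simp add: perm_of_list_def fun_eq_iff)
    moreover have "\<sigma> ` {..<p} \<subseteq> {..<k}"
      using image_mono[of "{..<p}" "{..<k}" \<sigma>] *(1) by (simp add: permutes_image[OF perm])
    ultimately show "(case q of (p, \<sigma>) \<Rightarrow> \<sigma> ` {..<p}) \<in> Pow {..<k}"
      "(card (case q of (p, \<sigma>) \<Rightarrow> \<sigma> ` {..<p}), perm_of_list (?L (case q of (p, \<sigma>) \<Rightarrow> \<sigma> ` {..<p}))) = q"
      by (simp_all only: q prod.case Sh_lists(3)[OF *] Pow_iff)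
    show "split_sign d (case q of (p, \<sigma>) \<Rightarrow> \<sigma> ` {..<p}) ({..<k} - (case q of (p, \<sigma>) \<Rightarrow> \<sigma> ` {..<p})) *\<^sub>Q
        X (sorted_list_of_set (case q of (p, \<sigma>) \<Rightarrow> \<sigma> ` {..<p}))
          (sorted_list_of_set ({..<k} - (case q of (p, \<sigma>) \<Rightarrow> \<sigma> ` {..<p}))) =
        (case q of (p, \<sigma>) \<Rightarrow> (\<Prod>(a, b)\<in>inversions k \<sigma>. (- 1) ^ (d (\<sigma> a) * d (\<sigma> b))) *\<^sub>Q
          X (map \<sigma> [0..<p]) (map \<sigma> [p..<k]))"
      by (simp only: q prod.case Sh_lists[OF *] split_sign_Sh[OF *])
  next
    fix A assume "A \<in> Pow {..<k}"
    then have A: "A \<subseteq> {..<k}" by simp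
    show "(case (card A, perm_of_list (?L A)) of (p, \<sigma>) \<Rightarrow> \<sigma> ` {..<p}) = A"
      "(card A, perm_of_list (?L A)) \<in> (SIGMA p:{..k}. Sh p (k - p))"
      using perm_of_list_Sh[OF A] by simp_all
  qed
  also have "\<dots> = (\<Sum>p\<le>k. \<Sum>\<sigma>\<in>Sh p (k - p).
      (\<Prod>(a, b)\<in>inversions k \<sigma>. (- 1) ^ (d (\<sigma> a) * d (\<sigma> b))) *\<^sub>Q X (map \<sigma> [0..<p]) (map \<sigma> [p..<k]))"
    by (rule sum.Sigma[symmetric]) (simp_all add: fin)
  finally show ?thesis ..
qed

text \<open>Letters may repeat, so subsets are taken among positions and then carried over to
  letters by \<open>ksum_map\<close>.\<close>

lemma ksum_Sh:
  "(\<Sum>p\<le>length xs. \<Sum>\<sigma>\<in>Sh p (length xs - p).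
      (\<Prod>(a, b)\<in>inversions (length xs) \<sigma>. (- 1) ^ (d (xs ! \<sigma> a) * d (xs ! \<sigma> b))) *\<^sub>Q
      X (map (\<lambda>j. xs ! \<sigma> j) [0..<p]) (map (\<lambda>j. xs ! \<sigma> j) [p..<length xs])) = ksum d xs X"
proof -
  have "ksum d xs X = ksum d (map ((!) xs) [0..<length xs]) X" by (simp add: map_nth)
  also have "\<dots> = ksum (\<lambda>i. d (xs ! i)) [0..<length xs] (\<lambda>A B. X (map ((!) xs) A) (map ((!) xs) B))"
    by (rule ksum_map)
  finally show ?thesis by (simp add: comp_def flip: ksum_Sh_upt)
qed

lemma sign_Sh:
  "\<sigma> \<in> Sh p q \<Longrightarrow> of_int (sign \<sigma>) = (\<Prod>(a, b)\<in>inversions (p + q) \<sigma>. - 1 :: rat)"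
  using sign_eq_inv_sign[of \<sigma> "p + q"]
  by (simp add: Sh_def inv_sign_inversions case_prod_unfold del: prod_constant)

section \<open>Antisymmetrisation\<close>

definition asum :: "'a list \<Rightarrow> ('a list \<Rightarrow> 'b::rat_vector) \<Rightarrow> 'b" where
  "asum us X = (\<Sum>\<sigma> | \<sigma> permutes {..<length us}. of_int (sign \<sigma>) *\<^sub>Q X (permute_list \<sigma> us))"

lemma asum_Nil: "asum [] X = X []"
  by (simp add: asum_def permute_list_def scaleQ_one)

lemma linear_asum: "linear_Q f \<Longrightarrow> f (asum us X) = asum us (\<lambda>w. f (X w))"
  by (simp add: asum_def linear_Q_D)

lemma asum_cong:
  "(\<And>w. mset w = mset us \<Longrightarrow> X w = Y w) \<Longrightarrow> asum us X = asum us Y"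
  unfolding asum_def by (intro sum.cong refl) (simp add: mset_permute_list)

lemma asum_map: "asum (map f us) X = asum us (\<lambda>w. X (map f w))"
  unfolding asum_def by (intro sum.cong) (simp_all add: permute_list_map)

text \<open>Sign of a word of distinct numbers, computed by removing its first letter. The recursion
  matches the choice of the first factor in an antisymmetrised sum.\<close>

fun word_sign :: "nat list \<Rightarrow> rat" where
  "word_sign [] = 1"
| "word_sign (x # w) = (- 1) ^ card {y \<in> set w. y < x} * word_sign w"

definition word_inversions :: "nat list \<Rightarrow> (nat \<times> nat) set" where
  "word_inversions w = {(a, b). a < b \<and> b < length w \<and> w ! b < w ! a}"

text \<open>The inversions that involve position 0 are counted by the smaller letters of the tail;
  distinctness makes counting letters the same as counting positions.\<close>

lemma word_sign_inversions: "distinct w \<Longrightarrow> word_sign w = (- 1) ^ card (word_inversions w)"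
proof (induction w)
  case Nil
  then show ?case by (simp add: word_inversions_def)
next
  case (Cons x w)
  let ?P = "{b. b < length w \<and> w ! b < x}"
  have fin: "finite (word_inversions w)"
    by (rule finite_subset[of _ "{..<length w} \<times> {..<length w}"]) (auto simp: word_inversions_def)
  have "word_inversions (x # w) = (\<lambda>b. (0, Suc b)) ` ?P \<union> map_prod Suc Suc ` word_inversions w"
  proof (intro equalityI subsetI)
    fix q assume q: "q \<in> word_inversions (x # w)"
    then obtain a b where ab: "q = (a, Suc b)" "a < Suc b" "b < length w" "w ! b < (x # w) ! a"
      by (cases q; cases "snd q") (auto simp: word_inversions_def)
    then show "q \<in> (\<lambda>b. (0, Suc b)) ` ?P \<union> map_prod Suc Suc ` word_inversions w"
      by (cases a) (auto simp: word_inversions_def image_iff)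
  qed (auto simp: word_inversions_def)
  then have "card (word_inversions (x # w)) = card ((\<lambda>b. (0::nat, Suc b)) ` ?P) + card (map_prod Suc Suc ` word_inversions w)"
    using fin by (simp only:) (rule card_Un_disjoint; auto)
  also have "card ((\<lambda>b. (0::nat, Suc b)) ` ?P) = card ?P"
    by (rule card_image) (auto intro: inj_onI)
  also have "card ?P = card ((!) w ` ?P)"
    using Cons.prems by (intro card_image[symmetric] inj_onI) (simp add: nth_eq_iff_index_eq)
  also have "(!) w ` ?P = {y \<in> set w. y < x}" by (auto simp: in_set_conv_nth image_iff)
  also have "card (map_prod Suc Suc ` word_inversions w) = card (word_inversions w)"
    by (rule card_image) (auto intro: inj_onI)
  finally show ?case using Cons by (simp add: power_add)
qed

lemma sign_eq_word_sign:
  assumes "\<sigma> permutes {..<n}"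
  shows "of_int (sign \<sigma>) = word_sign (map \<sigma> [0..<n])"
proof -
  have "distinct (map \<sigma> [0..<n])" using permutes_inj_on[OF assms] by (simp add: distinct_map)
  moreover have "word_inversions (map \<sigma> [0..<n]) = inversions n \<sigma>"
    by (auto simp: word_inversions_def inversions_def)
  ultimately show ?thesis
    using assms by (simp add: word_sign_inversions sign_eq_inv_sign inv_sign_inversions)
qed

lemma word_sign_map:
  assumes "strict_mono_on (set w) f"
  shows "word_sign (map f w) = word_sign w"
  using assms
proof (induction w)
  case (Cons x w)
  have less: "f y < f x \<longleftrightarrow> y < x" if "y \<in> set w" for y
    using that strict_mono_on_less[OF Cons.prems, of y x] by simp
  have "{y \<in> f ` set w. y < f x} = f ` {y \<in> set w. y < x}" using less by auto
  moreover have "inj_on f {y \<in> set w. y < x}"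
    using Cons.prems by (intro inj_on_subset[OF strict_mono_on_imp_inj_on]) auto
  moreover have "strict_mono_on (set w) f"
    using Cons.prems by (rule monotone_on_subset) auto
  ultimately show ?case using Cons.IH by (simp add: card_image)
qed simp

text \<open>On an increasing list a permutation can be traded for the word it produces, sign
  included. A sum over words can then be sorted by first letter.\<close>

lemma asum_sorted:
  fixes "is" :: "nat list"
  assumes s: "sorted_wrt (<) is"
  shows "asum is X = (\<Sum>w\<in>permutations_of_set (set is). word_sign w *\<^sub>Q X w)"
proof -
  let ?n = "length is"
  have dist: "distinct is" using s strict_sorted_iff by blast
  have mono: "strict_mono_on {..<?n} ((!) is)"
    using s by (auto simp: strict_mono_on_def sorted_wrt_iff_nth_less)
  have "bij_betw (\<lambda>\<sigma>. permute_list \<sigma> is) {\<sigma>. \<sigma> permutes {..<?n}} (permutations_of_set (set is))"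
    unfolding bij_betw_def
  proof (intro conjI equalityI subsetI inj_onI)
    fix \<sigma> \<tau> assume *: "\<sigma> \<in> {\<sigma>. \<sigma> permutes {..<?n}}" "\<tau> \<in> {\<sigma>. \<sigma> permutes {..<?n}}"
      and eq: "permute_list \<sigma> is = permute_list \<tau> is"
    have "\<sigma> j = \<tau> j" for j
    proof (cases "j < ?n")
      case True
      then have "is ! \<sigma> j = is ! \<tau> j" using eq * by (metis mem_Collect_eq permute_list_nth)
      moreover have "\<sigma> j < ?n" "\<tau> j < ?n" using * True permutes_in_image by fastforce+
      ultimately show ?thesis using dist by (simp add: nth_eq_iff_index_eq)
    next
      case False
      then show ?thesis
        using * permutes_not_in[of \<sigma> "{..<?n}" j] permutes_not_in[of \<tau> "{..<?n}" j] by simp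
    qed
    then show "\<sigma> = \<tau>" by (rule ext)
  next
    fix w assume "w \<in> (\<lambda>\<sigma>. permute_list \<sigma> is) ` {\<sigma>. \<sigma> permutes {..<?n}}"
    then show "w \<in> permutations_of_set (set is)"
      using dist by (auto simp: permutations_of_set_def)
  next
    fix w assume "w \<in> permutations_of_set (set is)"
    then have "mset w = mset is"
      using dist by (metis permutations_of_setD set_eq_iff_mset_eq_distinct)
    then show "w \<in> (\<lambda>\<sigma>. permute_list \<sigma> is) ` {\<sigma>. \<sigma> permutes {..<?n}}"
      by (metis (mono_tags, lifting) image_eqI mem_Collect_eq mset_eq_permutation)
  qed
  then have "(\<Sum>w\<in>permutations_of_set (set is). word_sign w *\<^sub>Q X w)
      = (\<Sum>\<sigma> | \<sigma> permutes {..<?n}. word_sign (permute_list \<sigma> is) *\<^sub>Q X (permute_list \<sigma> is))"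
    by (rule sum.reindex_bij_betw[symmetric])
  also have "\<dots> = asum is X"
    unfolding asum_def
  proof (rule sum.cong[OF refl])
    fix \<sigma> assume "\<sigma> \<in> {\<sigma>. \<sigma> permutes {..<?n}}"
    then have \<sigma>: "\<sigma> permutes {..<?n}" by simp
    have "word_sign (permute_list \<sigma> is) = word_sign (map ((!) is) (map \<sigma> [0..<?n]))"
      by (simp add: permute_list_def comp_def)
    also have "\<dots> = word_sign (map \<sigma> [0..<?n])"
      using mono by (intro word_sign_map) (simp add: atLeast0LessThan permutes_image[OF \<sigma>])
    finally show "word_sign (permute_list \<sigma> is) *\<^sub>Q X (permute_list \<sigma> is) =
        of_int (sign \<sigma>) *\<^sub>Q X (permute_list \<sigma> is)"
      by (simp add: sign_eq_word_sign[OF \<sigma>])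
  qed
  finally show ?thesis ..
qed

text \<open>Expansion along the first letter, as for a determinant along a row.\<close>

lemma sum_permutations_of_set_word_sign:
  assumes "finite S" "S \<noteq> {}"
  shows "(\<Sum>w\<in>permutations_of_set S. word_sign w *\<^sub>Q X w) =
    (\<Sum>x\<in>S. (- 1) ^ card {y \<in> S. y < x} *\<^sub>Q
      (\<Sum>w\<in>permutations_of_set (S - {x}). word_sign w *\<^sub>Q X (x # w)))"
proof -
  have "(\<Sum>w\<in>permutations_of_set S. word_sign w *\<^sub>Q X w) =
    (\<Sum>x\<in>S. \<Sum>w\<in>(#) x ` permutations_of_set (S - {x}). word_sign w *\<^sub>Q X w)"
    unfolding permutations_of_set_nonempty[OF assms(2)]
    by (rule sum.UNION_disjoint) (use assms in auto)
  also have "\<dots> = (\<Sum>x\<in>S. \<Sum>w\<in>permutations_of_set (S - {x}). word_sign (x # w) *\<^sub>Q X (x # w))"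
    by (simp add: sum.reindex)
  also have "\<dots> = (\<Sum>x\<in>S. (- 1) ^ card {y \<in> S. y < x} *\<^sub>Q
      (\<Sum>w\<in>permutations_of_set (S - {x}). word_sign w *\<^sub>Q X (x # w)))"
  proof (rule sum.cong[OF refl])
    fix x assume "x \<in> S"
    have "word_sign (x # w) = (- 1) ^ card {y \<in> S. y < x} * word_sign w"
      if "w \<in> permutations_of_set (S - {x})" for w
    proof -
      have "{y \<in> set w. y < x} = {y \<in> S. y < x}" using permutations_of_setD(1)[OF that] by auto
      then show ?thesis by simp
    qed
    then show "(\<Sum>w\<in>permutations_of_set (S - {x}). word_sign (x # w) *\<^sub>Q X (x # w)) =
      (- 1) ^ card {y \<in> S. y < x} *\<^sub>Q (\<Sum>w\<in>permutations_of_set (S - {x}). word_sign w *\<^sub>Q X (x # w))"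
      by (simp add: Q.scale_sum_right scaleQ_scaleQ del: word_sign.simps)
  qed
  finally show ?thesis .
qed

text \<open>Choosing a letter as the first one costs a sign for every letter in front of it. This is
  the Koszul sign, in degree 1, of splitting off a one-letter subword.\<close>

lemma asum_first:
  assumes "us \<noteq> []"
  shows "asum us X = ksum (\<lambda>_. 1) us (\<lambda>A B. if length A = 1 then asum B (\<lambda>w. X (A @ w)) else 0)"
proof -
  define n where "n = length us"
  let ?Y = "\<lambda>w. X (map ((!) us) w)" and ?S = "{..<n}"
  let ?Z = "\<lambda>A B. if length A = 1 then asum B (\<lambda>w. ?Y (A @ w)) else 0"
  have us: "us = map ((!) us) [0..<n]" by (simp add: n_def map_nth)
  have S: "?S \<noteq> {}" using assms by (auto simp: n_def lessThan_empty_iff)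
  have "ksum (\<lambda>_. 1) us (\<lambda>A B. if length A = 1 then asum B (\<lambda>w. X (A @ w)) else 0)
      = ksum (\<lambda>_. 1) (map ((!) us) [0..<n]) (\<lambda>A B. if length A = 1 then asum B (\<lambda>w. X (A @ w)) else 0)"
    by (simp only: us[symmetric])
  also have "\<dots> = ksum (\<lambda>_. 1) [0..<n] ?Z"
    unfolding ksum_map by (simp add: asum_map cong: if_cong)
  also have "\<dots> = (\<Sum>A\<in>Pow ?S. split_sign (\<lambda>_. 1) A (?S - A) *\<^sub>Q
      ?Z (sorted_list_of_set A) (sorted_list_of_set (?S - A)))"
    by (subst ksum_subsets) (simp, simp only: set_upt atLeast0LessThan)
  also have "\<dots> = (\<Sum>A\<in>(\<lambda>x. {x}) ` ?S. split_sign (\<lambda>_. 1) A (?S - A) *\<^sub>Q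
      ?Z (sorted_list_of_set A) (sorted_list_of_set (?S - A)))"
    by (rule sum.mono_neutral_right)
      (auto simp: Q.scale_zero_right card_1_singleton_iff image_iff)
  also have "\<dots> = (\<Sum>x\<in>?S. split_sign (\<lambda>_. 1) {x} (?S - {x}) *\<^sub>Q asum (sorted_list_of_set (?S - {x})) (\<lambda>w. ?Y (x # w)))"
    by (subst sum.reindex) (auto intro: inj_onI)
  also have "\<dots> = (\<Sum>x\<in>?S. (- 1) ^ card {y \<in> ?S. y < x} *\<^sub>Q
      (\<Sum>w\<in>permutations_of_set (?S - {x}). word_sign w *\<^sub>Q ?Y (x # w)))"
  proof (rule sum.cong[OF refl])
    fix x
    have "{b \<in> ?S - {x}. b < x} = {y \<in> ?S. y < x}" by auto
    then have "split_sign (\<lambda>_. 1) {x} (?S - {x}) = (- 1) ^ card {y \<in> ?S. y < x}"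
      by (simp add: split_sign_def)
    moreover have "set (sorted_list_of_set (?S - {x})) = ?S - {x}" by simp
    ultimately show "split_sign (\<lambda>_. 1) {x} (?S - {x}) *\<^sub>Q asum (sorted_list_of_set (?S - {x})) (\<lambda>w. ?Y (x # w))
      = (- 1) ^ card {y \<in> ?S. y < x} *\<^sub>Q (\<Sum>w\<in>permutations_of_set (?S - {x}). word_sign w *\<^sub>Q ?Y (x # w))"
      by (subst asum_sorted) simp_all
  qed
  also have "\<dots> = (\<Sum>w\<in>permutations_of_set ?S. word_sign w *\<^sub>Q ?Y w)"
    by (rule sum_permutations_of_set_word_sign[symmetric]) (simp_all add: S)
  also have "\<dots> = asum [0..<n] ?Y"
    by (subst asum_sorted) (simp_all add: atLeast0LessThan)
  also have "\<dots> = asum us X"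
    by (subst us, subst asum_map) (rule refl)
  finally show ?thesis ..
qed

text \<open>The letters of the first block are chosen, and both pieces are antisymmetrised on their
  own. One letter is split off at a time, and coassociativity joins it to the next \<open>m\<close>
  letters.\<close>

lemma asum_take_drop:
  assumes "m \<le> length us"
  shows "asum us (\<lambda>w. X (take m w) (drop m w)) =
    ksum (\<lambda>_. 1) us (\<lambda>A B. if length A = m then asum A (\<lambda>v. asum B (X v)) else 0)"
  using assms
proof (induction m arbitrary: us X)
  case 0
  have "ksum (\<lambda>_. 1) us (\<lambda>A B. if A = [] then asum [] (\<lambda>v. asum B (X v)) else 0) = asum us (X [])"
    by (simp only: ksum_nil asum_Nil)
  moreover have "(\<lambda>A B. if length A = 0 then asum A (\<lambda>v. asum B (X v)) else 0) =
      (\<lambda>A B. if A = [] then asum [] (\<lambda>v. asum B (X v)) else 0)"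
    by (simp add: fun_eq_iff)
  ultimately show ?case by simp
next
  case (Suc m)
  let ?Z = "\<lambda>A C D. if length A = 1 \<and> length C = m then asum C (\<lambda>v. asum D (X (A @ v))) else 0"
  have "asum us (\<lambda>w. X (take (Suc m) w) (drop (Suc m) w)) =
      ksum (\<lambda>_. 1) us (\<lambda>A B. if length A = 1
        then asum B (\<lambda>w. X (take (Suc m) (A @ w)) (drop (Suc m) (A @ w))) else 0)"
    using Suc.prems by (intro asum_first) auto
  also have "\<dots> = ksum (\<lambda>_. 1) us (\<lambda>A B. ksum (\<lambda>_. 1) B (?Z A))"
  proof (rule ksum_cong)
    fix A B assume AB: "mset A + mset B = mset us"
    have "length A + length B = length us" using arg_cong[OF AB, of size] by simp
    then show "(if length A = 1 then asum B (\<lambda>w. X (take (Suc m) (A @ w)) (drop (Suc m) (A @ w))) else 0)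
        = ksum (\<lambda>_. 1) B (?Z A)"
      using Suc.IH[of B "\<lambda>v. X (A @ v)"] Suc.prems by (simp add: ksum_zero)
  qed
  also have "\<dots> = ksum (\<lambda>_. 1) us (\<lambda>E D. ksum (\<lambda>_. 1) E (\<lambda>A C. ?Z A C D))"
    by (rule ksum_coassoc)
  also have "\<dots> = ksum (\<lambda>_. 1) us (\<lambda>E D. if length E = Suc m then asum E (\<lambda>v. asum D (X v)) else 0)"
  proof (rule ksum_cong)
    fix E D
    have len: "length A + length C = length E" if "mset A + mset C = mset E" for A C :: "'a list"
      using arg_cong[OF that, of size] by simp
    show "ksum (\<lambda>_. 1) E (\<lambda>A C. ?Z A C D) = (if length E = Suc m then asum E (\<lambda>v. asum D (X v)) else 0)"
    proof (cases "length E = Suc m")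
      case True
      \<comment> \<open>\<open>E\<close> collects the first letter and the block behind it; reading
        \<open>asum_first\<close> backwards restores the antisymmetrisation over the whole of
        \<open>E\<close>.\<close>
      then have "asum E (\<lambda>v. asum D (X v)) =
          ksum (\<lambda>_. 1) E (\<lambda>A C. if length A = 1 then asum C (\<lambda>w. asum D (X (A @ w))) else 0)"
        by (intro asum_first) auto
      also have "\<dots> = ksum (\<lambda>_. 1) E (\<lambda>A C. ?Z A C D)"
        by (rule ksum_cong) (use True len in force)
      finally show ?thesis using True by simp
    next
      case False
      have "ksum (\<lambda>_. 1) E (\<lambda>A C. ?Z A C D) = ksum (\<lambda>_. 1) E (\<lambda>A C. 0)"
        by (rule ksum_cong) (use False len in force)
      then show ?thesis using False by (simp add: ksum_zero)
    qed
  qed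
  finally show ?case .
qed

section \<open>Subwords of partitions\<close>

text \<open>Pairs of partitions with union \<open>L\<close> as multisets: the splittings of
  \<open>L\<close> with equal parts regarded as indistinguishable.\<close>

definition desc_pairs :: "nat list \<Rightarrow> (nat list \<times> nat list) set" where
  "desc_pairs L = {(A, B). sorted_wrt (\<ge>) A \<and> sorted_wrt (\<ge>) B \<and> mset A + mset B = mset L}"

lemma finite_desc_pairs: "finite (desc_pairs L)"
proof (rule finite_subset)
  let ?F = "{A. set A \<subseteq> set L \<and> length A \<le> length L}"
  show "finite (?F \<times> ?F)" by (intro finite_cartesian_product finite_lists_length_le) auto
  have "set A \<subseteq> set L \<and> length A \<le> length L \<and> set B \<subseteq> set L \<and> length B \<le> length L"
    if "mset A + mset B = mset L" for A B
    using arg_cong[OF that, of set_mset] arg_cong[OF that, of size] by auto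
  then show "desc_pairs L \<subseteq> ?F \<times> ?F" by (auto simp: desc_pairs_def)
qed

lemma mult_factor_superset:
  assumes "finite S" "set L \<subseteq> S"
  shows "mult_factor L = (\<Prod>m\<in>S. 1 / fact (count_list L m))"
  unfolding mult_factor_def using assms
  by (intro prod.mono_neutral_left) (auto simp: count_list_0_iff)

text \<open>For the part \<open>m\<close> this is k / k! = 1 / (k - 1)!, and the other parts keep
  their multiplicities.\<close>

lemma mult_factor_Cons: "of_nat (count_list (m # L) m) * mult_factor (m # L) = mult_factor L"
proof -
  let ?S = "insert m (set L)"
  have "mult_factor K = 1 / fact (count_list K m) * (\<Prod>x\<in>?S - {m}. 1 / fact (count_list K x))"
    if "set K \<subseteq> ?S" for K
    by (subst mult_factor_superset[OF _ that], simp, rule prod.remove) auto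
  from this[of L] this[of "m # L"]
  have 1: "mult_factor L = 1 / fact (count_list L m) * (\<Prod>x\<in>?S - {m}. 1 / fact (count_list L x))"
    and 2: "mult_factor (m # L) = 1 / fact (count_list (m # L) m) * (\<Prod>x\<in>?S - {m}. 1 / fact (count_list (m # L) x))"
    by auto
  have "(\<Prod>x\<in>?S - {m}. 1 / fact (count_list (m # L) x)) = (\<Prod>x\<in>?S - {m}. 1 / fact (count_list L x) :: rat)"
    by (rule prod.cong) auto
  moreover have "of_nat (Suc c) * (1 / fact (Suc c)) = (1 / fact c :: rat)" for c
    by (simp del: of_nat_Suc)
  ultimately show ?thesis
    unfolding 1 2 by (simp only: mult.assoc[symmetric] count_list.simps if_True refl Suc_eq_plus1[symmetric])
qed

lemma count_list_desc_pairs: "(A, B) \<in> desc_pairs L \<Longrightarrow> count_list A m + count_list B m = count_list L m"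
  by (simp add: desc_pairs_def count_mset[symmetric] flip: count_union)

lemma desc_pairs_swap: "(A, B) \<in> desc_pairs L \<longleftrightarrow> (B, A) \<in> desc_pairs L"
  by (auto simp: desc_pairs_def add.commute)

text \<open>\<open>m\<close> is the largest part, so if it occurs in the descending list
  \<open>A\<close> it is the first entry.\<close>

lemma desc_pairs_Cons:
  assumes "sorted_wrt (\<ge>) (m # L)"
  shows "{q \<in> desc_pairs (m # L). count_list (fst q) m \<noteq> 0} = (\<lambda>(A, B). (m # A, B)) ` desc_pairs L"
proof (intro equalityI subsetI)
  fix q assume "q \<in> {q \<in> desc_pairs (m # L). count_list (fst q) m \<noteq> 0}"
  then obtain A B where q: "q = (A, B)" "(A, B) \<in> desc_pairs (m # L)" "m \<in> set A"
    by (cases q) (auto simp: count_list_0_iff)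
  then obtain x A' where A: "A = x # A'" by (cases A) auto
  have eq: "mset A + mset B = mset (m # L)" using q by (simp add: desc_pairs_def)
  have "x \<in> set (m # L)" using arg_cong[OF eq, of set_mset] A by auto
  then have "x \<le> m" using assms by auto
  moreover have "m \<le> x" using q by (auto simp: A desc_pairs_def)
  ultimately have "x = m" by simp
  then have "(A', B) \<in> desc_pairs L" using q by (auto simp: A desc_pairs_def)
  then show "q \<in> (\<lambda>(A, B). (m # A, B)) ` desc_pairs L"
    by (intro image_eqI[of _ _ "(A', B)"]) (simp_all add: q A \<open>x = m\<close>)
next
  fix q assume "q \<in> (\<lambda>(A, B). (m # A, B)) ` desc_pairs L"
  then obtain A B where q: "q = (m # A, B)" "(A, B) \<in> desc_pairs L" by auto
  then have eq: "mset A + mset B = mset L" by (simp add: desc_pairs_def)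
  have "set A \<subseteq> set L" using arg_cong[OF eq, of set_mset] by auto
  then show "q \<in> {q \<in> desc_pairs (m # L). count_list (fst q) m \<noteq> 0}"
    using q assms by (auto simp: desc_pairs_def)
qed

text \<open>The factor \<open>count_list A m\<close> discards the pairs without \<open>m\<close> in
  \<open>A\<close>. In the others it cancels against the factorial when one copy of \<open>m\<close>
  is removed.\<close>

lemma sum_desc_pairs_Cons:
  fixes X :: "nat list \<Rightarrow> nat list \<Rightarrow> 'b::rat_vector"
  assumes "sorted_wrt (\<ge>) (m # L)"
  shows "(\<Sum>(A, B)\<in>desc_pairs (m # L). (of_nat (count_list A m) * mult_factor A * mult_factor B) *\<^sub>Q X A B)
    = (\<Sum>(A, B)\<in>desc_pairs L. (mult_factor A * mult_factor B) *\<^sub>Q X (m # A) B)"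
proof -
  let ?g = "\<lambda>(A, B). (of_nat (count_list A m) * mult_factor A * mult_factor B) *\<^sub>Q X A B"
  have "sum ?g (desc_pairs (m # L)) = sum ?g {q \<in> desc_pairs (m # L). count_list (fst q) m \<noteq> 0}"
    by (rule sum.mono_neutral_right) (auto simp: finite_desc_pairs Q.scale_zero_left)
  also have "\<dots> = sum ?g ((\<lambda>(A, B). (m # A, B)) ` desc_pairs L)"
    by (simp only: desc_pairs_Cons[OF assms])
  also have "\<dots> = (\<Sum>(A, B)\<in>desc_pairs L. ?g (m # A, B))"
    by (subst sum.reindex) (auto intro!: inj_onI sum.cong)
  also have "\<dots> = (\<Sum>(A, B)\<in>desc_pairs L. (mult_factor A * mult_factor B) *\<^sub>Q X (m # A) B)"
    by (simp only: prod.case mult_factor_Cons)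
  finally show ?thesis .
qed

lemma sum_desc_pairs_swap:
  "(\<Sum>(A, B)\<in>desc_pairs L. f A B) = (\<Sum>(A, B)\<in>desc_pairs L. f B A)"
  by (rule sum.reindex_bij_witness[of _ prod.swap prod.swap]) (auto simp: desc_pairs_swap)

text \<open>The weights \<open>mult_factor\<close> turn the sum over all subsequences of a partition into a sum
  over the partitions that occur among them: the subsequences choosing \<open>a\<close> of the \<open>k\<close> parts equal to \<open>m\<close>
  number \<open>k choose a\<close>, which is what the quotient of the factorials cancels.\<close>

lemma mult_factor_ksum:
  assumes "sorted_wrt (\<ge>) L"
  shows "mult_factor L *\<^sub>Q ksum (\<lambda>_. 0) L X =
    (\<Sum>(A, B)\<in>desc_pairs L. (mult_factor A * mult_factor B) *\<^sub>Q X A B)"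
  using assms
proof (induction L arbitrary: X)
  case Nil
  have "desc_pairs [] = {([], [])}" by (auto simp: desc_pairs_def)
  then show ?case by (simp add: mult_factor_def)
next
  case (Cons m L)
  let ?k = "of_nat (count_list (m # L) m) :: rat"
  let ?w = "\<lambda>A B. mult_factor A * mult_factor B"
  \<comment> \<open>The multiplicity of \<open>m\<close> is the sum of its multiplicities in
    \<open>A\<close> and in \<open>B\<close>. This Leibniz rule yields the two branches of
    \<open>ksum\<close>; the factor is nonzero and is cancelled at the end.\<close>
  have "?k *\<^sub>Q (\<Sum>(A, B)\<in>desc_pairs (m # L). ?w A B *\<^sub>Q X A B) =
     (\<Sum>(A, B)\<in>desc_pairs (m # L). (of_nat (count_list A m) * mult_factor A * mult_factor B) *\<^sub>Q X A B
       + (of_nat (count_list B m) * mult_factor B * mult_factor A) *\<^sub>Q X A B)"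
    unfolding Q.scale_sum_right
  proof (rule sum.cong[OF refl], clarify)
    fix A B assume "(A, B) \<in> desc_pairs (m # L)"
    then have "?k = of_nat (count_list A m) + of_nat (count_list B m)"
      by (simp only: count_list_desc_pairs[symmetric] of_nat_add)
    then show "?k *\<^sub>Q ?w A B *\<^sub>Q X A B =
        (of_nat (count_list A m) * mult_factor A * mult_factor B) *\<^sub>Q X A B
       + (of_nat (count_list B m) * mult_factor B * mult_factor A) *\<^sub>Q X A B"
      by (simp only: scaleQ_scaleQ scaleQ_add_left[symmetric]) (simp add: algebra_simps)
  qed
  also have "\<dots> = (\<Sum>(A, B)\<in>desc_pairs (m # L). (of_nat (count_list A m) * mult_factor A * mult_factor B) *\<^sub>Q X A B)
     + (\<Sum>(A, B)\<in>desc_pairs (m # L). (of_nat (count_list A m) * mult_factor A * mult_factor B) *\<^sub>Q X B A)"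
    using sum_desc_pairs_swap[of "\<lambda>A B. (of_nat (count_list B m) * mult_factor B * mult_factor A) *\<^sub>Q X A B"]
    by (simp only: case_prod_unfold sum.distrib)
  also have "\<dots> = (\<Sum>(A, B)\<in>desc_pairs L. ?w A B *\<^sub>Q X (m # A) B)
     + (\<Sum>(A, B)\<in>desc_pairs L. ?w B A *\<^sub>Q X A (m # B))"
    by (simp only: sum_desc_pairs_Cons[OF Cons.prems] sum_desc_pairs_Cons[OF Cons.prems, of "\<lambda>A B. X B A"]
        sum_desc_pairs_swap[of "\<lambda>A B. ?w A B *\<^sub>Q X B (m # A)"])
  also have "\<dots> = mult_factor L *\<^sub>Q ksum (\<lambda>_. 0) (m # L) X"
    using Cons by (simp add: scaleQ_add_right scaleQ_one mult.commute)
  also have "\<dots> = ?k *\<^sub>Q mult_factor (m # L) *\<^sub>Q ksum (\<lambda>_. 0) (m # L) X"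
    by (simp only: scaleQ_scaleQ mult_factor_Cons)
  finally show ?case
    by (subst (asm) Q.scale_cancel_left) auto
qed

section \<open>Splittings of pairs of partitions\<close>

lemma bipartition_bounds:
  assumes "(\<mu>, \<nu>) \<in> bipartitions N"
  shows "set \<mu> \<subseteq> {..N}" "length \<mu> \<le> N" "set \<nu> \<subseteq> {..N}" "length \<nu> \<le> N"
proof -
  have len: "length \<mu> \<le> sum_list \<mu>" if "0 \<notin> set \<mu>" for \<mu> :: "nat list"
    using that by (induction \<mu>) auto
  have el: "x \<le> sum_list \<mu>" if "x \<in> set \<mu>" for \<mu> and x :: nat
    using that by (auto intro: member_le_sum_list)
  have *: "0 \<notin> set \<mu>" "0 \<notin> set \<nu>" "sum_list \<mu> + sum_list \<nu> = N"
    using assms by (auto simp: bipartitions_def)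
  show "set \<mu> \<subseteq> {..N}" "set \<nu> \<subseteq> {..N}" using el *(3) by (auto intro: trans_le_add1 trans_le_add2)
  show "length \<mu> \<le> N" "length \<nu> \<le> N" using len[OF *(1)] len[OF *(2)] *(3) by auto
qed

lemma finite_bipartitions: "finite (bipartitions N)"
proof (rule finite_subset)
  let ?F = "{A. set A \<subseteq> {..N} \<and> length A \<le> N}"
  show "finite (?F \<times> ?F)" by (intro finite_cartesian_product finite_lists_length_le) auto
  show "bipartitions N \<subseteq> ?F \<times> ?F"
  proof
    fix q assume "q \<in> bipartitions N"
    then have "(fst q, snd q) \<in> bipartitions N" by simp
    from bipartition_bounds[OF this] show "q \<in> ?F \<times> ?F" by (simp add: mem_Times_iff)
  qed
qed

definition split_bipartitions :: "nat \<Rightarrow> ((nat list \<times> nat list) \<times> (nat list \<times> nat list)) set" where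
  "split_bipartitions N = (\<Union>p\<le>N. bipartitions p \<times> bipartitions (N - p))"

lemma finite_split_bipartitions: "finite (split_bipartitions N)"
  by (simp add: split_bipartitions_def finite_bipartitions)

definition desc_merge :: "nat list \<Rightarrow> nat list \<Rightarrow> nat list" where
  "desc_merge A B = rev (sorted_list_of_multiset (mset A + mset B))"

lemma desc_merge: "mset (desc_merge A B) = mset A + mset B" "sorted_wrt (\<ge>) (desc_merge A B)"
  by (simp_all add: desc_merge_def sorted_wrt_rev)

lemma desc_merge_unique:
  assumes "mset A + mset B = mset L" "sorted_wrt (\<ge>) L"
  shows "desc_merge A B = L"
proof -
  have "sorted (rev L)" using assms(2) by (simp add: sorted_wrt_rev)
  then have "sorted_list_of_multiset (mset L) = rev L"
    by (simp add: sorted_sort_id sorted_list_of_multiset_mset properties_for_sort)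
  then show ?thesis using assms(1) by (simp add: desc_merge_def)
qed

text \<open>A bipartition of \<open>N\<close> with a splitting of each component is an ordered pair
  of bipartitions of total size \<open>N\<close>. The map \<open>j\<close> regroups the four lists;
  \<open>i\<close> merges them in descending order, which recovers \<mu> and \<nu>.\<close>

lemma sum_bipartitions_split:
  "(\<Sum>(\<mu>, \<nu>)\<in>bipartitions N. \<Sum>(A, B)\<in>desc_pairs \<mu>. \<Sum>(C, D)\<in>desc_pairs \<nu>. g (A, C) (B, D))
    = (\<Sum>(x, y)\<in>split_bipartitions N. g x y)"
proof -
  define i where "i r = ((desc_merge (fst (fst r)) (fst (snd r)), desc_merge (snd (fst r)) (snd (snd r))),
      ((fst (fst r), fst (snd r)), (snd (fst r), snd (snd r))))"
    for r :: "(nat list \<times> nat list) \<times> (nat list \<times> nat list)"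
  define j where "j z = ((fst (fst (snd z)), fst (snd (snd z))), (snd (fst (snd z)), snd (snd (snd z))))"
    for z :: "(nat list \<times> nat list) \<times> ((nat list \<times> nat list) \<times> (nat list \<times> nat list))"
  have "(\<Sum>(\<mu>, \<nu>)\<in>bipartitions N. \<Sum>(A, B)\<in>desc_pairs \<mu>. \<Sum>(C, D)\<in>desc_pairs \<nu>. g (A, C) (B, D))
      = (\<Sum>q\<in>bipartitions N. \<Sum>r\<in>desc_pairs (fst q) \<times> desc_pairs (snd q).
          g (fst (fst r), fst (snd r)) (snd (fst r), snd (snd r)))"
    by (simp add: sum.cartesian_product case_prod_unfold)
  also have "\<dots> = (\<Sum>(q, r)\<in>(SIGMA q:bipartitions N. desc_pairs (fst q) \<times> desc_pairs (snd q)).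
          g (fst (fst r), fst (snd r)) (snd (fst r), snd (snd r)))"
    by (rule sum.Sigma) (simp_all add: finite_bipartitions finite_desc_pairs)
  also have "\<dots> = (\<Sum>(x, y)\<in>split_bipartitions N. g x y)"
  proof (rule sum.reindex_bij_witness[of _ i j])
    fix z assume "z \<in> (SIGMA q:bipartitions N. desc_pairs (fst q) \<times> desc_pairs (snd q))"
    then obtain \<mu> \<nu> A B C D where z: "z = ((\<mu>, \<nu>), ((A, B), (C, D)))"
      and bip: "(\<mu>, \<nu>) \<in> bipartitions N" and AB: "(A, B) \<in> desc_pairs \<mu>" and CD: "(C, D) \<in> desc_pairs \<nu>"
      by auto
    have eq: "mset A + mset B = mset \<mu>" "mset C + mset D = mset \<nu>"
      using AB CD by (auto simp: desc_pairs_def)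
    have s: "sum_list A + sum_list B = sum_list \<mu>" "sum_list C + sum_list D = sum_list \<nu>"
      using arg_cong[OF eq(1), of sum_mset] arg_cong[OF eq(2), of sum_mset]
      by (simp_all add: sum_mset_sum_list)
    have e: "set A \<union> set B = set \<mu>" "set C \<union> set D = set \<nu>"
      using arg_cong[OF eq(1), of set_mset] arg_cong[OF eq(2), of set_mset] by simp_all
    have "desc_merge A B = \<mu>" "desc_merge C D = \<nu>"
      using eq bip by (auto intro!: desc_merge_unique simp: bipartitions_def)
    then show "i (j z) = z" by (simp add: z i_def j_def)
    have "(A, C) \<in> bipartitions (sum_list A + sum_list C)"
      "(B, D) \<in> bipartitions (N - (sum_list A + sum_list C))" "sum_list A + sum_list C \<le> N"
      using bip AB CD s e by (auto simp: bipartitions_def desc_pairs_def)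
    then show "j z \<in> split_bipartitions N"
      by (auto simp: z j_def split_bipartitions_def)
  next
    fix z :: "(nat list \<times> nat list) \<times> (nat list \<times> nat list)"
    assume "z \<in> split_bipartitions N"
    then obtain A B C D p where z: "z = ((A, C), (B, D))" and p: "p \<le> N"
      and bip: "(A, C) \<in> bipartitions p" "(B, D) \<in> bipartitions (N - p)"
      by (auto simp: split_bipartitions_def)
    have s: "sum_list (desc_merge A B) = sum_list A + sum_list B" for A B
      by (simp flip: sum_mset_sum_list add: desc_merge)
    have e: "set (desc_merge A B) = set A \<union> set B" for A B
      by (simp flip: set_mset_mset add: desc_merge)
    have "(desc_merge A B, desc_merge C D) \<in> bipartitions N"
      using bip p by (auto simp: bipartitions_def s e desc_merge(2))
    moreover have "(A, B) \<in> desc_pairs (desc_merge A B)" "(C, D) \<in> desc_pairs (desc_merge C D)"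
      using bip by (auto simp: bipartitions_def desc_pairs_def desc_merge)
    ultimately show "i z \<in> (SIGMA q:bipartitions N. desc_pairs (fst q) \<times> desc_pairs (snd q))"
      by (simp add: z i_def)
  qed (auto simp: i_def j_def case_prod_unfold)
  finally show ?thesis .
qed

section \<open>The coproducts on generators\<close>

lemma linear_abs_pres: "linear_Q abs_pres"
  by (simp add: linear_Q_iff plus_pres.abs_eq scaleQ_pres.abs_eq)

text \<open>Through this, identities of linear maps are checked on monomials, pure tensors and words
  of triples only.\<close>

lemma span_gen: "x \<in> Q.span (range gen)"
proof -
  define p where "p = rep_pres x"
  have x: "x = abs_pres p"
    unfolding p_def by (rule Quotient_abs_rep[OF Quotient_pres, symmetric])
  have sum: "Poly_Mapping.lookup (sum f A) k = (\<Sum>a\<in>A. Poly_Mapping.lookup (f a) k)" for f :: "'a \<Rightarrow> 'a \<Rightarrow>\<^sub>0 rat" and A k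
    by (induction A rule: infinite_finite_induct) (simp_all add: lookup_add)
  have "p = (\<Sum>k\<in>Poly_Mapping.keys p. Poly_Mapping.lookup p k *\<^sub>Q symb k)"
  proof (rule poly_mapping_eqI)
    fix k
    have "Poly_Mapping.lookup (\<Sum>l\<in>Poly_Mapping.keys p. Poly_Mapping.lookup p l *\<^sub>Q symb l) k = (\<Sum>l\<in>Poly_Mapping.keys p. if l = k then Poly_Mapping.lookup p l else 0)"
      unfolding sum by (rule sum.cong) (simp_all add: lookup_scaleQ scaleQ_rat_def lookup_single when_def)
    also have "\<dots> = Poly_Mapping.lookup p k" by (simp only: sum.delta finite_keys) (simp add: in_keys_iff)
    finally show "Poly_Mapping.lookup p k = Poly_Mapping.lookup (\<Sum>l\<in>Poly_Mapping.keys p. Poly_Mapping.lookup p l *\<^sub>Q symb l) k" ..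
  qed
  then have "abs_pres p = abs_pres (\<Sum>k\<in>Poly_Mapping.keys p. Poly_Mapping.lookup p k *\<^sub>Q symb k)"
    by (rule arg_cong[where f = abs_pres])
  also have "\<dots> = (\<Sum>k\<in>Poly_Mapping.keys p. Poly_Mapping.lookup p k *\<^sub>Q gen k)"
    by (simp only: linear_Q_D[OF linear_abs_pres] gen_def)
  also have "\<dots> \<in> Q.span (range gen)"
    by (intro Q.span_sum Q.span_scale Q.span_base) simp
  finally show ?thesis by (simp only: x)
qed

lemma pres_eqI:
  assumes "linear_Q f" "linear_Q g" "\<And>s. f (gen s) = g (gen s)"
  shows "f x = g x"
  by (rule linear_Q_eq_on_span[OF assms(1,2) _ span_gen]) (auto simp: assms(3))

lemma wedge_eqI:
  assumes "linear_Q f" "linear_Q g" "\<And>us. f (wedge us) = g (wedge us)"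
  shows "f x = g x"
  by (rule pres_eqI[OF assms(1,2)]) (metis assms(3) wedge_def wedge_sym.exhaust)

lemma tensor_eqI:
  assumes "linear_Q f" "linear_Q g" "\<And>x y. f (x \<otimes> y) = g (x \<otimes> y)"
  shows "f t = g t"
  by (rule pres_eqI[OF assms(1,2)]) (metis assms(3) tensor_def tensor_sym.exhaust)

lemma sprod_eqI:
  assumes "linear_Q f" "linear_Q g" "\<And>xs. f (sprod xs) = g (sprod xs)"
  shows "f x = g x"
  by (rule pres_eqI[OF assms(1,2)]) (metis assms(3) sprod_def S_sym.exhaust)

lemma mtensor_eqI:
  assumes "linear_Q f" "linear_Q g" "\<And>ts. f (mtensor ts) = g (mtensor ts)"
  shows "f x = g x"
  by (rule pres_eqI[OF assms(1,2)]) (metis assms(3) mtensor_def M_sym.exhaust)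

lemma linear_Q_add: "linear_Q f \<Longrightarrow> linear_Q g \<Longrightarrow> linear_Q (\<lambda>x. f x + g x)"
  by (simp add: linear_Q_iff scaleQ_add_right)

lemma linear_Q_zero: "linear_Q (\<lambda>x. 0)"
  by (simp add: linear_Q_iff Q.scale_zero_right)

lemma linear_Q_id: "linear_Q (\<lambda>x. x)"
  by (simp add: linear_Q_iff)

lemma linear_tensor_left: "linear_Q (\<lambda>x. x \<otimes> y)"
  and linear_tensor_right: "linear_Q (\<lambda>y. x \<otimes> y)"
  using bilinear_tensor by (auto simp: bilinear_Q_def)

lemma bilinear_tensor_map:
  assumes "linear_Q f" "linear_Q g"
  shows "bilinear_Q (\<lambda>x y. f x \<otimes> g y)"
  unfolding bilinear_Q_def
  using linear_Q_compose[OF linear_tensor_left assms(1)] linear_Q_compose[OF linear_tensor_right assms(2)]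
  by blast

lemma tensor_map_tensor: "linear_Q f \<Longrightarrow> linear_Q g \<Longrightarrow> tensor_map f g (x \<otimes> y) = f x \<otimes> g y"
  by (simp add: tensor_map_def tensor_lift_tensor bilinear_tensor_map)

lemma linear_tensor_map: "linear_Q f \<Longrightarrow> linear_Q g \<Longrightarrow> linear_Q (tensor_map f g)"
  by (simp add: tensor_map_def linear_tensor_lift bilinear_tensor_map)

section \<open>Alternating functions and the coproduct of the exterior algebra\<close>

lemma alternating_D:
  assumes "alternating h"
  shows "linear_Q (\<lambda>x. h (xs @ x # ys))" "h (xs @ x # x # ys) = 0"
    "linear_Q (\<lambda>x. h (x # ys))" "h (x # x # ys) = 0"
proof -
  have *: "linear_Q (\<lambda>x. h (xs @ x # ys))" "h (xs @ x # x # ys) = 0" for xs x ys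
    using assms by (auto simp: alternating_def)
  show "linear_Q (\<lambda>x. h (xs @ x # ys))" "h (xs @ x # x # ys) = 0" by (rule *)+
  show "linear_Q (\<lambda>x. h (x # ys))" "h (x # x # ys) = 0" using *[of "[]"] by simp_all
qed

lemma alternating_linear: "linear_Q f \<Longrightarrow> alternating h \<Longrightarrow> alternating (\<lambda>xs. f (h xs))"
  unfolding alternating_def[of "\<lambda>xs. f (h xs)"]
  by (simp add: linear_Q_compose[OF _ alternating_D(1)] alternating_D(2) linear_Q_D(3))

lemma alternating_sign_Cons:
  assumes "alternating h"
  shows "alternating (\<lambda>xs. c ^ (sum_list (map (\<lambda>_. 1) xs)) *\<^sub>Q h xs)" "alternating (\<lambda>xs. h (x # xs))"
proof -
  show "alternating (\<lambda>xs. c ^ (sum_list (map (\<lambda>_. 1) xs)) *\<^sub>Q h xs)"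
    using alternating_D(1,2)[OF assms]
    by (simp add: alternating_def linear_Q_scaled Q.scale_zero_right)
  show "alternating (\<lambda>xs. h (x # xs))"
    using alternating_D(1,2)[OF assms, of "x # _"] by (simp add: alternating_def)
qed

text \<open>This makes the coproduct well defined. Two equal adjacent letters either fall into the
  same subword, where \<open>X\<close> vanishes, or into different ones, and the two mixed
  distributions have opposite signs.\<close>

lemma alternating_ksum:
  assumes "\<And>B. alternating (\<lambda>A. X A B)" "\<And>A. alternating (X A)"
  shows "alternating (\<lambda>us. ksum (\<lambda>_. 1) us X)"
proof -
  let ?s = "\<lambda>A. (- 1) ^ sum_list (map (\<lambda>_. 1) A) :: rat"
  \<comment> \<open>The recursion replaces \<open>X\<close> by these functions, which have to be
    alternating in both arguments again. The sign depends on the length of \<open>A\<close>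
    alone.\<close>
  have step: "alternating (\<lambda>A. X (u # A) B)" "alternating (X (u # A))"
    "alternating (\<lambda>A. ?s A *\<^sub>Q X A (u # B))" "alternating (\<lambda>B. ?s A *\<^sub>Q X A (u # B))"
    if "\<And>B. alternating (\<lambda>A. X A B)" "\<And>A. alternating (X A)" for X :: "'a list \<Rightarrow> 'a list \<Rightarrow> 'b" and u A B
    by (rule alternating_sign_Cons(2)[OF that(1)] that(2) alternating_sign_Cons(1)[OF that(1)]
        alternating_linear[OF linear_Q_scale alternating_sign_Cons(2)[OF that(2)]])+
  have "linear_Q (\<lambda>x. ksum (\<lambda>_. 1) (xs @ x # ys) X)" for xs ys
    using assms
  proof (induction xs arbitrary: X)
    case Nil
    have "linear_Q (\<lambda>x. X (x # A) B)" "linear_Q (\<lambda>x. X A (x # B))" for A B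
      by (rule alternating_D(3)[OF Nil(1)] alternating_D(3)[OF Nil(2)])+
    then show ?case
      by (auto intro!: linear_Q_add linear_Q_ksum linear_Q_scaled)
  next
    case (Cons u xs)
    show ?case
      unfolding append_Cons ksum.simps mult_1
      by (intro linear_Q_add Cons.IH step[OF Cons.prems])
  qed
  moreover have "ksum (\<lambda>_. 1) (xs @ x # x # ys) X = 0" for xs x ys
    using assms
  proof (induction xs arbitrary: X)
    case Nil
    have "X (x # x # A) B = 0" "X A (x # x # B) = 0" for A B
      by (rule alternating_D(4)[OF Nil(1)] alternating_D(4)[OF Nil(2)])+
    then show ?case
      by (simp add: ksum_zero scaleQ_scaleQ Q.scale_zero_right Q.scale_minus_left flip: ksum_add)
  next
    case (Cons u xs)
    have "ksum (\<lambda>_. 1) (xs @ x # x # ys) (\<lambda>A. X (u # A)) = 0"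
      "ksum (\<lambda>_. 1) (xs @ x # x # ys) (\<lambda>A B. ?s A *\<^sub>Q X A (u # B)) = 0"
      by (rule Cons.IH; rule step[OF Cons.prems])+
    then show ?case by simp
  qed
  ultimately show ?thesis by (simp add: alternating_def)
qed

lemma alternating_coprod: "alternating (\<lambda>us. ksum (\<lambda>_. 1) us (\<lambda>A B. wedge A \<otimes> wedge B))"
  by (intro alternating_ksum alternating_linear[OF linear_tensor_left]
      alternating_linear[OF linear_tensor_right] alternating_wedge)

text \<open>In degree 1 every inversion contributes -1, so the Koszul sign of a shuffle is its
  ordinary sign.\<close>

lemma ext_coprod_eq: "ext_coprod = ext_lift (\<lambda>us. ksum (\<lambda>_. 1) us (\<lambda>A B. wedge A \<otimes> wedge B))"
proof -
  have "(let i = length xs in \<Sum>p\<le>i. \<Sum>\<sigma>\<in>Sh p (i - p). of_int (sign \<sigma>) *\<^sub>Q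
       (wedge (map (\<lambda>j. xs ! \<sigma> j) [0..<p]) \<otimes> wedge (map (\<lambda>j. xs ! \<sigma> j) [p..<i]))) =
      ksum (\<lambda>_. 1) xs (\<lambda>A B. wedge A \<otimes> wedge B)" for xs :: "'a list"
    unfolding Let_def ksum_Sh[symmetric]
    by (intro sum.cong refl arg_cong2[of _ _ _ _ scaleQ])
      (auto dest!: sign_Sh simp del: prod_constant)
  then show ?thesis by (simp only: ext_coprod_def)
qed

lemma linear_ext_coprod: "linear_Q ext_coprod"
  and ext_coprod_wedge: "ext_coprod (wedge us) = ksum (\<lambda>_. 1) us (\<lambda>A B. wedge A \<otimes> wedge B)"
  by (simp_all only: ext_coprod_eq linear_ext_lift[OF alternating_coprod] ext_lift_wedge[OF alternating_coprod])

lemma linear_ext_counit: "linear_Q (ext_counit :: 'a::rat_vector ext \<Rightarrow> rat)"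
  and ext_counit_wedge: "ext_counit (wedge (us :: 'a list)) = (if us = [] then 1 else 0)"
proof -
  have *: "alternating (\<lambda>us :: 'a list. if us = [] then 1 else (0::rat))"
    by (simp add: alternating_def linear_Q_zero)
  show "linear_Q (ext_counit :: 'a ext \<Rightarrow> rat)" "ext_counit (wedge us) = (if us = [] then 1 else 0)"
    unfolding ext_counit_def by (rule linear_ext_lift[OF *] ext_lift_wedge[OF *])+
qed

section \<open>Functions respecting graded commutativity and the coproduct of the graded-symmetric
  algebra\<close>

definition S_compat :: "('n::finite Uhom list \<Rightarrow> 'b::rat_vector) \<Rightarrow> bool" where
  "S_compat h \<longleftrightarrow>
    (\<forall>xs x y z ys. deg x = deg z \<longrightarrow> deg y = deg z \<longrightarrow> val z = val x + val y \<longrightarrow>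
       h (xs @ z # ys) = h (xs @ x # ys) + h (xs @ y # ys)) \<and>
    (\<forall>c xs x z ys. deg x = deg z \<longrightarrow> val z = c *\<^sub>Q val x \<longrightarrow> h (xs @ z # ys) = c *\<^sub>Q h (xs @ x # ys)) \<and>
    (\<forall>xs x y ys. h (xs @ y # x # ys) = (- 1) ^ (deg x * deg y) *\<^sub>Q h (xs @ x # y # ys))"

lemma compatible_S:
  assumes "S_compat h"
  shows "compatible (\<lambda>m. case m of Mono xs \<Rightarrow> h xs)"
proof -
  have "free_extend (\<lambda>m. case m of Mono xs \<Rightarrow> h xs)
      (symb (Mono (xs @ z # ys)) - symb (Mono (xs @ x # ys)) - symb (Mono (xs @ y # ys))) = 0"
    if "deg x = deg z" "deg y = deg z" "val z = val x + val y" for xs x y z ys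
    using assms that by (simp add: S_compat_def free_extend_simps)
  moreover have "free_extend (\<lambda>m. case m of Mono xs \<Rightarrow> h xs)
      (symb (Mono (xs @ z # ys)) - c *\<^sub>Q symb (Mono (xs @ x # ys))) = 0"
    if "deg x = deg z" "val z = c *\<^sub>Q val x" for xs x z ys c
    using assms that by (simp add: S_compat_def free_extend_simps)
  moreover have "free_extend (\<lambda>m. case m of Mono xs \<Rightarrow> h xs)
      (symb (Mono (xs @ y # x # ys)) - (- 1) ^ (deg x * deg y) *\<^sub>Q symb (Mono (xs @ x # y # ys))) = 0"
    for xs x y ys
    using assms unfolding S_compat_def free_extend_simps by (metis S_sym.case right_minus_eq)
  ultimately show ?thesis
    unfolding compatible_def relations_S_sym_def by fastforce
qed

lemma S_lift_sprod: "S_compat h \<Longrightarrow> S_lift h (sprod xs) = h xs"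
  by (simp add: S_lift_def sprod_def lift_gen compatible_S)

lemma linear_S_lift: "S_compat h \<Longrightarrow> linear_Q (S_lift h)"
  by (simp add: S_lift_def linear_lift compatible_S)

lemma S_compat_sprod: "S_compat (sprod :: 'n::finite Uhom list \<Rightarrow> 'n S)"
proof -
  have *: "abs_pres p = abs_pres q" if "p - q \<in> relations" for p q :: "'n S_sym \<Rightarrow>\<^sub>0 rat"
    using that by (simp add: pres.abs_eq_iff Q.span_base)
  show ?thesis
    unfolding S_compat_def sprod_def gen_def plus_pres.abs_eq scaleQ_pres.abs_eq
  proof (intro conjI allI impI *)
    fix xs ys :: "'n Uhom list" and x y z c
    show "symb (Mono (xs @ z # ys)) - (symb (Mono (xs @ x # ys)) + symb (Mono (xs @ y # ys))) \<in> relations"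
      if "deg x = deg z" "deg y = deg z" "val z = val x + val y"
    proof -
      have "symb (Mono (xs @ [z] @ ys)) - symb (Mono (xs @ [x] @ ys)) - symb (Mono (xs @ [y] @ ys))
          \<in> relations"
        using that unfolding relations_S_sym_def by blast
      then show ?thesis by (simp add: diff_diff_eq)
    qed
    show "symb (Mono (xs @ z # ys)) - c *\<^sub>Q symb (Mono (xs @ x # ys)) \<in> relations"
      if "deg x = deg z" "val z = c *\<^sub>Q val x"
    proof -
      have "symb (Mono (xs @ [z] @ ys)) - c *\<^sub>Q symb (Mono (xs @ [x] @ ys)) \<in> relations"
        using that unfolding relations_S_sym_def by blast
      then show ?thesis by simp
    qed
    have "symb (Mono (xs @ [y, x] @ ys)) - (- 1) ^ (deg x * deg y) *\<^sub>Q symb (Mono (xs @ [x, y] @ ys))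
        \<in> relations"
      unfolding relations_S_sym_def by blast
    then show "symb (Mono (xs @ y # x # ys)) - (- 1) ^ (deg x * deg y) *\<^sub>Q symb (Mono (xs @ x # y # ys))
        \<in> relations"
      by simp
  qed
qed

lemma S_compat_D:
  assumes "S_compat h"
  shows "deg x = deg z \<Longrightarrow> deg y = deg z \<Longrightarrow> val z = val x + val y \<Longrightarrow>
      h (xs @ z # ys) = h (xs @ x # ys) + h (xs @ y # ys)"
    "deg x = deg z \<Longrightarrow> val z = c *\<^sub>Q val x \<Longrightarrow> h (xs @ z # ys) = c *\<^sub>Q h (xs @ x # ys)"
    "h (xs @ y # x # ys) = (- 1) ^ (deg x * deg y) *\<^sub>Q h (xs @ x # y # ys)"
  using assms unfolding S_compat_def by blast+

lemmas S_compat_Nil_D = S_compat_D[where xs = "[]", unfolded append_Nil]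

lemma S_compat_linear:
  assumes "linear_Q f" "S_compat (h :: 'n::finite Uhom list \<Rightarrow> 'b::rat_vector)"
  shows "S_compat (\<lambda>xs. f (h xs))"
  unfolding S_compat_def
proof (intro conjI allI impI)
  fix xs ys :: "'n Uhom list" and x y z c
  show "f (h (xs @ z # ys)) = f (h (xs @ x # ys)) + f (h (xs @ y # ys))"
    if "deg x = deg z" "deg y = deg z" "val z = val x + val y"
    by (simp only: S_compat_D(1)[OF assms(2) that] linear_Q_D(1)[OF assms(1)])
  show "f (h (xs @ z # ys)) = c *\<^sub>Q f (h (xs @ x # ys))" if "deg x = deg z" "val z = c *\<^sub>Q val x"
    by (simp only: S_compat_D(2)[OF assms(2) that] linear_Q_D(2)[OF assms(1)])
  show "f (h (xs @ y # x # ys)) = (- 1) ^ (deg x * deg y) *\<^sub>Q f (h (xs @ x # y # ys))"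
    by (subst S_compat_D(3)[OF assms(2)]) (rule linear_Q_D(2)[OF assms(1)])
qed

lemma S_compat_Cons:
  assumes "S_compat (h :: 'n::finite Uhom list \<Rightarrow> 'b::rat_vector)"
  shows "S_compat (\<lambda>xs. h (x # xs))"
  unfolding S_compat_def
proof (intro conjI allI impI)
  fix xs ys :: "'n Uhom list" and u y z c
  show "h (x # xs @ z # ys) = h (x # xs @ u # ys) + h (x # xs @ y # ys)"
    if "deg u = deg z" "deg y = deg z" "val z = val u + val y"
    using S_compat_D(1)[OF assms that, of "x # xs"] by simp
  show "h (x # xs @ z # ys) = c *\<^sub>Q h (x # xs @ u # ys)" if "deg u = deg z" "val z = c *\<^sub>Q val u"
    using S_compat_D(2)[OF assms that, of "x # xs"] by simp
  show "h (x # xs @ y # u # ys) = (- 1) ^ (deg u * deg y) *\<^sub>Q h (x # xs @ u # y # ys)"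
    using S_compat_D(3)[OF assms, of "x # xs" y u ys] by simp
qed

text \<open>The relations preserve the total degree of a word, so a sign that depends on it alone
  passes through them.\<close>

lemma S_compat_twist:
  assumes "S_compat (h :: 'n::finite Uhom list \<Rightarrow> 'b::rat_vector)"
  shows "S_compat (\<lambda>xs. (- 1) ^ (m * sum_list (map deg xs)) *\<^sub>Q h xs)"
  unfolding S_compat_def
proof (intro conjI allI impI)
  fix xs ys :: "'n Uhom list" and x y z c
  let ?s = "\<lambda>xs. (- 1) ^ (m * sum_list (map deg xs)) :: rat"
  show "?s (xs @ z # ys) *\<^sub>Q h (xs @ z # ys) =
      ?s (xs @ x # ys) *\<^sub>Q h (xs @ x # ys) + ?s (xs @ y # ys) *\<^sub>Q h (xs @ y # ys)"
    if "deg x = deg z" "deg y = deg z" "val z = val x + val y"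
    using that by (simp add: S_compat_D(1)[OF assms that] scaleQ_add_right)
  show "?s (xs @ z # ys) *\<^sub>Q h (xs @ z # ys) = c *\<^sub>Q ?s (xs @ x # ys) *\<^sub>Q h (xs @ x # ys)"
    if "deg x = deg z" "val z = c *\<^sub>Q val x"
    using that by (simp add: S_compat_D(2)[OF assms that] scaleQ_scaleQ mult.commute)
  show "?s (xs @ y # x # ys) *\<^sub>Q h (xs @ y # x # ys) =
      (- 1) ^ (deg x * deg y) *\<^sub>Q ?s (xs @ x # y # ys) *\<^sub>Q h (xs @ x # y # ys)"
    by (subst S_compat_D(3)[OF assms], subst Q.scale_left_commute) (simp add: add_ac)
qed

lemma S_compat_ksum:
  assumes "\<And>B. S_compat (\<lambda>A. X A B)" "\<And>A. S_compat (X A)"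
  shows "S_compat (\<lambda>us. ksum deg us X)"
proof -
  let ?s = "\<lambda>u A. (- 1) ^ (deg u * sum_list (map deg A)) :: rat"
  have step: "S_compat (\<lambda>A. X (u # A) B)" "S_compat (X (u # A))"
    "S_compat (\<lambda>A. ?s u A *\<^sub>Q X A (u # B))" "S_compat (\<lambda>B. ?s u A *\<^sub>Q X A (u # B))"
    if "\<And>B. S_compat (\<lambda>A. X A B)" "\<And>A. S_compat (X A)"
    for X :: "'a Uhom list \<Rightarrow> 'a Uhom list \<Rightarrow> 'b" and u A B
    by (rule S_compat_Cons[OF that(1)] that(2) S_compat_twist[OF that(1)]
        S_compat_linear[OF linear_Q_scale S_compat_Cons[OF that(2)]])+
  have "ksum deg (xs @ z # ys) X = ksum deg (xs @ x # ys) X + ksum deg (xs @ y # ys) X"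
    if z: "deg x = deg z" "deg y = deg z" "val z = val x + val y" for xs x y z ys
    using assms
  proof (induction xs arbitrary: X)
    case Nil
    have e1: "(\<lambda>A. X (z # A)) = (\<lambda>A B. X (x # A) B + X (y # A) B)"
      by (intro ext) (rule S_compat_Nil_D(1)[OF Nil(1) z])
    have e2: "X A (z # B) = X A (x # B) + X A (y # B)" for A B
      by (rule S_compat_Nil_D(1)[OF Nil(2) z])
    from e1 e2 show ?case
      by (simp add: z ksum_add scaleQ_add_right)
  next
    case (Cons u xs)
    have "ksum deg (xs @ z # ys) (\<lambda>A. X (u # A)) =
        ksum deg (xs @ x # ys) (\<lambda>A. X (u # A)) + ksum deg (xs @ y # ys) (\<lambda>A. X (u # A))"
      by (rule Cons.IH; rule step[OF Cons.prems])
    moreover have "ksum deg (xs @ z # ys) (\<lambda>A B. (- 1) ^ (deg u * sum_list (map deg A)) *\<^sub>Q X A (u # B)) =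
        ksum deg (xs @ x # ys) (\<lambda>A B. (- 1) ^ (deg u * sum_list (map deg A)) *\<^sub>Q X A (u # B)) +
        ksum deg (xs @ y # ys) (\<lambda>A B. (- 1) ^ (deg u * sum_list (map deg A)) *\<^sub>Q X A (u # B))"
      by (rule Cons.IH; rule step[OF Cons.prems])
    ultimately show ?case by simp
  qed
  moreover have "ksum deg (xs @ z # ys) X = c *\<^sub>Q ksum deg (xs @ x # ys) X"
    if z: "deg x = deg z" "val z = c *\<^sub>Q val x" for xs x z ys c
    using assms
  proof (induction xs arbitrary: X)
    case Nil
    have e1: "(\<lambda>A. X (z # A)) = (\<lambda>A B. c *\<^sub>Q X (x # A) B)"
      by (intro ext) (rule S_compat_Nil_D(2)[OF Nil(1) z])
    have e2: "X A (z # B) = c *\<^sub>Q X A (x # B)" for A B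
      by (rule S_compat_Nil_D(2)[OF Nil(2) z])
    from e1 e2 show ?case
      by (simp add: z ksum_scale scaleQ_add_right mult.commute)
  next
    case (Cons u xs)
    have "ksum deg (xs @ z # ys) (\<lambda>A. X (u # A)) = c *\<^sub>Q ksum deg (xs @ x # ys) (\<lambda>A. X (u # A))"
      by (rule Cons.IH; rule step[OF Cons.prems])
    moreover have "ksum deg (xs @ z # ys) (\<lambda>A B. (- 1) ^ (deg u * sum_list (map deg A)) *\<^sub>Q X A (u # B)) =
        c *\<^sub>Q ksum deg (xs @ x # ys) (\<lambda>A B. (- 1) ^ (deg u * sum_list (map deg A)) *\<^sub>Q X A (u # B))"
      by (rule Cons.IH; rule step[OF Cons.prems])
    ultimately show ?case by (simp add: scaleQ_add_right)
  qed
  moreover have "ksum deg (xs @ y # x # ys) X = (- 1) ^ (deg x * deg y) *\<^sub>Q ksum deg (xs @ x # y # ys) X" for xs x y ys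
    using assms
  proof (induction xs arbitrary: X)
    case Nil
    \<comment> \<open>If \<open>x\<close> and \<open>y\<close> fall into the same subword, the
      relation for \<open>X\<close> applies. The two mixed distributions are exchanged, and their
      signs differ by exactly the sign of the relation.\<close>
    have e1: "(\<lambda>A. X (y # x # A)) = (\<lambda>A B. (- 1) ^ (deg x * deg y) *\<^sub>Q X (x # y # A) B)"
      by (intro ext) (rule S_compat_Nil_D(3)[OF Nil(1)])
    have e2: "X A (y # x # B) = (- 1) ^ (deg x * deg y) *\<^sub>Q X A (x # y # B)" for A B
      by (rule S_compat_Nil_D(3)[OF Nil(2)])
    from e1 e2 show ?case
      by (simp add: ksum_scale scaleQ_add_right scaleQ_scaleQ distrib_left mult.commute
          flip: power_add ksum_add)
        (simp add: add_ac mult_ac power_add scaleQ_scaleQ)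
  next
    case (Cons u xs)
    have "ksum deg (xs @ y # x # ys) (\<lambda>A. X (u # A)) =
        (- 1) ^ (deg x * deg y) *\<^sub>Q ksum deg (xs @ x # y # ys) (\<lambda>A. X (u # A))"
      by (rule Cons.IH; rule step[OF Cons.prems])
    moreover have "ksum deg (xs @ y # x # ys) (\<lambda>A B. (- 1) ^ (deg u * sum_list (map deg A)) *\<^sub>Q X A (u # B)) =
        (- 1) ^ (deg x * deg y) *\<^sub>Q ksum deg (xs @ x # y # ys) (\<lambda>A B. (- 1) ^ (deg u * sum_list (map deg A)) *\<^sub>Q X A (u # B))"
      by (rule Cons.IH; rule step[OF Cons.prems])
    ultimately show ?case by (simp add: scaleQ_add_right)
  qed
  ultimately show ?thesis unfolding S_compat_def by blast
qed

lemma S_compat_coprod: "S_compat (\<lambda>xs. ksum deg xs (\<lambda>A B. sprod A \<otimes> sprod B))"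
  by (intro S_compat_ksum S_compat_linear[OF linear_tensor_left]
      S_compat_linear[OF linear_tensor_right] S_compat_sprod)

lemma S_coprod_eq: "S_coprod = S_lift (\<lambda>xs. ksum deg xs (\<lambda>A B. sprod A \<otimes> sprod B))"
proof -
  have "koszul_sign \<sigma> xs = (\<Prod>(a, b)\<in>inversions (length xs) \<sigma>. (- 1) ^ (deg (xs ! \<sigma> a) * deg (xs ! \<sigma> b)))"
    for \<sigma> and xs :: "'a Uhom list"
    by (simp add: koszul_sign_def inversions_def)
  then show ?thesis by (simp only: S_coprod_def Let_def ksum_Sh[symmetric])
qed

lemma linear_S_coprod: "linear_Q S_coprod"
  and S_coprod_sprod: "S_coprod (sprod xs) = ksum deg xs (\<lambda>A B. sprod A \<otimes> sprod B)"
  by (simp_all only: S_coprod_eq linear_S_lift[OF S_compat_coprod] S_lift_sprod[OF S_compat_coprod])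

lemma linear_S_counit: "linear_Q (S_counit :: 'n::finite S \<Rightarrow> rat)"
  and S_counit_sprod: "S_counit (sprod (xs :: 'n Uhom list)) = (if xs = [] then 1 else 0)"
proof -
  have *: "S_compat (\<lambda>xs :: 'n Uhom list. if xs = [] then 1 else (0::rat))"
    by (simp add: S_compat_def Q.scale_zero_right)
  show "linear_Q (S_counit :: 'n S \<Rightarrow> rat)" "S_counit (sprod xs) = (if xs = [] then 1 else 0)"
    unfolding S_counit_def by (rule linear_S_lift[OF *] S_lift_sprod[OF *])+
qed

section \<open>The map into the tensor spaces\<close>

definition multilinear :: "('a::rat_vector list \<Rightarrow> 'b::rat_vector) \<Rightarrow> bool" where
  "multilinear h \<longleftrightarrow> (\<forall>xs ys. linear_Q (\<lambda>x. h (xs @ x # ys)))"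

lemma eq_uminus_zero:
  assumes "x = - (x :: 'a::rat_vector)"
  shows "x = 0"
proof -
  have "2 *\<^sub>Q x = x + x" using scaleQ_add_left[of 1 1 x] by (simp add: scaleQ_one)
  also have "\<dots> = 0" using assms by (metis add.right_inverse)
  finally show ?thesis by simp
qed

text \<open>The entry \<open>x\<close> moves to position \<open>inv \<sigma> (length xs)\<close>
  whatever its value, and all other entries stay the same as \<open>x\<close> varies.\<close>

lemma permute_list_slot:
  assumes \<sigma>: "\<sigma> permutes {..<Suc (length xs + length ys)}"
  shows "\<exists>ls rs. \<forall>x. permute_list \<sigma> (xs @ x # ys) = ls @ x # rs"
proof -
  define j where "j = inv \<sigma> (length xs)"
  define w where "w = permute_list \<sigma> (xs @ undefined # ys)"
  have j: "\<sigma> i = length xs \<longleftrightarrow> i = j" for i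
    using permutes_inverses[OF \<sigma>] by (metis j_def)
  have "\<sigma> j = length xs" using j by blast
  then have lt: "j < length w"
    using permutes_in_image[OF \<sigma>, of j] by (simp add: w_def)
  have "permute_list \<sigma> (xs @ x # ys) = w[j := x]" for x
  proof (rule nth_equalityI)
    fix i assume "i < length (permute_list \<sigma> (xs @ x # ys))"
    then have i: "i < Suc (length xs + length ys)" by simp
    have "(xs @ x # ys) ! \<sigma> i = (if i = j then x else (xs @ undefined # ys) ! \<sigma> i)"
      using j[of i] by (auto simp: nth_append nth_Cons')
    then show "permute_list \<sigma> (xs @ x # ys) ! i = w[j := x] ! i"
      using i \<sigma> by (simp add: w_def permute_list_nth nth_list_update)
  qed (simp add: w_def)
  then show ?thesis using lt by (metis upd_conv_take_nth_drop)
qed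

text \<open>Composition with the transposition of two equal adjacent letters fixes every permuted
  list and flips every sign, so the sum equals its own negative.\<close>

lemma alternating_asum:
  assumes "multilinear X"
  shows "alternating (\<lambda>us. asum us X)"
  unfolding alternating_def
proof (intro conjI allI)
  fix xs ys :: "'a list"
  have "linear_Q (\<lambda>x. of_int (sign \<sigma>) *\<^sub>Q X (permute_list \<sigma> (xs @ x # ys)))"
    if perm: "\<sigma> permutes {..<Suc (length xs + length ys)}" for \<sigma>
  proof -
    obtain ls rs where "\<And>x. permute_list \<sigma> (xs @ x # ys) = ls @ x # rs"
      using permute_list_slot[OF perm] by blast
    then show ?thesis using assms by (simp add: multilinear_def linear_Q_scaled)
  qed
  then show "linear_Q (\<lambda>x. asum (xs @ x # ys) X)"
    unfolding asum_def length_append list.size add_Suc_right add_0_right by (intro linear_Q_sum) simp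
next
  fix xs x and ys :: "'a list"
  let ?us = "xs @ x # x # ys" and ?k = "length xs"
  let ?\<tau> = "Transposition.transpose ?k (Suc ?k)" and ?S = "{..<length ?us}"
  have \<tau>: "?\<tau> permutes ?S" by (rule permutes_swap_id) auto
  have "permute_list ?\<tau> ?us = ?us"
  proof (rule nth_equalityI)
    fix i assume "i < length (permute_list ?\<tau> ?us)"
    then have "permute_list ?\<tau> ?us ! i = ?us ! ?\<tau> i" using \<tau> by (simp only: permute_list_nth length_permute_list)
    also have "\<dots> = ?us ! i"
      by (cases "i = ?k"; cases "i = Suc ?k") (simp_all add: nth_append transpose_apply_other)
    finally show "permute_list ?\<tau> ?us ! i = ?us ! i" .
  qed simp
  then have *: "permute_list (?\<tau> \<circ> \<sigma>) ?us = permute_list \<sigma> ?us" if "\<sigma> permutes ?S" for \<sigma>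
    using permute_list_compose[OF that] by metis
  have sgn: "sign (?\<tau> \<circ> \<sigma>) = - sign \<sigma>" if "\<sigma> permutes ?S" for \<sigma>
    using that by (subst sign_compose)
      (auto simp: sign_swap_id permutation_swap_id intro: permutes_imp_permutation[OF finite_lessThan])
  have "asum ?us X = (\<Sum>\<sigma> | \<sigma> permutes ?S. of_int (sign (?\<tau> \<circ> \<sigma>)) *\<^sub>Q X (permute_list (?\<tau> \<circ> \<sigma>) ?us))"
    unfolding asum_def by (rule setum_permutations_compose_left[OF \<tau>])
  also have "\<dots> = (\<Sum>\<sigma> | \<sigma> permutes ?S. - (of_int (sign \<sigma>) *\<^sub>Q X (permute_list \<sigma> ?us)))"
    by (rule sum.cong[OF refl]) (simp only: mem_Collect_eq * sgn of_int_minus Q.scale_minus_left)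
  also have "\<dots> = - asum ?us X" by (simp only: asum_def sum_negf)
  finally show "asum ?us X = 0" by (rule eq_uminus_zero)
qed

section \<open>Words of triples and the product of the spaces \<open>M\<^sub>i\<close>\<close>

definition M_compat :: "(('n::finite H \<times> 'n H \<times> 'n H dual) list \<Rightarrow> 'b::rat_vector) \<Rightarrow> bool" where
  "M_compat h \<longleftrightarrow> (\<forall>xs ys a b d. linear_Q (\<lambda>a. h (xs @ (a, b, d) # ys)) \<and>
     linear_Q (\<lambda>b. h (xs @ (a, b, d) # ys)) \<and> linear_Q (\<lambda>d. h (xs @ (a, b, d) # ys)))"

lemma M_compat_D:
  assumes "M_compat h"
  shows "linear_Q (\<lambda>a. h (xs @ (a, b, d) # ys))" "linear_Q (\<lambda>b. h (xs @ (a, b, d) # ys))"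
    "linear_Q (\<lambda>d. h (xs @ (a, b, d) # ys))"
  using assms unfolding M_compat_def by blast+

lemma compatible_M:
  assumes "M_compat h"
  shows "compatible (\<lambda>m. case m of MSym ts \<Rightarrow> h ts)"
  unfolding compatible_def relations_M_sym_def
  by (auto simp: free_extend_simps M_compat_D[OF assms, THEN linear_Q_D(1)]
      M_compat_D[OF assms, THEN linear_Q_D(2)])

lemma M_lift_mtensor: "M_compat h \<Longrightarrow> M_lift h (mtensor ts) = h ts"
  by (simp add: M_lift_def mtensor_def lift_gen compatible_M)

lemma linear_M_lift: "M_compat h \<Longrightarrow> linear_Q (M_lift h)"
  by (simp add: M_lift_def linear_lift compatible_M)

lemma M_compat_mtensor: "M_compat (mtensor :: ('n::finite H \<times> 'n H \<times> 'n H dual) list \<Rightarrow> 'n M)"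
proof -
  have *: "abs_pres p = abs_pres q" if "p - q \<in> relations" for p q :: "'n M_sym \<Rightarrow>\<^sub>0 rat"
    using that by (simp add: pres.abs_eq_iff Q.span_base)
  have R: "symb (MSym (xs @ [(a + a', b, d)] @ ys)) - symb (MSym (xs @ [(a, b, d)] @ ys))
       - symb (MSym (xs @ [(a', b, d)] @ ys)) \<in> relations"
     "symb (MSym (xs @ [(a, b + b', d)] @ ys)) - symb (MSym (xs @ [(a, b, d)] @ ys))
       - symb (MSym (xs @ [(a, b', d)] @ ys)) \<in> relations"
     "symb (MSym (xs @ [(a, b, d + d')] @ ys)) - symb (MSym (xs @ [(a, b, d)] @ ys))
       - symb (MSym (xs @ [(a, b, d')] @ ys)) \<in> relations"
     "symb (MSym (xs @ [(c *\<^sub>Q a, b, d)] @ ys)) - c *\<^sub>Q symb (MSym (xs @ [(a, b, d)] @ ys)) \<in> relations"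
     "symb (MSym (xs @ [(a, c *\<^sub>Q b, d)] @ ys)) - c *\<^sub>Q symb (MSym (xs @ [(a, b, d)] @ ys)) \<in> relations"
     "symb (MSym (xs @ [(a, b, c *\<^sub>Q d)] @ ys)) - c *\<^sub>Q symb (MSym (xs @ [(a, b, d)] @ ys)) \<in> relations"
    for xs ys and a a' b b' :: "'n H" and d d' c
    unfolding relations_M_sym_def
    subgoal by (rule UnI1, rule UnI1, rule UnI1, rule UnI1, rule UnI1, intro CollectI exI conjI TrueI) (rule refl)
    subgoal by (rule UnI1, rule UnI1, rule UnI1, rule UnI1, rule UnI2, intro CollectI exI conjI TrueI) (rule refl)
    subgoal by (rule UnI1, rule UnI1, rule UnI1, rule UnI2, intro CollectI exI conjI TrueI) (rule refl)
    subgoal by (rule UnI1, rule UnI1, rule UnI2, intro CollectI exI conjI TrueI) (rule refl)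
    subgoal by (rule UnI1, rule UnI2, intro CollectI exI conjI TrueI) (rule refl)
    subgoal by (rule UnI2, intro CollectI exI conjI TrueI) (rule refl)
    done
  show ?thesis
    unfolding M_compat_def linear_Q_iff mtensor_def gen_def plus_pres.abs_eq scaleQ_pres.abs_eq
    by (intro conjI allI *; use R in \<open>simp add: diff_diff_eq\<close>)
qed

lemma M_compat_linear:
  assumes "linear_Q f" "M_compat h"
  shows "M_compat (\<lambda>ts. f (h ts))"
  unfolding M_compat_def
  by (intro allI conjI linear_Q_compose[OF assms(1)] M_compat_D[OF assms(2)])

lemma M_compat_prefix:
  assumes "M_compat h"
  shows "M_compat (\<lambda>ts. h (ss @ ts))"
  unfolding M_compat_def append_assoc[symmetric]
  by (intro allI conjI M_compat_D[OF assms])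

definition M_cat :: "('n::finite H \<times> 'n H \<times> 'n H dual) list \<Rightarrow> 'n M \<Rightarrow> 'n M" where
  "M_cat ss = M_lift (\<lambda>ts. mtensor (ss @ ts))"

lemma linear_M_cat: "linear_Q (M_cat ss)"
  and M_cat_mtensor: "M_cat ss (mtensor ts) = mtensor (ss @ ts)"
  unfolding M_cat_def
  by (rule linear_M_lift[OF M_compat_prefix[OF M_compat_mtensor]]
      M_lift_mtensor[OF M_compat_prefix[OF M_compat_mtensor]])+

lemma M_compat_M_cat: "M_compat (\<lambda>ss. M_cat ss y)"
proof -
  \<comment> \<open>\<open>f\<close> inserts \<open>x\<close> into any of the three slots of a
    triple, so one argument serves all three linearity conditions.\<close>
  have "linear_Q (\<lambda>x. M_cat (f x) y)" if "\<And>ts. linear_Q (\<lambda>x. mtensor (f x @ ts))" for f :: "'b::rat_vector \<Rightarrow> _"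
    unfolding linear_Q_iff
  proof (intro conjI allI)
    fix x x' c
    show "M_cat (f (x + x')) y = M_cat (f x) y + M_cat (f x') y"
      by (rule mtensor_eqI[OF linear_M_cat linear_Q_add[OF linear_M_cat linear_M_cat]])
        (simp only: M_cat_mtensor linear_Q_D[OF that])
    show "M_cat (f (c *\<^sub>Q x)) y = c *\<^sub>Q M_cat (f x) y"
      by (rule mtensor_eqI[OF linear_M_cat linear_Q_scaled[OF linear_M_cat]])
        (simp only: M_cat_mtensor linear_Q_D[OF that])
  qed
  note * = this
  show ?thesis
    unfolding M_compat_def
    by (intro allI conjI *; unfold append_assoc append_Cons; rule M_compat_D[OF M_compat_mtensor])
qed

lemma M_mult_eq: "M_mult x y = M_lift (\<lambda>ss. M_cat ss y) x"
  by (simp add: M_mult_def M_cat_def)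

lemma linear_M_mult_left: "linear_Q (\<lambda>x. M_mult x y)"
  unfolding M_mult_eq by (rule linear_M_lift[OF M_compat_M_cat])

lemma M_mult_mtensor_left: "M_mult (mtensor ss) y = M_cat ss y"
  by (simp add: M_mult_eq M_lift_mtensor[OF M_compat_M_cat])

lemma linear_M_mult_right: "linear_Q (\<lambda>y. M_mult x y)"
  unfolding linear_Q_iff
proof (intro conjI allI)
  fix y y' c
  show "M_mult x (y + y') = M_mult x y + M_mult x y'"
    by (rule mtensor_eqI[OF linear_M_mult_left linear_Q_add[OF linear_M_mult_left linear_M_mult_left]])
      (simp only: M_mult_mtensor_left linear_Q_D[OF linear_M_cat])
  show "M_mult x (c *\<^sub>Q y) = c *\<^sub>Q M_mult x y"
    by (rule mtensor_eqI[OF linear_M_mult_left linear_Q_scaled[OF linear_M_mult_left]])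
      (simp only: M_mult_mtensor_left linear_Q_D[OF linear_M_cat])
qed

lemma M_mult_mtensor: "M_mult (mtensor ss) (mtensor ts) = mtensor (ss @ ts)"
  by (simp add: M_mult_mtensor_left M_cat_mtensor)

text \<open>With the unit law, this turns concatenation of words in U into multiplication, see
  \<open>M_word_append\<close>.\<close>

lemma M_mult_assoc: "M_mult (M_mult x y) z = M_mult x (M_mult y z)"
proof (rule mtensor_eqI[of "\<lambda>x. M_mult (M_mult x y) z"])
  fix ss
  show "M_mult (M_mult (mtensor ss) y) z = M_mult (mtensor ss) (M_mult y z)"
  proof (rule mtensor_eqI[of "\<lambda>y. M_mult (M_mult (mtensor ss) y) z"])
    fix ts
    show "M_mult (M_mult (mtensor ss) (mtensor ts)) z = M_mult (mtensor ss) (M_mult (mtensor ts) z)"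
      by (rule mtensor_eqI[OF linear_M_mult_right linear_Q_compose[OF linear_M_mult_right linear_M_mult_right]])
        (simp add: M_mult_mtensor)
  qed (rule linear_Q_compose[OF linear_M_mult_left linear_M_mult_right]
      linear_Q_compose[OF linear_M_mult_right linear_M_mult_left])+
qed (rule linear_Q_compose[OF linear_M_mult_left linear_M_mult_left] linear_M_mult_left)+

lemma M_mult_unit: "M_mult (mtensor []) y = y"
  by (rule mtensor_eqI[OF linear_M_mult_right linear_Q_id]) (simp add: M_mult_mtensor)

text \<open>The summand \<open>M\<^sub>i\<close>. Homogeneity matters because contractions cut a
  product after a fixed number of factors.\<close>

definition M_part :: "nat \<Rightarrow> 'n::finite M set" where
  "M_part i = Q.span {mtensor ts | ts. length ts = i}"

lemma M_part_eqI:
  assumes "linear_Q f" "linear_Q g" "\<And>ts. length ts = i \<Longrightarrow> f (mtensor ts) = g (mtensor ts)" "x \<in> M_part i"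
  shows "f x = g x"
  using assms(3) by (intro linear_Q_eq_on_span[OF assms(1,2) _ assms(4)[unfolded M_part_def]]) auto

lemma M_part_mtensor: "length ts = i \<Longrightarrow> mtensor ts \<in> M_part i"
  unfolding M_part_def by (intro Q.span_base) auto

lemma M_mult_part:
  assumes "x \<in> M_part i" "y \<in> M_part j"
  shows "M_mult x y \<in> M_part (i + j)"
  unfolding M_part_def
proof (rule linear_Q_span_subset[OF linear_M_mult_left _ assms(1)[unfolded M_part_def]])
  fix x :: "'a M" assume "x \<in> {mtensor ts | ts. length ts = i}"
  then obtain ss where ss: "x = mtensor ss" "length ss = i" by auto
  show "M_mult x y \<in> Q.span {mtensor ts | ts. length ts = i + j}"
  proof (rule linear_Q_span_subset[OF linear_M_mult_right _ assms(2)[unfolded M_part_def]])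
    fix y :: "'a M" assume "y \<in> {mtensor ts | ts. length ts = j}"
    then show "M_mult x y \<in> Q.span {mtensor ts | ts. length ts = i + j}"
      using ss by (auto simp: M_mult_mtensor intro!: Q.span_base)
  qed
qed

section \<open>The map \<phi> and its antisymmetrisation \<iota>\<close>

definition phi_list :: "'n::finite H dual \<Rightarrow> 'n H list \<Rightarrow> 'n M" where
  "phi_list d as = (case as of [a, b] \<Rightarrow> mtensor [(a, b, d)] - mtensor [(b, a, d)] | _ \<Rightarrow> 0)"

definition phi_tensor :: "'n::finite ext_dual \<Rightarrow> 'n M" where
  "phi_tensor = tensor_lift (\<lambda>w d. ext_lift (phi_list d) w)"

lemma linear_mtensor_single:
  "linear_Q (\<lambda>a. mtensor [(a, b, d)])" "linear_Q (\<lambda>b. mtensor [(a, b, d)])"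
  "linear_Q (\<lambda>d. mtensor [(a, b, d)])"
  using M_compat_D[OF M_compat_mtensor, of "[]" _ _ "[]"] by simp_all

lemma linear_Q_diff: "linear_Q f \<Longrightarrow> linear_Q g \<Longrightarrow> linear_Q (\<lambda>x. f x - g x)"
  by (simp add: linear_Q_iff Q.scale_right_diff_distrib)

text \<open>Words of length other than two are sent to 0; on two letters the difference is
  antisymmetric by construction.\<close>

lemma alternating_phi_list: "alternating (phi_list d)"
  unfolding alternating_def
proof (intro conjI allI)
  fix xs ys :: "'a H list" and x
  consider b where "xs = []" "ys = [b]" | a where "xs = [a]" "ys = []" | "length xs + length ys \<noteq> 1"
    by (cases xs; cases ys; cases "tl xs"; cases "tl ys") auto
  then show "linear_Q (\<lambda>x. phi_list d (xs @ x # ys))"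
  proof cases
    case 3
    then have "phi_list d (xs @ x # ys) = 0" for x
      by (cases xs; cases ys; cases "tl xs"; cases "tl ys") (auto simp: phi_list_def split: list.splits)
    then show ?thesis by (simp add: linear_Q_zero)
  qed (simp_all add: phi_list_def linear_Q_diff linear_mtensor_single)
  show "phi_list d (xs @ x # x # ys) = 0"
    by (cases xs; cases ys; cases "tl xs") (auto simp: phi_list_def split: list.splits)
qed

lemma linear_phi_list: "linear_Q (\<lambda>d. phi_list d as)"
  by (cases as; cases "tl as"; cases "tl (tl as)")
    (auto simp: phi_list_def linear_Q_zero linear_Q_diff linear_mtensor_single)

lemma bilinear_phi: "bilinear_Q (\<lambda>w d. ext_lift (phi_list d) w)"
  unfolding bilinear_Q_def
proof (intro conjI allI)
  show lin: "linear_Q (ext_lift (phi_list d))" for d :: "'a H dual"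
    by (rule linear_ext_lift[OF alternating_phi_list])
  fix w :: "'a H ext"
  show "linear_Q (\<lambda>d. ext_lift (phi_list d) w)"
    unfolding linear_Q_iff
  proof (intro conjI allI)
    fix d d' :: "'a H dual" and c
    show "ext_lift (phi_list (d + d')) w = ext_lift (phi_list d) w + ext_lift (phi_list d') w"
      by (rule wedge_eqI[OF lin linear_Q_add[OF lin lin]])
        (simp only: ext_lift_wedge[OF alternating_phi_list] linear_Q_D[OF linear_phi_list])
    show "ext_lift (phi_list (c *\<^sub>Q d)) w = c *\<^sub>Q ext_lift (phi_list d) w"
      by (rule wedge_eqI[OF lin linear_Q_scaled[OF lin]])
        (simp only: ext_lift_wedge[OF alternating_phi_list] linear_Q_D[OF linear_phi_list])
  qed
qed

lemma linear_phi_tensor: "linear_Q phi_tensor"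
  and phi_tensor_wedge: "phi_tensor (wedge as \<otimes> d) = phi_list d as"
  by (simp_all add: phi_tensor_def linear_tensor_lift[OF bilinear_phi] tensor_lift_tensor[OF bilinear_phi]
      ext_lift_wedge[OF alternating_phi_list])

lemma \<phi>_eq: "\<phi> u = phi_tensor (Rep_U u)"
  by (simp only: \<phi>_def phi_tensor_def phi_list_def[abs_def])

lemma linear_\<phi>: "linear_Q \<phi>"
  by (simp add: linear_Q_iff \<phi>_eq plus_U.rep_eq scaleQ_U.rep_eq linear_Q_D[OF linear_phi_tensor])

lemma \<phi>_part: "\<phi> u \<in> M_part 1"
  unfolding \<phi>_eq M_part_def
proof (rule linear_Q_span_subset[OF linear_phi_tensor _ Rep_U[unfolded Upart_def]])
  fix t :: "'a ext_dual" assume "t \<in> {wedge as \<otimes> d | as d. length as = Suc 1}"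
  then obtain a b d where "t = wedge [a, b] \<otimes> d" by (auto simp: length_Suc_conv)
  then show "phi_tensor t \<in> Q.span {mtensor ts | ts. length ts = 1}"
    by (simp add: phi_tensor_wedge phi_list_def) (intro Q.span_diff Q.span_base; force)
qed

definition M_word :: "'n::finite U list \<Rightarrow> 'n M" where
  "M_word us = foldr M_mult (map \<phi> us) (mtensor [])"

lemma M_word_simps: "M_word [] = mtensor []" "M_word (u # us) = M_mult (\<phi> u) (M_word us)"
  by (simp_all add: M_word_def)

lemma M_word_append: "M_word (us @ vs) = M_mult (M_word us) (M_word vs)"
  by (induction us) (simp_all add: M_word_simps M_mult_unit M_mult_assoc)

lemma multilinear_M_word: "multilinear M_word"
  unfolding multilinear_def M_word_append M_word_simps
  by (intro allI linear_Q_compose[OF linear_M_mult_right] linear_Q_compose[OF linear_M_mult_left linear_\<phi>])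

lemma M_word_part: "M_word us \<in> M_part (length us)"
proof (induction us)
  case Nil
  then show ?case by (simp add: M_word_simps M_part_mtensor)
next
  case (Cons u us)
  then show ?case using M_mult_part[OF \<phi>_part] by (simp add: M_word_simps)
qed

lemma \<iota>_eq: "\<iota> = ext_lift (\<lambda>us. asum us M_word)"
proof -
  have "foldr M_mult (map (\<lambda>j. \<phi> (us ! \<sigma> j)) [0..<length us]) (mtensor []) = M_word (permute_list \<sigma> us)"
    for us :: "'a U list" and \<sigma>
    by (simp add: M_word_def permute_list_def comp_def)
  then show ?thesis by (simp only: \<iota>_def asum_def)
qed

lemma linear_\<iota>: "linear_Q \<iota>"
  and \<iota>_wedge: "\<iota> (wedge us) = asum us M_word"
  by (simp_all only: \<iota>_eq linear_ext_lift[OF alternating_asum[OF multilinear_M_word]]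
      ext_lift_wedge[OF alternating_asum[OF multilinear_M_word]])

section \<open>Contractions and their equivariance\<close>

text \<open>The scalar common to both contractions; the wheel multiplies it by one further pairing,
  which closes the cycle.\<close>

definition chain :: "('n::finite H \<times> 'n H \<times> 'n H dual) list \<Rightarrow> rat" where
  "chain ts = (\<Prod>j\<in>{1..<length ts}. dual_apply (fac_d (ts ! j)) (fac_b (ts ! (j - 1))))"

lemma chain_Nil: "chain [] = 1"
  by (simp add: chain_def)

lemma chain_Cons: "chain (t # ts) = (if ts = [] then 1 else dual_apply (fac_d (hd ts)) (fac_b t)) * chain ts"
proof (cases ts)
  case (Cons t' r)
  let ?f = "\<lambda>j. dual_apply (fac_d ((t # ts) ! j)) (fac_b ((t # ts) ! (j - 1)))"
  have "chain (t # ts) = prod ?f {Suc 0..<Suc (length ts)}" by (simp add: chain_def)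
  also have "\<dots> = ?f (Suc 0) * prod ?f {Suc (Suc 0)..<Suc (length ts)}"
    by (rule prod.atLeast_Suc_lessThan) (simp add: Cons)
  also have "prod ?f {Suc (Suc 0)..<Suc (length ts)} = prod (?f \<circ> Suc) {Suc 0..<length ts}"
    by (rule prod.atLeast_Suc_lessThan_Suc_shift)
  also have "\<dots> = chain ts"
    unfolding chain_def One_nat_def by (rule prod.cong) (auto simp: nth_Cons')
  finally show ?thesis by (simp add: Cons)
qed (simp add: chain_def)

text \<open>Isolates the two pairings in which a given triple takes part: its \<open>d\<close> with
  the preceding \<open>b\<close>, and its \<open>b\<close> with the following \<open>d\<close>.
  Linearity in each slot is read off from this.\<close>

lemma chain_slot:
  "chain (xs @ t # ys) = chain xs * (if xs = [] then 1 else dual_apply (fac_d t) (fac_b (last xs))) *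
     ((if ys = [] then 1 else dual_apply (fac_d (hd ys)) (fac_b t)) * chain ys)"
  by (induction xs) (auto simp: chain_Nil chain_Cons hd_append)

lemma linear_dual_apply_left: "linear_Q (\<lambda>d. dual_apply d h)"
  by (simp add: linear_Q_iff plus_dual.rep_eq scaleQ_dual.rep_eq)

lemma linear_Q_scalar: "linear_Q s \<Longrightarrow> linear_Q (\<lambda>x. s x *\<^sub>Q w)"
  by (simp add: linear_Q_iff scaleQ_add_left scaleQ_rat_def scaleQ_scaleQ)

lemma linear_Q_mult: "linear_Q s \<Longrightarrow> linear_Q (\<lambda>x. s x * c)" "linear_Q s \<Longrightarrow> linear_Q (\<lambda>x. c * s x)"
  for c :: rat
  by (simp_all add: linear_Q_iff scaleQ_rat_def algebra_simps)

lemma linear_Q_tensor_left: "linear_Q f \<Longrightarrow> linear_Q (\<lambda>x. f x \<otimes> y)"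
  by (rule linear_Q_compose[OF linear_tensor_left])

lemma linear_wedge_slots: "linear_Q (\<lambda>x. wedge (x # ys))" "linear_Q (\<lambda>x. wedge (a # x # ys))"
  "linear_Q (\<lambda>x. wedge (xs @ a # x # ys))"
  using linear_wedge_slot[of "[]" ys] linear_wedge_slot[of "[a]" ys] linear_wedge_slot[of "xs @ [a]" ys]
  by simp_all

lemmas linear_Q_intros = linear_Q_scalar linear_Q_scaled linear_Q_mult linear_Q_tensor_left
  linear_tensor_right linear_dual_apply linear_dual_apply_left linear_wedge_slot
  linear_wedge_slots

lemma M_compat_length:
  assumes "M_compat h"
  shows "M_compat (\<lambda>ts. if length ts = i then h ts else 0)"
  unfolding M_compat_def
proof (intro allI)
  fix xs ys :: "('a H \<times> 'a H \<times> 'a H dual) list" and a b d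
  show "linear_Q (\<lambda>a. if length (xs @ (a, b, d) # ys) = i then h (xs @ (a, b, d) # ys) else 0) \<and>
    linear_Q (\<lambda>b. if length (xs @ (a, b, d) # ys) = i then h (xs @ (a, b, d) # ys) else 0) \<and>
    linear_Q (\<lambda>d. if length (xs @ (a, b, d) # ys) = i then h (xs @ (a, b, d) # ys) else 0)"
    by (cases "length xs + Suc (length ys) = i") (simp_all add: M_compat_D[OF assms] linear_Q_zero)
qed

text \<open>The cases concern the ends of the chain: the \<open>d\<close> of the first triple enters
  the dual factor and the \<open>b\<close> of the last one enters the wedge, instead of a
  scalar.\<close>

lemma M_compat_c_map:
  "M_compat (\<lambda>ts. chain ts *\<^sub>Q (wedge (map fac_a ts @ [fac_b (last ts)]) \<otimes> fac_d (hd ts)))"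
  unfolding M_compat_def chain_slot map_append list.map append_assoc append_Cons
proof (intro allI conjI)
  fix xs ys :: "('a H \<times> 'a H \<times> 'a H dual) list" and a b d
  note simps = hd_append last_append
  show "linear_Q (\<lambda>a. (chain xs * (if xs = [] then 1 else dual_apply (fac_d (a, b, d)) (fac_b (last xs))) *
      ((if ys = [] then 1 else dual_apply (fac_d (hd ys)) (fac_b (a, b, d))) * chain ys)) *\<^sub>Q
      (wedge (map fac_a xs @ fac_a (a, b, d) # map fac_a ys @ [fac_b (last (xs @ (a, b, d) # ys))])
       \<otimes> fac_d (hd (xs @ (a, b, d) # ys))))"
    by (cases "xs = []"; cases "ys = []") (simp_all add: simps, (intro linear_Q_intros)+)
  show "linear_Q (\<lambda>b. (chain xs * (if xs = [] then 1 else dual_apply (fac_d (a, b, d)) (fac_b (last xs))) *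
      ((if ys = [] then 1 else dual_apply (fac_d (hd ys)) (fac_b (a, b, d))) * chain ys)) *\<^sub>Q
      (wedge (map fac_a xs @ fac_a (a, b, d) # map fac_a ys @ [fac_b (last (xs @ (a, b, d) # ys))])
       \<otimes> fac_d (hd (xs @ (a, b, d) # ys))))"
    by (cases "xs = []"; cases "ys = []") (simp_all add: simps, (intro linear_Q_intros)+)
  show "linear_Q (\<lambda>d. (chain xs * (if xs = [] then 1 else dual_apply (fac_d (a, b, d)) (fac_b (last xs))) *
      ((if ys = [] then 1 else dual_apply (fac_d (hd ys)) (fac_b (a, b, d))) * chain ys)) *\<^sub>Q
      (wedge (map fac_a xs @ fac_a (a, b, d) # map fac_a ys @ [fac_b (last (xs @ (a, b, d) # ys))])
       \<otimes> fac_d (hd (xs @ (a, b, d) # ys))))"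
    by (cases "xs = []"; cases "ys = []") (simp_all add: simps, (intro linear_Q_intros)+)
qed

lemma c_map_eq: "c_map i = M_lift (\<lambda>ts. if length ts = i then
    chain ts *\<^sub>Q (wedge (map fac_a ts @ [fac_b (last ts)]) \<otimes> fac_d (hd ts)) else 0)"
  unfolding c_map_def by (intro arg_cong[of _ _ M_lift] ext) (simp add: chain_def)

lemma linear_c_map: "linear_Q (c_map i)"
  and c_map_mtensor: "c_map i (mtensor ts) = (if length ts = i then
    chain ts *\<^sub>Q (wedge (map fac_a ts @ [fac_b (last ts)]) \<otimes> fac_d (hd ts)) else 0)"
  unfolding c_map_eq
  by (rule linear_M_lift[OF M_compat_length[OF M_compat_c_map]]
      M_lift_mtensor[OF M_compat_length[OF M_compat_c_map]])+

text \<open>The closing pairing joins the two ends of the chain, so every slot occurs exactly once;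
  for a single triple it pairs \<open>d\<close> with \<open>b\<close> of that same triple.\<close>

lemma M_compat_c_wheel:
  "M_compat (\<lambda>ts. (dual_apply (fac_d (hd ts)) (fac_b (last ts)) * chain ts) *\<^sub>Q wedge (map fac_a ts))"
  unfolding M_compat_def chain_slot map_append list.map append_assoc append_Cons
proof (intro allI conjI)
  fix xs ys :: "('a H \<times> 'a H \<times> 'a H dual) list" and a b d
  note simps = hd_append last_append
  show "linear_Q (\<lambda>a. (dual_apply (fac_d (hd (xs @ (a, b, d) # ys))) (fac_b (last (xs @ (a, b, d) # ys))) *
      (chain xs * (if xs = [] then 1 else dual_apply (fac_d (a, b, d)) (fac_b (last xs))) *
      ((if ys = [] then 1 else dual_apply (fac_d (hd ys)) (fac_b (a, b, d))) * chain ys))) *\<^sub>Q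
      wedge (map fac_a xs @ fac_a (a, b, d) # map fac_a ys))"
    by (cases "xs = []"; cases "ys = []") (simp_all add: simps, (intro linear_Q_intros)+)
  show "linear_Q (\<lambda>b. (dual_apply (fac_d (hd (xs @ (a, b, d) # ys))) (fac_b (last (xs @ (a, b, d) # ys))) *
      (chain xs * (if xs = [] then 1 else dual_apply (fac_d (a, b, d)) (fac_b (last xs))) *
      ((if ys = [] then 1 else dual_apply (fac_d (hd ys)) (fac_b (a, b, d))) * chain ys))) *\<^sub>Q
      wedge (map fac_a xs @ fac_a (a, b, d) # map fac_a ys))"
    by (cases "xs = []"; cases "ys = []") (simp_all add: simps, (intro linear_Q_intros)+)
  show "linear_Q (\<lambda>d. (dual_apply (fac_d (hd (xs @ (a, b, d) # ys))) (fac_b (last (xs @ (a, b, d) # ys))) *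
      (chain xs * (if xs = [] then 1 else dual_apply (fac_d (a, b, d)) (fac_b (last xs))) *
      ((if ys = [] then 1 else dual_apply (fac_d (hd ys)) (fac_b (a, b, d))) * chain ys))) *\<^sub>Q
      wedge (map fac_a xs @ fac_a (a, b, d) # map fac_a ys))"
    by (cases "xs = []"; cases "ys = []") (simp_all add: simps, (intro linear_Q_intros)+)
qed

lemma c_wheel_ext_eq: "c_wheel_ext i = M_lift (\<lambda>ts. if length ts = i then
    (dual_apply (fac_d (hd ts)) (fac_b (last ts)) * chain ts) *\<^sub>Q wedge (map fac_a ts) else 0)"
  unfolding c_wheel_ext_def by (intro arg_cong[of _ _ M_lift] ext) (simp add: chain_def)

lemma linear_c_wheel_ext: "linear_Q (c_wheel_ext i)"
  and c_wheel_ext_mtensor: "c_wheel_ext i (mtensor ts) = (if length ts = i then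
    (dual_apply (fac_d (hd ts)) (fac_b (last ts)) * chain ts) *\<^sub>Q wedge (map fac_a ts) else 0)"
  unfolding c_wheel_ext_eq
  by (rule linear_M_lift[OF M_compat_length[OF M_compat_c_wheel]]
      M_lift_mtensor[OF M_compat_length[OF M_compat_c_wheel]])+

lemma span_mtensor: "z \<in> Q.span (range mtensor)"
proof -
  have "range gen \<subseteq> range (mtensor :: ('a H \<times> 'a H \<times> 'a H dual) list \<Rightarrow> 'a M)"
  proof
    fix y :: "'a M" assume "y \<in> range gen"
    then obtain s :: "'a M_sym" where "y = gen s" by auto
    then show "y \<in> range mtensor" by (cases s) (auto simp: mtensor_def)
  qed
  then show ?thesis using Q.span_mono span_gen by blast
qed

section \<open>Ranges and GL-equivariance of the contractions\<close>

lemma c_map_in: "c_map i z \<in> Upart i"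
  unfolding Upart_def
proof (rule linear_Q_span_subset[OF linear_c_map _ span_mtensor])
  fix x :: "'a M" assume "x \<in> range mtensor"
  then obtain ts where x: "x = mtensor ts" by auto
  have mem: "wedge (map fac_a ts @ [fac_b (last ts)]) \<otimes> fac_d (hd ts) \<in> {wedge as \<otimes> d | as d. length as = Suc i}"
    if "length ts = i"
    using that by (intro CollectI exI[of _ "map fac_a ts @ [fac_b (last ts)]"] exI[of _ "fac_d (hd ts)"]) simp
  show "c_map i x \<in> Q.span {wedge as \<otimes> d | as d. length as = Suc i}"
    unfolding x c_map_mtensor 
    by (split if_split, intro conjI impI) (rule Q.span_scale[OF Q.span_base[OF mem]] Q.span_zero; assumption)+
qed

lemma c_wheel_ext_in: "c_wheel_ext i z \<in> ext_part i"
  unfolding ext_part_def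
proof (rule linear_Q_span_subset[OF linear_c_wheel_ext _ span_mtensor])
  fix x :: "'a M" assume "x \<in> range mtensor"
  then obtain ts where x: "x = mtensor ts" by auto
  have mem: "wedge (map fac_a ts) \<in> {wedge xs | xs. length xs = i}" if "length ts = i"
    using that by (intro CollectI exI[of _ "map fac_a ts"]) simp
  show "c_wheel_ext i x \<in> Q.span {wedge xs | xs. length xs = i}"
    unfolding x c_wheel_ext_mtensor 
    by (split if_split, intro conjI impI) (rule Q.span_scale[OF Q.span_base[OF mem]] Q.span_zero; assumption)+
qed

lemma Upart_closed: "0 \<in> Upart i" "u \<in> Upart i \<Longrightarrow> v \<in> Upart i \<Longrightarrow> u + v \<in> Upart i"
  "u \<in> Upart i \<Longrightarrow> c *\<^sub>Q u \<in> Upart i"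
  unfolding Upart_def by (rule Q.span_zero Q.span_add Q.span_scale; assumption)+

lemma gl_extH_in: "w \<in> ext_part i \<Longrightarrow> gl_extH g w \<in> ext_part i"
  unfolding ext_part_def
  by (rule linear_Q_span_subset[OF linear_gl_extH]; (assumption | (auto simp: gl_extH_wedge intro!: Q.span_base)))

lemma gl_ext_dual_in:
  assumes "u \<in> Upart i"
  shows "gl_ext_dual g u \<in> Upart i"
  unfolding Upart_def
proof (rule linear_Q_span_subset[OF linear_gl_ext_dual _ assms[unfolded Upart_def]])
  fix x :: "'a ext_dual" assume "x \<in> {wedge as \<otimes> d | as d. length as = Suc i}"
  then obtain as d where x: "x = wedge as \<otimes> d" "length as = Suc i" by auto
  then show "gl_ext_dual g x \<in> Q.span {wedge as \<otimes> d | as d. length as = Suc i}"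
    by (intro Q.span_base CollectI exI[of _ "map ((*v) g) as"] exI[of _ "gl_dual g d"])
      (simp add: gl_ext_dual_tensor gl_extH_wedge)
qed

text \<open>In the contragredient action \<open>g\<close> meets its inverse, so pairings are
  invariant, and with them \<open>chain\<close>.\<close>

lemma gl_dual_matrix:
  assumes "invertible g"
  shows "dual_apply (gl_dual g d) (g *v h) = dual_apply d h"
proof -
  have "matrix_inv g ** g = mat 1"
    using assms unfolding invertible_def matrix_inv_def by (rule someI2_ex) blast
  then show ?thesis by (simp add: gl_dual.rep_eq matrix_vector_mul_assoc)
qed

lemma contraction_gl:
  assumes "invertible g"
  shows "contraction (gl_ext_dual g u) = gl_extH g (contraction u)"
proof (rule tensor_eqI[of "\<lambda>u. contraction (gl_ext_dual g u)"])
  show "linear_Q (\<lambda>u. contraction (gl_ext_dual g u))"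
    by (rule linear_Q_compose[OF linear_contraction linear_gl_ext_dual])
  show "linear_Q (\<lambda>u. gl_extH g (contraction u))"
    by (rule linear_Q_compose[OF linear_gl_extH linear_contraction])
  fix w :: "'a H ext" and d
  show "contraction (gl_ext_dual g (w \<otimes> d)) = gl_extH g (contraction (w \<otimes> d))"
    unfolding gl_ext_dual_tensor
  proof (rule wedge_eqI[of "\<lambda>w. contraction (gl_extH g w \<otimes> gl_dual g d)"])
    show "linear_Q (\<lambda>w. contraction (gl_extH g w \<otimes> gl_dual g d))"
      by (intro linear_Q_compose[OF linear_contraction] linear_Q_tensor_left linear_gl_extH)
    show "linear_Q (\<lambda>w. gl_extH g (contraction (w \<otimes> d)))"
      by (intro linear_Q_compose[OF linear_gl_extH] linear_Q_compose[OF linear_contraction] linear_tensor_left)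
    fix as :: "'a H list"
    show "contraction (gl_extH g (wedge as) \<otimes> gl_dual g d) = gl_extH g (contraction (wedge as \<otimes> d))"
      by (simp add: gl_extH_wedge contraction_wedge linear_Q_D[OF linear_gl_extH] gl_dual_matrix[OF assms]
          take_map drop_map)
  qed
qed

definition gl_triple :: "rat ^ 'n ^ 'n \<Rightarrow> 'n::finite H \<times> 'n H \<times> 'n H dual \<Rightarrow> 'n H \<times> 'n H \<times> 'n H dual" where
  "gl_triple g t = (g *v fac_a t, g *v fac_b t, gl_dual g (fac_d t))"

definition gl_M :: "rat ^ 'n ^ 'n \<Rightarrow> 'n::finite M \<Rightarrow> 'n M" where
  "gl_M g = M_lift (\<lambda>ts. mtensor (map (gl_triple g) ts))"

lemma linear_gl_M: "linear_Q (gl_M g)"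
  and gl_M_mtensor: "gl_M g (mtensor ts) = mtensor (map (gl_triple g) ts)"
proof -
  have "M_compat (\<lambda>ts. mtensor (map (gl_triple g) ts))"
    unfolding M_compat_def map_append list.map gl_triple_def fst_conv snd_conv
    by (intro allI conjI linear_Q_compose[OF M_compat_D(1)[OF M_compat_mtensor] linear_matrix]
       linear_Q_compose[OF M_compat_D(2)[OF M_compat_mtensor] linear_matrix]
       linear_Q_compose[OF M_compat_D(3)[OF M_compat_mtensor] linear_gl_dual])
  note * = this
  show "linear_Q (gl_M g)" "gl_M g (mtensor ts) = mtensor (map (gl_triple g) ts)"
    unfolding gl_M_def by (rule linear_M_lift[OF *] M_lift_mtensor[OF *])+
qed

lemma gl_M_mult: "gl_M g (M_mult x y) = M_mult (gl_M g x) (gl_M g y)"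
proof (rule mtensor_eqI[of "\<lambda>x. gl_M g (M_mult x y)"])
  fix ss
  show "gl_M g (M_mult (mtensor ss) y) = M_mult (gl_M g (mtensor ss)) (gl_M g y)"
    by (rule mtensor_eqI[OF linear_Q_compose[OF linear_gl_M linear_M_mult_right]
          linear_Q_compose[OF linear_M_mult_right linear_gl_M]])
      (simp add: M_mult_mtensor gl_M_mtensor)
qed (rule linear_Q_compose[OF linear_gl_M linear_M_mult_left] linear_Q_compose[OF linear_M_mult_left linear_gl_M])+

lemma phi_tensor_gl: "phi_tensor (gl_ext_dual g t) = gl_M g (phi_tensor t)"
proof (rule tensor_eqI[of "\<lambda>t. phi_tensor (gl_ext_dual g t)"])
  show "linear_Q (\<lambda>t. phi_tensor (gl_ext_dual g t))"
    by (rule linear_Q_compose[OF linear_phi_tensor linear_gl_ext_dual])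
  show "linear_Q (\<lambda>t. gl_M g (phi_tensor t))"
    by (rule linear_Q_compose[OF linear_gl_M linear_phi_tensor])
  fix w :: "'a H ext" and d
  show "phi_tensor (gl_ext_dual g (w \<otimes> d)) = gl_M g (phi_tensor (w \<otimes> d))"
    unfolding gl_ext_dual_tensor
  proof (rule wedge_eqI[of "\<lambda>w. phi_tensor (gl_extH g w \<otimes> gl_dual g d)"])
    show "linear_Q (\<lambda>w. phi_tensor (gl_extH g w \<otimes> gl_dual g d))"
      by (intro linear_Q_compose[OF linear_phi_tensor] linear_Q_tensor_left linear_gl_extH)
    show "linear_Q (\<lambda>w. gl_M g (phi_tensor (w \<otimes> d)))"
      by (intro linear_Q_compose[OF linear_gl_M] linear_Q_compose[OF linear_phi_tensor] linear_tensor_left)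
    fix as :: "'a H list"
    show "phi_tensor (gl_extH g (wedge as) \<otimes> gl_dual g d) = gl_M g (phi_tensor (wedge as \<otimes> d))"
      by (cases as; cases "tl as"; cases "tl (tl as)")
        (auto simp: gl_extH_wedge phi_tensor_wedge phi_list_def linear_Q_D[OF linear_gl_M]
          gl_M_mtensor gl_triple_def)
  qed
qed

lemma Rep_gl_U: "Rep_U (gl_U g u) = gl_ext_dual g (Rep_U u)"
  unfolding gl_U_def by (rule Abs_U_inverse[OF gl_ext_dual_in[OF Rep_U]])

lemma linear_gl_U: "linear_Q (gl_U g)"
  by (simp add: linear_Q_iff Rep_U_inject[symmetric] Rep_gl_U plus_U.rep_eq scaleQ_U.rep_eq
      linear_Q_D[OF linear_gl_ext_dual])

lemma linear_gl_extU: "linear_Q (gl_extU g)"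
  and gl_extU_wedge: "gl_extU g (wedge us) = wedge (map (gl_U g) us)"
  unfolding gl_extU_def ext_map_def
  by (rule linear_ext_lift[OF alternating_map[OF linear_gl_U]] ext_lift_wedge[OF alternating_map[OF linear_gl_U]])+

lemma M_word_gl: "M_word (map (gl_U g) us) = gl_M g (M_word us)"
  by (induction us) (simp_all add: M_word_simps gl_M_mtensor gl_M_mult \<phi>_eq Rep_gl_U phi_tensor_gl)

lemma \<iota>_gl: "\<iota> (wedge (map (gl_U g) us)) = gl_M g (\<iota> (wedge us))"
  by (simp only: \<iota>_wedge asum_map M_word_gl linear_asum[OF linear_gl_M])

lemma chain_gl: "invertible g \<Longrightarrow> chain (map (gl_triple g) ts) = chain ts"
  by (induction ts) (auto simp: chain_Nil chain_Cons gl_triple_def gl_dual_matrix hd_map)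

lemma c_map_gl:
  assumes "invertible g" "1 \<le> i"
  shows "c_map i (gl_M g z) = gl_ext_dual g (c_map i z)"
proof (rule mtensor_eqI[OF linear_Q_compose[OF linear_c_map linear_gl_M] linear_Q_compose[OF linear_gl_ext_dual linear_c_map]])
  fix ts :: "('a H \<times> 'a H \<times> 'a H dual) list"
  show "c_map i (gl_M g (mtensor ts)) = gl_ext_dual g (c_map i (mtensor ts))"
  proof (cases "length ts = i")
    case True
    \<comment> \<open>On a nonempty list \<open>hd\<close> and \<open>last\<close> commute with
      \<open>map\<close>; this is where \<open>1 \<le> i\<close> enters.\<close>
    then have "ts \<noteq> []" using assms(2) by auto
    then show ?thesis
      using True by (simp add: gl_M_mtensor c_map_mtensor chain_gl[OF assms(1)] linear_Q_D[OF linear_gl_ext_dual]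
          gl_ext_dual_tensor gl_extH_wedge last_map hd_map comp_def)
        (simp add: gl_triple_def)
  qed (simp add: gl_M_mtensor c_map_mtensor linear_Q_D[OF linear_gl_ext_dual])
qed

lemma c_wheel_ext_gl:
  assumes "invertible g" "1 \<le> i"
  shows "c_wheel_ext i (gl_M g z) = gl_extH g (c_wheel_ext i z)"
proof (rule mtensor_eqI[OF linear_Q_compose[OF linear_c_wheel_ext linear_gl_M] linear_Q_compose[OF linear_gl_extH linear_c_wheel_ext]])
  fix ts :: "('a H \<times> 'a H \<times> 'a H dual) list"
  show "c_wheel_ext i (gl_M g (mtensor ts)) = gl_extH g (c_wheel_ext i (mtensor ts))"
  proof (cases "length ts = i")
    case True
    then have "ts \<noteq> []" using assms(2) by auto
    then show ?thesis
      using True by (simp add: gl_M_mtensor c_wheel_ext_mtensor chain_gl[OF assms(1)] linear_Q_D[OF linear_gl_extH]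
          gl_extH_wedge last_map hd_map comp_def)
        (simp add: gl_triple_def gl_dual_matrix[OF assms(1)])
  qed (simp add: gl_M_mtensor c_wheel_ext_mtensor linear_Q_D[OF linear_gl_extH])
qed

section \<open>The components of the map\<close>

lemma Upart_deg_val: "1 \<le> deg x" "val x \<in> Upart (deg x)"
  using Rep_Uhom[of x] by (auto simp: deg_def val_def)

lemma deg_hom_elt: "1 \<le> m \<Longrightarrow> u \<in> Upart m \<Longrightarrow> deg (hom_elt m u) = m"
  and val_hom_elt: "1 \<le> m \<Longrightarrow> u \<in> Upart m \<Longrightarrow> val (hom_elt m u) = u"
  by (simp_all add: deg_def val_def hom_elt_def Abs_Uhom_inverse)

text \<open>Left multiplication by one homogeneous element. Products in the graded-symmetric algebra
  are built with it one letter at a time, in step with the recursion of \<open>ksum\<close>.\<close>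

definition lmul :: "nat \<Rightarrow> 'n::finite ext_dual \<Rightarrow> 'n S \<Rightarrow> 'n S" where
  "lmul m u = S_lift (\<lambda>xs. sprod (hom_elt m u # xs))"

lemma linear_lmul: "linear_Q (lmul m u)"
  and lmul_sprod: "lmul m u (sprod xs) = sprod (hom_elt m u # xs)"
  unfolding lmul_def
  by (rule linear_S_lift[OF S_compat_Cons[OF S_compat_sprod]] S_lift_sprod[OF S_compat_Cons[OF S_compat_sprod]])+

text \<open>Additivity in a letter is a relation between letters of equal degree, and
  \<open>hom_elt m\<close> has the intended degree and value on \<open>Upart m\<close>; hence the
  condition on the range of \<open>g\<close>.\<close>

lemma linear_lmul_left:
  assumes g: "linear_Q g" and U: "\<And>x. g x \<in> Upart m" and m: "1 \<le> m"
  shows "linear_Q (\<lambda>x. lmul m (g x) s)"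
  unfolding linear_Q_iff
proof (intro conjI allI)
  fix x y c
  note dv = deg_hom_elt[OF m U] val_hom_elt[OF m U]
  show "lmul m (g (x + y)) s = lmul m (g x) s + lmul m (g y) s"
  proof (rule sprod_eqI[OF linear_lmul linear_Q_add[OF linear_lmul linear_lmul]])
    fix xs
    show "lmul m (g (x + y)) (sprod xs) = lmul m (g x) (sprod xs) + lmul m (g y) (sprod xs)"
      unfolding lmul_sprod by (rule S_compat_Nil_D(1)[OF S_compat_sprod]) (simp_all only: dv, simp only: linear_Q_D[OF g])
  qed
  show "lmul m (g (c *\<^sub>Q x)) s = c *\<^sub>Q lmul m (g x) s"
  proof (rule sprod_eqI[OF linear_lmul linear_Q_scaled[OF linear_lmul]])
    fix xs
    show "lmul m (g (c *\<^sub>Q x)) (sprod xs) = c *\<^sub>Q lmul m (g x) (sprod xs)"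
      unfolding lmul_sprod by (rule S_compat_Nil_D(2)[OF S_compat_sprod]) (simp_all only: dv, simp only: linear_Q_D[OF g])
  qed
qed

text \<open>The Koszul sign of moving an element of degree \<open>m\<close> past another. It is an
  operator because the left tensor factors of a coproduct have various degrees.\<close>

definition twist :: "nat \<Rightarrow> 'n::finite S \<Rightarrow> 'n S" where
  "twist m = S_lift (\<lambda>xs. (- 1) ^ (m * sum_list (map deg xs)) *\<^sub>Q sprod xs)"

lemma linear_twist: "linear_Q (twist m)"
  and twist_sprod: "twist m (sprod xs) = (- 1) ^ (m * sum_list (map deg xs)) *\<^sub>Q sprod xs"
  unfolding twist_def
  by (rule linear_S_lift[OF S_compat_twist[OF S_compat_sprod]] S_lift_sprod[OF S_compat_twist[OF S_compat_sprod]])+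

lemma twist_part: "s \<in> S_part i \<Longrightarrow> twist m s = (- 1) ^ (m * i) *\<^sub>Q s"
  unfolding S_part_def
  by (erule linear_Q_eq_on_span[OF linear_twist linear_Q_scale, rotated]) (auto simp: twist_sprod)

text \<open>This is primitivity of \<open>u\<close>: it goes to the left or to the right tensor
  factor, and on its way to the right it crosses the left one, which \<open>twist\<close> accounts
  for.\<close>

lemma S_coprod_lmul:
  assumes "1 \<le> m" "u \<in> Upart m"
  shows "S_coprod (lmul m u s) =
    tensor_map (lmul m u) (\<lambda>x. x) (S_coprod s) + tensor_map (twist m) (lmul m u) (S_coprod s)"
proof -
  note lin1 = linear_tensor_map[OF linear_lmul linear_Q_id]
  note lin2 = linear_tensor_map[OF linear_twist linear_lmul]
  show ?thesis
  proof (rule sprod_eqI[OF linear_Q_compose[OF linear_S_coprod linear_lmul] linear_Q_add[OF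
        linear_Q_compose[OF lin1 linear_S_coprod] linear_Q_compose[OF lin2 linear_S_coprod]]])
    fix xs :: "'a Uhom list"
    show "S_coprod (lmul m u (sprod xs)) =
      tensor_map (lmul m u) (\<lambda>x. x) (S_coprod (sprod xs)) + tensor_map (twist m) (lmul m u) (S_coprod (sprod xs))"
      unfolding lmul_sprod S_coprod_sprod linear_ksum[OF lin1] linear_ksum[OF lin2]
        tensor_map_tensor[OF linear_lmul linear_Q_id] tensor_map_tensor[OF linear_twist linear_lmul]
        twist_sprod ksum.simps deg_hom_elt[OF assms] linear_Q_D(2)[OF linear_tensor_left]
      by (rule refl)
  qed
qed

lemma S_counit_lmul: "S_counit (lmul m u s) = 0"
  by (rule sprod_eqI[OF linear_Q_compose[OF linear_S_counit linear_lmul] linear_Q_zero])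
    (simp add: lmul_sprod S_counit_sprod)

lemma linear_gl_S: "linear_Q (gl_S g)"
  and gl_S_sprod: "gl_S g (sprod xs) = sprod (map (\<lambda>x. hom_elt (deg x) (gl_ext_dual g (val x))) xs)"
proof -
  define f where "f x = hom_elt (deg x) (gl_ext_dual g (val x))" for x :: "'a Uhom"
  have dv: "deg (f x) = deg x" "val (f x) = gl_ext_dual g (val x)" for x
    unfolding f_def by (rule deg_hom_elt[OF Upart_deg_val(1) gl_ext_dual_in[OF Upart_deg_val(2)]]
        val_hom_elt[OF Upart_deg_val(1) gl_ext_dual_in[OF Upart_deg_val(2)]])+
  have *: "S_compat (\<lambda>xs. sprod (map f xs))"
    unfolding S_compat_def
  proof (intro conjI allI impI)
    fix xs ys :: "'a Uhom list" and x y z c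
    show "sprod (map f (xs @ z # ys)) = sprod (map f (xs @ x # ys)) + sprod (map f (xs @ y # ys))"
      if "deg x = deg z" "deg y = deg z" "val z = val x + val y"
      unfolding map_append list.map
      by (rule S_compat_D(1)[OF S_compat_sprod]) (simp_all only: dv that linear_Q_D[OF linear_gl_ext_dual])
    show "sprod (map f (xs @ z # ys)) = c *\<^sub>Q sprod (map f (xs @ x # ys))"
      if "deg x = deg z" "val z = c *\<^sub>Q val x"
      unfolding map_append list.map
      by (rule S_compat_D(2)[OF S_compat_sprod]) (simp_all only: dv that linear_Q_D[OF linear_gl_ext_dual])
    show "sprod (map f (xs @ y # x # ys)) = (- 1) ^ (deg x * deg y) *\<^sub>Q sprod (map f (xs @ x # y # ys))"
      unfolding map_append list.map
      using S_compat_D(3)[OF S_compat_sprod, of "map f xs" "f y" "f x" "map f ys"] by (simp only: dv)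
  qed
  show "linear_Q (gl_S g)" "gl_S g (sprod xs) = sprod (map (\<lambda>x. hom_elt (deg x) (gl_ext_dual g (val x))) xs)"
    unfolding gl_S_def f_def[symmetric] by (rule linear_S_lift[OF *] S_lift_sprod[OF *])+
qed

lemma gl_S_lmul:
  assumes "1 \<le> m" "u \<in> Upart m"
  shows "gl_S g (lmul m u s) = lmul m (gl_ext_dual g u) (gl_S g s)"
  by (rule sprod_eqI[OF linear_Q_compose[OF linear_gl_S linear_lmul] linear_Q_compose[OF linear_lmul linear_gl_S]])
    (simp add: lmul_sprod gl_S_sprod deg_hom_elt[OF assms] val_hom_elt[OF assms])

section \<open>Tree and wheel contractions for a fixed identification \<theta>\<close>

locale wheel =
  fixes \<theta> :: "nat \<Rightarrow> 'n::finite H ext \<Rightarrow> 'n ext_dual"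
  assumes wheel: "wheel_identification \<theta>"
begin

lemma wheelD:
  assumes "1 \<le> i" "i < CARD('n)"
  shows "x \<in> ext_part i \<Longrightarrow> y \<in> ext_part i \<Longrightarrow> \<theta> i (x + y) = \<theta> i x + \<theta> i y"
    "x \<in> ext_part i \<Longrightarrow> \<theta> i (c *\<^sub>Q x) = c *\<^sub>Q \<theta> i x"
    "invertible g \<Longrightarrow> x \<in> ext_part i \<Longrightarrow> \<theta> i (gl_extH g x) = gl_ext_dual g (\<theta> i x)"
    "Upart i = {t + w | t w. t \<in> Utree i \<and> w \<in> \<theta> i ` ext_part i}"
    "Utree i \<inter> \<theta> i ` ext_part i = {0}"
  using wheel assms unfolding wheel_identification_def by blast+

lemma ext_part_closed: "x \<in> ext_part i \<Longrightarrow> y \<in> ext_part i \<Longrightarrow> x + y \<in> ext_part i"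
  "x \<in> ext_part i \<Longrightarrow> c *\<^sub>Q x \<in> ext_part i"
  unfolding ext_part_def by (rule Q.span_add Q.span_scale; assumption)+

lemma Utree_closed: "u \<in> Utree i \<Longrightarrow> v \<in> Utree i \<Longrightarrow> u + v \<in> Utree i"
  "u \<in> Utree i \<Longrightarrow> c *\<^sub>Q u \<in> Utree i"
  by (simp_all add: Utree_def Upart_closed linear_Q_D[OF linear_contraction] Q.scale_zero_right)

lemma wheel_closed:
  assumes i: "1 \<le> i" "i < CARD('n)"
  shows "u \<in> \<theta> i ` ext_part i \<Longrightarrow> v \<in> \<theta> i ` ext_part i \<Longrightarrow> u + v \<in> \<theta> i ` ext_part i"
    "u \<in> \<theta> i ` ext_part i \<Longrightarrow> c *\<^sub>Q u \<in> \<theta> i ` ext_part i"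
  by (auto simp: wheelD(1,2)[OF i, symmetric] ext_part_closed)

text \<open>Two candidates differ by an element that is of tree and of wheel type at once, hence by
  zero. So the definite description in \<open>c_tree\<close> is the projection along the direct
  sum.\<close>

lemma c_tree_eqI:
  assumes i: "1 \<le> i" "i < CARD('n)" and t: "t \<in> Utree i" "c_map i z - t \<in> \<theta> i ` ext_part i"
  shows "c_tree \<theta> i z = t"
proof -
  have uniq: "t' = t" if t': "t' \<in> Utree i" "c_map i z - t' \<in> \<theta> i ` ext_part i" for t'
  proof -
    have "t' + (- 1) *\<^sub>Q t \<in> Utree i" by (intro Utree_closed t t')
    moreover have "(c_map i z - t) + (- 1) *\<^sub>Q (c_map i z - t') \<in> \<theta> i ` ext_part i"
      by (intro wheel_closed[OF i] t t')
    then have "t' + (- 1) *\<^sub>Q t \<in> \<theta> i ` ext_part i"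
      by (simp add: minus_one_scale)
    ultimately have "t' + (- 1) *\<^sub>Q t = 0" using wheelD(5)[OF i] by blast
    then show ?thesis by (simp add: minus_one_scale)
  qed
  show ?thesis
    unfolding c_tree_def if_P[OF i(2)]
    by (rule the_equality) (simp_all only: t uniq simp_thms)
qed

lemma c_tree_props:
  assumes i: "1 \<le> i" "i < CARD('n)"
  shows "c_tree \<theta> i z \<in> Utree i" "c_map i z - c_tree \<theta> i z \<in> \<theta> i ` ext_part i"
proof -
  obtain t w where tw: "c_map i z = t + w" "t \<in> Utree i" "w \<in> \<theta> i ` ext_part i"
    using c_map_in[of i z] unfolding wheelD(4)[OF i] by blast
  then have "c_tree \<theta> i z = t" by (intro c_tree_eqI[OF i]) auto
  with tw show "c_tree \<theta> i z \<in> Utree i" "c_map i z - c_tree \<theta> i z \<in> \<theta> i ` ext_part i" by auto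
qed

lemma linear_c_tree:
  assumes "1 \<le> i"
  shows "linear_Q (c_tree \<theta> i)"
proof (cases "i < CARD('n)")
  case True
  note i = assms True
  show ?thesis
    unfolding linear_Q_iff
  proof (intro conjI allI)
    fix x y c
    have "c_map i (x + y) - (c_tree \<theta> i x + c_tree \<theta> i y) =
        (c_map i x - c_tree \<theta> i x) + (c_map i y - c_tree \<theta> i y)"
      by (simp add: linear_Q_D[OF linear_c_map])
    then show "c_tree \<theta> i (x + y) = c_tree \<theta> i x + c_tree \<theta> i y"
      by (intro c_tree_eqI[OF i] Utree_closed c_tree_props[OF i])
        (simp only:, intro wheel_closed[OF i] c_tree_props[OF i])
    have "c_map i (c *\<^sub>Q x) - c *\<^sub>Q c_tree \<theta> i x = c *\<^sub>Q (c_map i x - c_tree \<theta> i x)"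
      by (simp add: linear_Q_D[OF linear_c_map] Q.scale_right_diff_distrib)
    then show "c_tree \<theta> i (c *\<^sub>Q x) = c *\<^sub>Q c_tree \<theta> i x"
      by (intro c_tree_eqI[OF i] Utree_closed c_tree_props[OF i])
        (simp only:, intro wheel_closed[OF i] c_tree_props[OF i])
  qed
next
  \<comment> \<open>For such \<open>i\<close> the representation \<open>U\<^sub>i\<close> is zero,
    and \<open>c_tree\<close> has the default value 0.\<close>
  case False
  then have "c_tree \<theta> i = (\<lambda>z. 0)" by (simp add: c_tree_def fun_eq_iff)
  then show ?thesis by (simp only: linear_Q_zero)
qed

lemma linear_c_wheel:
  assumes "1 \<le> i"
  shows "linear_Q (c_wheel \<theta> i)"
proof (cases "i < CARD('n)")
  case True
  show ?thesis
    unfolding linear_Q_iff c_wheel_def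
    by (simp add: True linear_Q_D[OF linear_c_wheel_ext] wheelD(1,2)[OF assms True] c_wheel_ext_in)
next
  case False
  then have "c_wheel \<theta> i = (\<lambda>z. 0)" by (simp add: c_wheel_def fun_eq_iff)
  then show ?thesis by (simp only: linear_Q_zero)
qed

text \<open>Both summands are stable: the tree part because \<open>contraction\<close> is
  equivariant, the wheel part because \<theta> is. Hence the projection commutes with
  \<open>g\<close>.\<close>

lemma c_tree_gl:
  assumes g: "invertible g" and "1 \<le> i"
  shows "c_tree \<theta> i (gl_M g z) = gl_ext_dual g (c_tree \<theta> i z)"
proof (cases "i < CARD('n)")
  case True
  note i = assms(2) True
  obtain w where w: "w \<in> ext_part i" "c_map i z - c_tree \<theta> i z = \<theta> i w"
    using c_tree_props(2)[OF i, of z] by auto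
  show ?thesis
  proof (rule c_tree_eqI[OF i])
    show "gl_ext_dual g (c_tree \<theta> i z) \<in> Utree i"
      using c_tree_props(1)[OF i, of z]
      by (simp add: Utree_def gl_ext_dual_in contraction_gl[OF g] linear_Q_D[OF linear_gl_extH])
    have "c_map i (gl_M g z) - gl_ext_dual g (c_tree \<theta> i z) = gl_ext_dual g (c_map i z - c_tree \<theta> i z)"
      by (simp only: c_map_gl[OF assms] linear_Q_D[OF linear_gl_ext_dual])
    also have "\<dots> = \<theta> i (gl_extH g w)" by (simp only: w(2) wheelD(3)[OF i g w(1)])
    finally show "c_map i (gl_M g z) - gl_ext_dual g (c_tree \<theta> i z) \<in> \<theta> i ` ext_part i"
      using gl_extH_in[OF w(1)] by simp
  qed
qed (simp add: c_tree_def linear_Q_D[OF linear_gl_ext_dual])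

lemma c_wheel_gl:
  assumes g: "invertible g" and "1 \<le> i"
  shows "c_wheel \<theta> i (gl_M g z) = gl_ext_dual g (c_wheel \<theta> i z)"
proof (cases "i < CARD('n)")
  case True
  then show ?thesis
    by (simp add: c_wheel_def c_wheel_ext_gl[OF assms] wheelD(3)[OF assms(2) True g] c_wheel_ext_in)
qed (simp add: c_wheel_def linear_Q_D[OF linear_gl_ext_dual])

text \<open>A pair \<open>(True, m)\<close> stands for a tree part \<open>m\<close> and \<open>(False, m)\<close> for a wheel part, so that a
  pair of partitions becomes one list.\<close>

definition c_part :: "bool \<times> nat \<Rightarrow> 'n M \<Rightarrow> 'n ext_dual" where
  "c_part z = (if fst z then c_tree \<theta> (snd z) else c_wheel \<theta> (snd z))"

lemma linear_c_part: "1 \<le> snd z \<Longrightarrow> linear_Q (c_part z)"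
  by (simp add: c_part_def linear_c_tree linear_c_wheel)

lemma c_part_in:
  assumes "1 \<le> snd z"
  shows "c_part z x \<in> Upart (snd z)"
proof (cases "snd z < CARD('n)")
  case True
  \<comment> \<open>With 0 as the tree component, the decomposition of \<open>Upart\<close> shows
    that it contains the image of \<theta>.\<close>
  have "0 \<in> Utree (snd z)" by (simp add: Utree_def Upart_closed linear_Q_D[OF linear_contraction])
  then have "\<theta> (snd z) w \<in> Upart (snd z)" if "w \<in> ext_part (snd z)" for w
    unfolding wheelD(4)[OF assms True] using that by force
  then show ?thesis
    using c_tree_props(1)[OF assms True]
    by (auto simp: c_part_def c_wheel_def True c_wheel_ext_in Utree_def)
qed (simp add: c_part_def c_tree_def c_wheel_def Upart_closed)

lemma c_part_gl: "invertible g \<Longrightarrow> 1 \<le> snd z \<Longrightarrow> c_part z (gl_M g x) = gl_ext_dual g (c_part z x)"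
  by (simp add: c_part_def c_tree_gl c_wheel_gl)

section \<open>Contractions along a word of parts\<close>

definition parts_deg :: "(bool \<times> nat) list \<Rightarrow> nat" where
  "parts_deg L = sum_list (map snd L)"

fun letters :: "(bool \<times> nat) list \<Rightarrow> ('n H \<times> 'n H \<times> 'n H dual) list \<Rightarrow> 'n Uhom list" where
  "letters [] ts = []"
| "letters (z # L) ts = hom_elt (snd z) (c_part z (mtensor (take (snd z) ts))) # letters L (drop (snd z) ts)"

lemma letters_bipartition:
  "map2 (\<lambda>m t. hom_elt m (c_tree \<theta> m (mtensor t))) \<mu> (blocks \<mu> ts) @
   map2 (\<lambda>m t. hom_elt m (c_wheel \<theta> m (mtensor t))) \<nu> (blocks \<nu> (drop (sum_list \<mu>) ts))
   = letters (map (Pair True) \<mu> @ map (Pair False) \<nu>) ts"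
proof -
  have "map2 (\<lambda>m t. hom_elt m (c_wheel \<theta> m (mtensor t))) \<nu> (blocks \<nu> ts) = letters (map (Pair False) \<nu>) ts" for ts
    by (induction \<nu> arbitrary: ts) (simp_all add: c_part_def)
  note wheel_letters = this
  show ?thesis
  proof (induction \<mu> arbitrary: ts)
    case (Cons m \<mu>)
    show ?case using Cons[of "drop m ts"] by (simp add: c_part_def add.commute)
  qed (simp add: wheel_letters)
qed

definition block_prod :: "(bool \<times> nat) list \<Rightarrow> ('n H \<times> 'n H \<times> 'n H dual) list \<Rightarrow> 'n S" where
  "block_prod L ts = (if length ts = parts_deg L then sprod (letters L ts) else 0)"

text \<open>A list too short for the first block is excluded separately: \<open>drop\<close> would
  then return the empty list, which passes the length test of \<open>block_prod L\<close> when
  \<open>L\<close> is empty.\<close>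

lemma block_prod_Cons:
  "block_prod (z # L) ts = (if length ts < snd z then 0 else
     lmul (snd z) (c_part z (mtensor (take (snd z) ts))) (block_prod L (drop (snd z) ts)))"
  by (auto simp: block_prod_def parts_deg_def lmul_sprod linear_Q_D[OF linear_lmul])

lemma M_compat_block_prod:
  assumes "\<forall>z\<in>set L. 1 \<le> snd z"
  shows "M_compat (block_prod L)"
  using assms
proof (induction L)
  case Nil
  have "block_prod [] (xs @ t # ys) = 0" for xs t ys by (simp add: block_prod_def parts_deg_def)
  then show ?case by (simp add: M_compat_def linear_Q_zero)
next
  case (Cons z L)
  let ?m = "snd z"
  have z: "1 \<le> ?m" and IH: "M_compat (block_prod L)" using Cons by auto
  \<comment> \<open>\<open>f\<close> stands for any of the three slots of a triple. The varied
    triple lies in a list that is too short, behind the first block, or inside it.\<close>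
  have *: "linear_Q (\<lambda>x. block_prod (z # L) (xs @ f x # ys))"
    if lin: "\<And>h xs ys. M_compat h \<Longrightarrow> linear_Q (\<lambda>x. (h (xs @ f x # ys) :: 'n S))"
      and lin': "\<And>xs ys. linear_Q (\<lambda>x. mtensor (xs @ f x # ys))"
    for xs ys and f :: "'b::rat_vector \<Rightarrow> 'n H \<times> 'n H \<times> 'n H dual"
  proof -
    consider "length xs + Suc (length ys) < ?m" | "?m \<le> length xs"
      | k where "?m = Suc (length xs + k)" "k \<le> length ys"
    proof (cases "length xs + Suc (length ys) < ?m \<or> ?m \<le> length xs")
      case False
      then have "?m = Suc (length xs + (?m - Suc (length xs)))" "?m - Suc (length xs) \<le> length ys" by auto
      then show thesis using that(3) by blast
    qed (use that in blast)
    then show ?thesis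
    proof cases
      case 1
      then show ?thesis by (simp add: block_prod_Cons linear_Q_zero)
    next
      case 2
      then show ?thesis
        using linear_Q_compose[OF linear_lmul lin[OF IH]] by (simp add: block_prod_Cons)
    next
      case 3
      then show ?thesis
        using linear_lmul_left[OF linear_Q_compose[OF linear_c_part[OF z] lin'] c_part_in[OF z] z]
        by (simp add: block_prod_Cons)
    qed
  qed
  show ?case
    unfolding M_compat_def
    by (intro allI conjI; rule *) (rule M_compat_D[OF M_compat_mtensor] M_compat_D; assumption?)+
qed

end

lemma S_part_closed: "0 \<in> S_part i" "s \<in> S_part i \<Longrightarrow> c *\<^sub>Q s \<in> S_part i"
  "(\<And>a. a \<in> A \<Longrightarrow> f a \<in> S_part i) \<Longrightarrow> sum f A \<in> S_part i"
  unfolding S_part_def by (simp_all add: Q.span_zero Q.span_scale Q.span_sum)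

lemma \<iota>_part: "\<iota> (wedge us) \<in> M_part (length us)"
  unfolding \<iota>_wedge asum_def M_part_def
proof (intro Q.span_sum Q.span_scale)
  fix \<sigma>
  show "M_word (permute_list \<sigma> us) \<in> Q.span {mtensor ts | ts. length ts = length us}"
    using M_word_part[of "permute_list \<sigma> us"] by (simp add: M_part_def)
qed

context wheel
begin

lemma deg_letters:
  assumes "\<forall>z\<in>set L. 1 \<le> snd z"
  shows "sum_list (map deg (letters L ts)) = parts_deg L"
  using assms by (induction L arbitrary: ts) (simp_all add: parts_deg_def deg_hom_elt c_part_in)

definition contr :: "(bool \<times> nat) list \<Rightarrow> 'n M \<Rightarrow> 'n S" where
  "contr L = M_lift (block_prod L)"

lemma linear_contr: "\<forall>z\<in>set L. 1 \<le> snd z \<Longrightarrow> linear_Q (contr L)"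
  unfolding contr_def by (rule linear_M_lift[OF M_compat_block_prod])

lemma contr_mtensor: "\<forall>z\<in>set L. 1 \<le> snd z \<Longrightarrow> contr L (mtensor ts) = block_prod L ts"
  unfolding contr_def by (rule M_lift_mtensor[OF M_compat_block_prod])

text \<open>Because \<open>p\<close> is homogeneous of length \<open>snd z\<close>, the cut after
  the first block falls exactly between \<open>p\<close> and \<open>q\<close>.\<close>

lemma contr_Cons_mult:
  assumes pos: "\<forall>w\<in>set (z # L). 1 \<le> snd w" and p: "p \<in> M_part (snd z)"
  shows "contr (z # L) (M_mult p q) = lmul (snd z) (c_part z p) (contr L q)"
proof (rule M_part_eqI[OF _ _ _ p])
  have z: "1 \<le> snd z" and posL: "\<forall>w\<in>set L. 1 \<le> snd w" using pos by auto
  show "linear_Q (\<lambda>p. contr (z # L) (M_mult p q))"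
    by (rule linear_Q_compose[OF linear_contr[OF pos] linear_M_mult_left])
  show "linear_Q (\<lambda>p. lmul (snd z) (c_part z p) (contr L q))"
    by (rule linear_lmul_left[OF linear_c_part[OF z] c_part_in[OF z] z])
  fix ss :: "('n H \<times> 'n H \<times> 'n H dual) list" assume ss: "length ss = snd z"
  show "contr (z # L) (M_mult (mtensor ss) q) = lmul (snd z) (c_part z (mtensor ss)) (contr L q)"
    by (rule mtensor_eqI[OF linear_Q_compose[OF linear_contr[OF pos] linear_M_mult_right]
          linear_Q_compose[OF linear_lmul linear_contr[OF posL]]])
      (simp only: M_mult_mtensor contr_mtensor[OF pos] contr_mtensor[OF posL], simp add: block_prod_Cons ss)
qed

lemma contr_other_degree:
  assumes pos: "\<forall>w\<in>set L. 1 \<le> snd w" and "p \<in> M_part k" "k \<noteq> parts_deg L"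
  shows "contr L p = 0"
  by (rule M_part_eqI[OF linear_contr[OF pos] linear_Q_zero _ assms(2)])
    (simp add: contr_mtensor[OF pos] block_prod_def assms(3))

lemma contr_part:
  assumes pos: "\<forall>w\<in>set L. 1 \<le> snd w"
  shows "contr L p \<in> S_part (parts_deg L)"
  unfolding S_part_def
proof (rule linear_Q_span_subset[OF linear_contr[OF pos] _ span_mtensor])
  fix p :: "'n M" assume "p \<in> range mtensor"
  then obtain ts where p: "p = mtensor ts" by auto
  have "sprod (letters L ts) \<in> Q.span {sprod xs | xs. sum_list (map deg xs) = parts_deg L}"
    using deg_letters[OF pos] by (intro Q.span_base) blast
  then show "contr L p \<in> Q.span {sprod xs | xs. sum_list (map deg xs) = parts_deg L}"
    by (simp add: p contr_mtensor[OF pos] block_prod_def Q.span_zero)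
qed

section \<open>Convolution products indexed by words of parts\<close>

definition F_word :: "(bool \<times> nat) list \<Rightarrow> 'n U list \<Rightarrow> 'n S" where
  "F_word L us = contr L (\<iota> (wedge us))"

lemma F_word_zero:
  "\<forall>w\<in>set L. 1 \<le> snd w \<Longrightarrow> length us \<noteq> parts_deg L \<Longrightarrow> F_word L us = 0"
  unfolding F_word_def by (rule contr_other_degree[OF _ \<iota>_part])

lemma F_word_part:
  assumes "\<forall>w\<in>set L. 1 \<le> snd w"
  shows "F_word L us \<in> S_part (length us)"
proof (cases "length us = parts_deg L")
  case True
  show ?thesis unfolding F_word_def True by (rule contr_part[OF assms])
next
  case False
  then show ?thesis by (simp add: F_word_zero[OF assms] S_part_closed)
qed

lemma F_word_Nil: "F_word [] us = (if us = [] then sprod [] else 0)"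
proof (cases us)
  case Nil
  then show ?thesis
    by (simp add: F_word_def \<iota>_wedge asum_Nil M_word_simps contr_mtensor block_prod_def parts_deg_def)
next
  case (Cons u vs)
  then show ?thesis by (simp add: F_word_zero parts_deg_def)
qed

definition f_part :: "bool \<times> nat \<Rightarrow> 'n U list \<Rightarrow> 'n ext_dual" where
  "f_part z us = c_part z (\<iota> (wedge us))"

text \<open>Combines \<open>asum_take_drop\<close> with \<open>contr_Cons_mult\<close>. If
  \<open>us\<close> is shorter than the first block, both sides vanish.\<close>

lemma F_word_Cons:
  assumes pos: "\<forall>w\<in>set (z # L). 1 \<le> snd w"
  shows "F_word (z # L) us = ksum (\<lambda>_. 1) us (\<lambda>A B.
    if length A = snd z then lmul (snd z) (f_part z A) (F_word L B) else 0)"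
proof (cases "snd z \<le> length us")
  case True
  let ?m = "snd z"
  have z: "1 \<le> ?m" and posL: "\<forall>w\<in>set L. 1 \<le> snd w" using pos by auto
  let ?X = "\<lambda>v w. lmul ?m (c_part z (M_word v)) (contr L (M_word w))"
  have "F_word (z # L) us = asum us (\<lambda>w. contr (z # L) (M_word w))"
    by (simp only: F_word_def \<iota>_wedge linear_asum[OF linear_contr[OF pos]])
  also have "\<dots> = asum us (\<lambda>w. ?X (take ?m w) (drop ?m w))"
  proof (rule asum_cong)
    fix w assume "mset w = mset us"
    then have "length (take ?m w) = ?m" using True by (metis length_take min.absorb2 mset_eq_length)
    then have "M_word (take ?m w) \<in> M_part ?m" using M_word_part[of "take ?m w"] by simp
    moreover have "M_word w = M_mult (M_word (take ?m w)) (M_word (drop ?m w))"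
      by (simp flip: M_word_append)
    ultimately show "contr (z # L) (M_word w) = ?X (take ?m w) (drop ?m w)"
      by (simp only: contr_Cons_mult[OF pos])
  qed
  also have "\<dots> = ksum (\<lambda>_. 1) us (\<lambda>A B. if length A = ?m then asum A (\<lambda>v. asum B (?X v)) else 0)"
    by (rule asum_take_drop[OF True])
  also have "\<dots> = ksum (\<lambda>_. 1) us (\<lambda>A B. if length A = ?m then lmul ?m (f_part z A) (F_word L B) else 0)"
  proof -
    have "asum A (\<lambda>v. asum B (?X v)) = lmul ?m (f_part z A) (F_word L B)" for A B
    proof -
      have "asum B (?X v) = lmul ?m (c_part z (M_word v)) (F_word L B)" for v
        by (simp only: F_word_def \<iota>_wedge linear_asum[OF linear_contr[OF posL]] linear_asum[OF linear_lmul])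
      then show ?thesis
        unfolding f_part_def \<iota>_wedge
        by (simp only: linear_asum[OF linear_lmul_left[OF linear_c_part[OF z] c_part_in[OF z] z]])
    qed
    then show ?thesis by (simp cong: if_cong)
  qed
  finally show ?thesis .
next
  case False
  have "ksum (\<lambda>_. 1) us (\<lambda>A B. if length A = snd z then lmul (snd z) (f_part z A) (F_word L B) else 0)
      = ksum (\<lambda>_. 1) us (\<lambda>A B. 0)"
  proof (rule ksum_cong)
    fix A B assume eq: "mset A + mset B = mset us"
    show "(if length A = snd z then lmul (snd z) (f_part z A) (F_word L B) else 0) = 0"
      using False arg_cong[OF eq, of size] by simp
  qed
  moreover have "length us \<noteq> parts_deg (z # L)" using False by (simp add: parts_deg_def)
  ultimately show ?thesis by (simp add: F_word_zero[OF pos] ksum_zero)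
qed

text \<open>For a nonempty word of parts every summand begins with \<open>lmul\<close>, which the
  counit kills.\<close>

lemma S_counit_F_word:
  assumes "\<forall>w\<in>set L. 1 \<le> snd w"
  shows "S_counit (F_word L us) = (if L = [] \<and> us = [] then 1 else 0)"
proof (cases L)
  case Nil
  then show ?thesis by (simp add: F_word_Nil S_counit_sprod linear_Q_D[OF linear_S_counit])
next
  case (Cons z K)
  have "S_counit (F_word (z # K) us) = ksum (\<lambda>_. 1) us (\<lambda>A B. 0)"
    using assms unfolding Cons
    by (subst F_word_Cons) (simp_all add: linear_ksum[OF linear_S_counit] if_distrib[of S_counit]
        S_counit_lmul linear_Q_D[OF linear_S_counit] cong: if_cong)
  then show ?thesis by (simp add: Cons ksum_zero)
qed

lemma F_word_gl:
  assumes g: "invertible g" and pos: "\<forall>w\<in>set L. 1 \<le> snd w"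
  shows "gl_S g (F_word L us) = F_word L (map (gl_U g) us)"
  using pos
proof (induction L arbitrary: us)
  case Nil
  then show ?case by (simp add: F_word_Nil gl_S_sprod linear_Q_D[OF linear_gl_S])
next
  case (Cons z L)
  have z: "1 \<le> snd z" and posL: "\<forall>w\<in>set L. 1 \<le> snd w" using Cons.prems by auto
  have f: "f_part z (map (gl_U g) A) = gl_ext_dual g (f_part z A)" for A
    by (simp only: f_part_def \<iota>_gl c_part_gl[OF g z])
  have *: "gl_S g (lmul (snd z) (f_part z A) (F_word L B)) =
      lmul (snd z) (f_part z (map (gl_U g) A)) (F_word L (map (gl_U g) B))" for A B
    unfolding f by (simp only: gl_S_lmul[OF z c_part_in[OF z], folded f_part_def] f_part_def Cons.IH[OF posL])
  show ?case
    unfolding F_word_Cons[OF Cons.prems] ksum_map linear_ksum[OF linear_gl_S] length_map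
    by (rule ksum_cong) (simp add: * linear_Q_D[OF linear_gl_S])
qed

text \<open>Primitivity applied under the induction hypothesis. The left factor
  \<open>F_word L1 B1\<close> has degree \<open>length B1\<close>, which turns the operator
  \<open>twist\<close> into a sign that \<open>ksum\<close> can handle.\<close>

lemma S_coprod_lmul_F_word:
  assumes z: "1 \<le> snd z" and posL: "\<forall>w\<in>set L. 1 \<le> snd w"
    and IH: "S_coprod (F_word L B) = ksum (\<lambda>_. 0) L (\<lambda>L1 L2. ksum (\<lambda>_. 1) B (\<lambda>B1 B2. F_word L1 B1 \<otimes> F_word L2 B2))"
  shows "S_coprod (lmul (snd z) (f_part z A) (F_word L B)) = ksum (\<lambda>_. 1) B (\<lambda>B1 B2.
      ksum (\<lambda>_. 0) L (\<lambda>L1 L2. lmul (snd z) (f_part z A) (F_word L1 B1) \<otimes> F_word L2 B2) +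
      (- 1) ^ (snd z * length B1) *\<^sub>Q
      ksum (\<lambda>_. 0) L (\<lambda>L1 L2. F_word L1 B1 \<otimes> lmul (snd z) (f_part z A) (F_word L2 B2)))"
proof -
  let ?m = "snd z"
  let ?l = "lmul ?m (f_part z A)"
  have U: "f_part z A \<in> Upart ?m" unfolding f_part_def by (rule c_part_in[OF z])
  note lin1 = linear_tensor_map[OF linear_lmul linear_Q_id]
  note lin2 = linear_tensor_map[OF linear_twist linear_lmul]
  have "S_coprod (?l (F_word L B)) =
      ksum (\<lambda>_. 0) L (\<lambda>L1 L2. ksum (\<lambda>_. 1) B (\<lambda>B1 B2. ?l (F_word L1 B1) \<otimes> F_word L2 B2)) +
      ksum (\<lambda>_. 0) L (\<lambda>L1 L2. ksum (\<lambda>_. 1) B (\<lambda>B1 B2. twist ?m (F_word L1 B1) \<otimes> ?l (F_word L2 B2)))"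
    unfolding S_coprod_lmul[OF z U] IH linear_ksum[OF lin1] linear_ksum[OF lin2]
      tensor_map_tensor[OF linear_lmul linear_Q_id] tensor_map_tensor[OF linear_twist linear_lmul]
    by (rule refl)
  also have "ksum (\<lambda>_. 0) L (\<lambda>L1 L2. ksum (\<lambda>_. 1) B (\<lambda>B1 B2. twist ?m (F_word L1 B1) \<otimes> ?l (F_word L2 B2))) =
      ksum (\<lambda>_. 0) L (\<lambda>L1 L2. ksum (\<lambda>_. 1) B (\<lambda>B1 B2. (- 1) ^ (?m * length B1) *\<^sub>Q (F_word L1 B1 \<otimes> ?l (F_word L2 B2))))"
  proof (rule ksum_cong)
    fix L1 L2 assume eq: "mset L1 + mset L2 = mset L"
    have "set L1 \<subseteq> set L" using arg_cong[OF eq, of set_mset] by auto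
    then have pos1: "\<forall>w\<in>set L1. 1 \<le> snd w" using posL by blast
    show "ksum (\<lambda>_. 1) B (\<lambda>B1 B2. twist ?m (F_word L1 B1) \<otimes> ?l (F_word L2 B2)) =
      ksum (\<lambda>_. 1) B (\<lambda>B1 B2. (- 1) ^ (?m * length B1) *\<^sub>Q (F_word L1 B1 \<otimes> ?l (F_word L2 B2)))"
      by (simp only: twist_part[OF F_word_part[OF pos1]] linear_Q_D(2)[OF linear_tensor_left])
  qed
  finally show ?thesis
    unfolding ksum_add ksum_fubini[of "\<lambda>_. 0" L "\<lambda>_. 1" B] ksum_scale .
qed

text \<open>The part \<open>z\<close> takes its block \<open>A\<close> to the left or to the right
  factor. On the left, coassociativity regroups the letters. On the right, \<open>A\<close> must
  also move past \<open>B1\<close>, and the Koszul sign of the target is precisely the one that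
  graded cocommutativity of the exterior algebra absorbs.\<close>

lemma F_word_coprod:
  assumes "\<forall>w\<in>set L. 1 \<le> snd w"
  shows "S_coprod (F_word L us) =
    ksum (\<lambda>_. 0) L (\<lambda>L1 L2. ksum (\<lambda>_. 1) us (\<lambda>A B. F_word L1 A \<otimes> F_word L2 B))"
  using assms
proof (induction L arbitrary: us)
  case Nil
  show ?case
  proof (cases "us = []")
    case True
    then show ?thesis by (simp add: F_word_Nil S_coprod_sprod)
  next
    case False
    have "ksum (\<lambda>_. 1) us (\<lambda>A B. F_word [] A \<otimes> F_word [] B) = ksum (\<lambda>_. 1) us (\<lambda>A B. 0)"
    proof (rule ksum_cong)
      fix A B assume "mset A + mset B = mset us"
      then have "A \<noteq> [] \<or> B \<noteq> []" using False by auto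
      then show "F_word [] A \<otimes> F_word [] B = 0"
        by (auto simp: F_word_Nil linear_Q_D[OF linear_tensor_left] linear_Q_D[OF linear_tensor_right])
    qed
    then show ?thesis
      using False by (simp add: F_word_Nil linear_Q_D[OF linear_S_coprod] ksum_zero)
  qed
next
  case (Cons z L)
  let ?m = "snd z"
  have z: "1 \<le> ?m" and posL: "\<forall>w\<in>set L. 1 \<le> snd w" using Cons.prems by auto
  have pos': "\<forall>w\<in>set (z # L'). 1 \<le> snd w" if "mset L' \<subseteq># mset L" for L'
    using set_mset_mono[OF that] z posL by auto
  let ?l = "\<lambda>A. lmul ?m (f_part z A)"
  let ?W1 = "\<lambda>A B1 B2. if length A = ?m then ksum (\<lambda>_. 0) L (\<lambda>L1 L2. ?l A (F_word L1 B1) \<otimes> F_word L2 B2) else 0"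
  let ?W2 = "\<lambda>B1 A B2. if length A = ?m then ksum (\<lambda>_. 0) L (\<lambda>L1 L2. F_word L1 B1 \<otimes> ?l A (F_word L2 B2)) else 0"
  \<comment> \<open>For \<open>length A = snd z\<close> this is the sign of
    \<open>S_coprod_lmul_F_word\<close>, written in the form that \<open>ksum_cocomm\<close>
    produces.\<close>
  let ?sg = "\<lambda>A B. (- 1) ^ (sum_list (map (\<lambda>_. 1) A) * sum_list (map (\<lambda>_. 1) B)) :: rat"
  have "S_coprod (F_word (z # L) us) =
      ksum (\<lambda>_. 1) us (\<lambda>A B. ksum (\<lambda>_. 1) B (\<lambda>B1 B2. ?W1 A B1 B2 + ?sg A B1 *\<^sub>Q ?W2 B1 A B2))"
    unfolding F_word_Cons[OF Cons.prems] linear_ksum[OF linear_S_coprod]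
  proof (rule ksum_cong)
    fix A B
    show "S_coprod (if length A = ?m then ?l A (F_word L B) else 0) =
        ksum (\<lambda>_. 1) B (\<lambda>B1 B2. ?W1 A B1 B2 + ?sg A B1 *\<^sub>Q ?W2 B1 A B2)"
    proof (cases "length A = ?m")
      case True
      have "sum_list (map (\<lambda>_. 1) A) = ?m" "\<And>B :: 'n U list. sum_list (map (\<lambda>_. 1) B) = length B"
        by (simp_all add: sum_list_triv True)
      then show ?thesis
        using S_coprod_lmul_F_word[OF z posL Cons.IH[OF posL], of A B] by (simp only: True if_True refl)
    qed (simp add: linear_Q_D[OF linear_S_coprod] Q.scale_zero_right ksum_zero)
  qed
  also have "\<dots> = ksum (\<lambda>_. 1) us (\<lambda>A B. ksum (\<lambda>_. 1) B (?W1 A))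
      + ksum (\<lambda>_. 1) us (\<lambda>A B. ksum (\<lambda>_. 1) B (\<lambda>B1 B2. ?sg A B1 *\<^sub>Q ?W2 B1 A B2))"
    by (simp only: ksum_add)
  also have "ksum (\<lambda>_. 1) us (\<lambda>A B. ksum (\<lambda>_. 1) B (?W1 A)) =
      ksum (\<lambda>_. 1) us (\<lambda>E D. ksum (\<lambda>_. 1) E (\<lambda>A B. ?W1 A B D))"
    by (rule ksum_coassoc)
  also have "\<dots> = ksum (\<lambda>_. 1) us (\<lambda>E D. ksum (\<lambda>_. 0) L (\<lambda>L1 L2. F_word (z # L1) E \<otimes> F_word L2 D))"
  proof (rule ksum_cong)
    fix E D
    have "ksum (\<lambda>_. 1) E (\<lambda>A B. ?W1 A B D) = ksum (\<lambda>_. 1) E (\<lambda>A B. ksum (\<lambda>_. 0) L (\<lambda>L1 L2.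
        (if length A = ?m then ?l A (F_word L1 B) else 0) \<otimes> F_word L2 D))"
      by (rule ksum_cong) (simp add: linear_Q_D[OF linear_tensor_left] ksum_zero)
    also have "\<dots> = ksum (\<lambda>_. 0) L (\<lambda>L1 L2. ksum (\<lambda>_. 1) E (\<lambda>A B.
        (if length A = ?m then ?l A (F_word L1 B) else 0)) \<otimes> F_word L2 D)"
      by (simp only: ksum_fubini[of "\<lambda>_. 1" E] linear_ksum[OF linear_tensor_left])
    also have "\<dots> = ksum (\<lambda>_. 0) L (\<lambda>L1 L2. F_word (z # L1) E \<otimes> F_word L2 D)"
    proof (rule ksum_cong)
      fix L1 L2 assume "mset L1 + mset L2 = mset L"
      then have "mset L1 \<subseteq># mset L" by (metis mset_subset_eq_add_left)
      from F_word_Cons[OF pos'[OF this]]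
      show "ksum (\<lambda>_. 1) E (\<lambda>A B. (if length A = ?m then ?l A (F_word L1 B) else 0)) \<otimes> F_word L2 D
          = F_word (z # L1) E \<otimes> F_word L2 D" by simp
    qed
    finally show "ksum (\<lambda>_. 1) E (\<lambda>A B. ?W1 A B D) = ksum (\<lambda>_. 0) L (\<lambda>L1 L2. F_word (z # L1) E \<otimes> F_word L2 D)" .
  qed
  also have "ksum (\<lambda>_. 1) us (\<lambda>A B. ksum (\<lambda>_. 1) B (\<lambda>B1 B2. ?sg A B1 *\<^sub>Q ?W2 B1 A B2)) =
      ksum (\<lambda>_. 1) us (\<lambda>E B2. ksum (\<lambda>_. 1) E (\<lambda>A B1. ?sg A B1 *\<^sub>Q ?W2 B1 A B2))"
    by (rule ksum_coassoc)
  \<comment> \<open>Cocommutativity inside \<open>E\<close>, read from right to left, removes the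
    sign and puts \<open>B1\<close> in front of \<open>A\<close>.\<close>
  also have "\<dots> = ksum (\<lambda>_. 1) us (\<lambda>E B2. ksum (\<lambda>_. 1) E (\<lambda>B1 A. ?W2 B1 A B2))"
    by (simp only: ksum_cocomm[symmetric, of "\<lambda>_. 1" _ "\<lambda>B1 A. ?W2 B1 A _"])
  also have "\<dots> = ksum (\<lambda>_. 1) us (\<lambda>B1 D. ksum (\<lambda>_. 1) D (?W2 B1))"
    by (rule ksum_coassoc[symmetric])
  also have "\<dots> = ksum (\<lambda>_. 1) us (\<lambda>E D. ksum (\<lambda>_. 0) L (\<lambda>L1 L2. F_word L1 E \<otimes> F_word (z # L2) D))"
  proof (rule ksum_cong)
    fix E D
    have "ksum (\<lambda>_. 1) D (?W2 E) = ksum (\<lambda>_. 1) D (\<lambda>A B. ksum (\<lambda>_. 0) L (\<lambda>L1 L2.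
        F_word L1 E \<otimes> (if length A = ?m then ?l A (F_word L2 B) else 0)))"
      by (rule ksum_cong) (simp add: linear_Q_D[OF linear_tensor_right] ksum_zero)
    also have "\<dots> = ksum (\<lambda>_. 0) L (\<lambda>L1 L2. F_word L1 E \<otimes> ksum (\<lambda>_. 1) D (\<lambda>A B.
        (if length A = ?m then ?l A (F_word L2 B) else 0)))"
      by (simp only: ksum_fubini[of "\<lambda>_. 1" D] linear_ksum[OF linear_tensor_right])
    also have "\<dots> = ksum (\<lambda>_. 0) L (\<lambda>L1 L2. F_word L1 E \<otimes> F_word (z # L2) D)"
    proof (rule ksum_cong)
      fix L1 L2 assume "mset L1 + mset L2 = mset L"
      then have "mset L2 \<subseteq># mset L" by (metis mset_subset_eq_add_right)
      from F_word_Cons[OF pos'[OF this]]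
      show "F_word L1 E \<otimes> ksum (\<lambda>_. 1) D (\<lambda>A B. (if length A = ?m then ?l A (F_word L2 B) else 0))
          = F_word L1 E \<otimes> F_word (z # L2) D" by simp
    qed
    finally show "ksum (\<lambda>_. 1) D (?W2 E) = ksum (\<lambda>_. 0) L (\<lambda>L1 L2. F_word L1 E \<otimes> F_word (z # L2) D)" .
  qed
  finally show ?case
    by (simp add: scaleQ_one ksum_fubini[of "\<lambda>_. 0" L])
qed

section \<open>Assembling the components over all bipartitions\<close>

definition bip_word :: "nat list \<times> nat list \<Rightarrow> (bool \<times> nat) list" where
  "bip_word x = map (Pair True) (fst x) @ map (Pair False) (snd x)"

definition bip_weight :: "nat list \<times> nat list \<Rightarrow> rat" where
  "bip_weight x = mult_factor (fst x) * mult_factor (snd x)"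

lemma bip_word_pos: "x \<in> bipartitions i \<Longrightarrow> \<forall>w\<in>set (bip_word x). 1 \<le> snd w"
  by (fastforce simp: bipartitions_def bip_word_def Suc_le_eq intro: gr0I)

lemma parts_deg_bip_word: "parts_deg (bip_word x) = sum_list (fst x) + sum_list (snd x)"
  by (simp add: parts_deg_def bip_word_def comp_def)

lemma F_pair_eq:
  assumes "x \<in> bipartitions i"
  shows "F_pair \<theta> x w = bip_weight x *\<^sub>Q contr (bip_word x) (\<iota> w)"
proof -
  note pos = bip_word_pos[OF assms]
  obtain \<mu> \<nu> where x: "x = (\<mu>, \<nu>)" by (cases x)
  have "F_pair \<theta> x w = M_lift (\<lambda>ts. if length ts = sum_list \<mu> + sum_list \<nu>
      then bip_weight x *\<^sub>Q sprod (letters (bip_word x) ts) else 0) (\<iota> w)"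
    by (simp only: x F_pair_def prod.case letters_bipartition bip_word_def bip_weight_def fst_conv snd_conv)
  also have "(\<lambda>ts. if length ts = sum_list \<mu> + sum_list \<nu>
      then bip_weight x *\<^sub>Q sprod (letters (bip_word x) ts) else 0) =
      (\<lambda>ts. bip_weight x *\<^sub>Q block_prod (bip_word x) ts)"
    by (simp add: fun_eq_iff block_prod_def parts_deg_bip_word x Q.scale_zero_right)
  also have "M_lift (\<lambda>ts. bip_weight x *\<^sub>Q block_prod (bip_word x) ts) (\<iota> w)
      = bip_weight x *\<^sub>Q contr (bip_word x) (\<iota> w)"
  proof (rule mtensor_eqI[of "M_lift (\<lambda>ts. bip_weight x *\<^sub>Q block_prod (bip_word x) ts)"])
    note * = M_compat_linear[OF linear_Q_scale M_compat_block_prod[OF pos]]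
    show "linear_Q (M_lift (\<lambda>ts. bip_weight x *\<^sub>Q block_prod (bip_word x) ts))" by (rule linear_M_lift[OF *])
    show "linear_Q (\<lambda>w. bip_weight x *\<^sub>Q contr (bip_word x) w)" by (rule linear_Q_scaled[OF linear_contr[OF pos]])
    show "M_lift (\<lambda>ts. bip_weight x *\<^sub>Q block_prod (bip_word x) ts) (mtensor ts) =
        bip_weight x *\<^sub>Q contr (bip_word x) (mtensor ts)" for ts
      by (simp only: M_lift_mtensor[OF *] contr_mtensor[OF pos])
  qed
  finally show ?thesis .
qed

lemma linear_F_deg: "linear_Q (F_deg \<theta> i)"
proof -
  have "F_deg \<theta> i = (\<lambda>w. \<Sum>x\<in>bipartitions i. bip_weight x *\<^sub>Q contr (bip_word x) (\<iota> w))"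
    by (simp add: F_deg_def fun_eq_iff F_pair_eq)
  then show ?thesis
    using bip_word_pos by (simp add: linear_Q_sum linear_Q_scaled linear_Q_compose[OF linear_contr linear_\<iota>])
qed

lemma alternating_F: "alternating (\<lambda>us. F_deg \<theta> (length us) (wedge us))"
  unfolding alternating_def
  by (simp add: linear_Q_compose[OF linear_F_deg linear_wedge_slot] wedge_eq linear_Q_D[OF linear_F_deg])

lemma linear_F_star: "linear_Q (F_star \<theta>)"
  unfolding F_star_def by (rule linear_ext_lift[OF alternating_F])

lemma F_star_wedge:
  "F_star \<theta> (wedge us) = (\<Sum>x\<in>bipartitions (length us). bip_weight x *\<^sub>Q F_word (bip_word x) us)"
  unfolding F_star_def ext_lift_wedge[OF alternating_F]
  by (simp add: F_deg_def F_word_def F_pair_eq)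

lemma F_star_part:
  assumes "w \<in> ext_part i"
  shows "F_star \<theta> w \<in> S_part i"
  unfolding S_part_def
proof (rule linear_Q_span_subset[OF linear_F_star _ assms[unfolded ext_part_def]])
  fix w :: "'n U ext" assume "w \<in> {wedge xs | xs. length xs = i}"
  then obtain us where us: "w = wedge us" "length us = i" by auto
  have "F_star \<theta> w \<in> S_part i"
    unfolding us(1) F_star_wedge
    using F_word_part[OF bip_word_pos, of _ "length us" us] us(2) by (intro S_part_closed) auto
  then show "F_star \<theta> w \<in> Q.span {sprod xs | xs. sum_list (map deg xs) = i}" by (simp only: S_part_def)
qed

lemma F_star_gl:
  assumes "invertible g"
  shows "F_star \<theta> (gl_extU g w) = gl_S g (F_star \<theta> w)"
proof (rule wedge_eqI[OF linear_Q_compose[OF linear_F_star linear_gl_extU] linear_Q_compose[OF linear_gl_S linear_F_star]])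
  fix us
  show "F_star \<theta> (gl_extU g (wedge us)) = gl_S g (F_star \<theta> (wedge us))"
    unfolding gl_extU_wedge F_star_wedge length_map linear_Q_D[OF linear_gl_S]
    by (rule sum.cong[OF refl]) (simp only: F_word_gl[OF assms bip_word_pos])
qed

text \<open>A bipartition with empty word is the empty one; it occurs in degree 0, with weight
  1.\<close>

lemma F_star_counit: "S_counit (F_star \<theta> w) = ext_counit w"
proof (rule wedge_eqI[OF linear_Q_compose[OF linear_S_counit linear_F_star] linear_ext_counit])
  fix us :: "'n U list"
  have "S_counit (F_star \<theta> (wedge us)) =
      (\<Sum>x\<in>bipartitions (length us). bip_weight x *\<^sub>Q (if bip_word x = [] \<and> us = [] then 1 else 0))"
    unfolding F_star_wedge linear_Q_D[OF linear_S_counit]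
    by (rule sum.cong[OF refl]) (simp only: S_counit_F_word[OF bip_word_pos])
  also have "\<dots> = (if us = [] then 1 else 0)"
  proof (cases "us = []")
    case True
    have "sum_list \<mu> = 0 \<Longrightarrow> 0 \<notin> set \<mu> \<Longrightarrow> \<mu> = []" for \<mu> :: "nat list" by (cases \<mu>) auto
    then have "bipartitions 0 = {([], [])}" by (auto simp: bipartitions_def)
    then show ?thesis
      by (simp add: True bip_word_def bip_weight_def mult_factor_def scaleQ_one)
  qed (simp add: Q.scale_zero_right)
  finally show "S_counit (F_star \<theta> (wedge us)) = ext_counit (wedge us)" by (simp only: ext_counit_wedge)
qed

text \<open>\<open>F_word\<close> vanishes on lists of the wrong length, so for fixed
  \<open>A\<close> and \<open>B\<close> the pairs of sizes \<open>length A\<close> and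
  \<open>length B\<close> survive, and their double sum factors.\<close>

lemma sum_split_bipartitions_tensor:
  assumes "length A + length B = N"
  shows "(\<Sum>(x, y)\<in>split_bipartitions N. (bip_weight x * bip_weight y) *\<^sub>Q (F_word (bip_word x) A \<otimes> F_word (bip_word y) B))
    = F_star \<theta> (wedge A) \<otimes> F_star \<theta> (wedge B)"
proof -
  let ?t = "\<lambda>(x, y). (bip_weight x * bip_weight y) *\<^sub>Q (F_word (bip_word x) A \<otimes> F_word (bip_word y) B)"
  let ?R = "bipartitions (length A) \<times> bipartitions (length B)"
  have "sum ?t (split_bipartitions N) = sum ?t ?R"
  proof (rule sum.mono_neutral_right[OF finite_split_bipartitions])
    show "?R \<subseteq> split_bipartitions N"
      using assms by (fastforce simp: split_bipartitions_def)
    show "\<forall>q\<in>split_bipartitions N - ?R. ?t q = 0"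
    proof
      fix q assume q: "q \<in> split_bipartitions N - ?R"
      then obtain p where "p \<le> N" "q \<in> bipartitions p \<times> bipartitions (N - p)"
        unfolding split_bipartitions_def by blast
      then obtain x y where xy: "q = (x, y)" "x \<in> bipartitions p" "y \<in> bipartitions (N - p)" "p \<le> N"
        by blast
      have deg: "parts_deg (bip_word x) = p" "parts_deg (bip_word y) = N - p"
        using xy by (auto simp: parts_deg_bip_word bipartitions_def)
      have "p \<noteq> length A" using q xy assms by auto
      then have "F_word (bip_word x) A = 0" by (intro F_word_zero[OF bip_word_pos[OF xy(2)]]) (simp add: deg)
      then show "?t q = 0" by (simp add: xy linear_Q_D[OF linear_tensor_left] Q.scale_zero_right)
    qed
  qed
  also have "\<dots> = (\<Sum>x\<in>bipartitions (length A). \<Sum>y\<in>bipartitions (length B).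
      (bip_weight x *\<^sub>Q F_word (bip_word x) A) \<otimes> (bip_weight y *\<^sub>Q F_word (bip_word y) B))"
    by (simp add: sum.cartesian_product linear_Q_D[OF linear_tensor_left] linear_Q_D[OF linear_tensor_right]
        scaleQ_scaleQ case_prod_unfold mult.commute)
  also have "\<dots> = F_star \<theta> (wedge A) \<otimes> F_star \<theta> (wedge B)"
    unfolding F_star_wedge linear_Q_D(5)[OF linear_tensor_left] linear_Q_D(5)[OF linear_tensor_right]
    by (rule sum.swap refl)
  finally show ?thesis .
qed

text \<open>With the weights, splittings of words of parts become pairs of bipartitions whose sizes
  are not tied to the splitting of \<open>us\<close>. Exchanging the two sums makes each splitting
  of \<open>us\<close> select the matching sizes.\<close>

lemma F_star_coprod: "S_coprod (F_star \<theta> w) = tensor_map (F_star \<theta>) (F_star \<theta>) (ext_coprod w)"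
proof (rule wedge_eqI[OF linear_Q_compose[OF linear_S_coprod linear_F_star]
      linear_Q_compose[OF linear_tensor_map[OF linear_F_star linear_F_star] linear_ext_coprod]])
  fix us :: "'n U list"
  let ?N = "length us"
  let ?K = "\<lambda>L1 L2. ksum (\<lambda>_. 1) us (\<lambda>A B. F_word L1 A \<otimes> F_word L2 B)"
  have "S_coprod (F_star \<theta> (wedge us)) = (\<Sum>x\<in>bipartitions ?N. bip_weight x *\<^sub>Q ksum (\<lambda>_. 0) (bip_word x) ?K)"
    unfolding F_star_wedge linear_Q_D[OF linear_S_coprod]
    by (rule sum.cong[OF refl]) (simp only: F_word_coprod[OF bip_word_pos])
  also have "\<dots> = (\<Sum>(\<mu>, \<nu>)\<in>bipartitions ?N. \<Sum>(A, B)\<in>desc_pairs \<mu>. \<Sum>(C, D)\<in>desc_pairs \<nu>.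
      (bip_weight (A, C) * bip_weight (B, D)) *\<^sub>Q ?K (bip_word (A, C)) (bip_word (B, D)))"
  proof (rule sum.cong[OF refl], clarify)
    fix \<mu> \<nu> assume "(\<mu>, \<nu>) \<in> bipartitions ?N"
    then have desc: "sorted_wrt (\<ge>) \<mu>" "sorted_wrt (\<ge>) \<nu>" by (auto simp: bipartitions_def)
    \<comment> \<open>The unsigned splitting of the word separates into one of \<mu> and one of
      \<nu>, so \<open>mult_factor_ksum\<close> applies to each of them with its own factor.\<close>
    have "bip_weight (\<mu>, \<nu>) *\<^sub>Q ksum (\<lambda>_. 0) (bip_word (\<mu>, \<nu>)) ?K =
        mult_factor \<mu> *\<^sub>Q ksum (\<lambda>_. 0) \<mu> (\<lambda>A B. mult_factor \<nu> *\<^sub>Q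
          ksum (\<lambda>_. 0) \<nu> (\<lambda>C D. ?K (bip_word (A, C)) (bip_word (B, D))))"
      by (simp add: bip_weight_def bip_word_def ksum_append_unsigned ksum_map ksum_scale scaleQ_scaleQ)
    also have "\<dots> = (\<Sum>(A, B)\<in>desc_pairs \<mu>. \<Sum>(C, D)\<in>desc_pairs \<nu>.
      (bip_weight (A, C) * bip_weight (B, D)) *\<^sub>Q ?K (bip_word (A, C)) (bip_word (B, D)))"
      unfolding mult_factor_ksum[OF desc(1)] mult_factor_ksum[OF desc(2)]
      by (simp add: case_prod_unfold Q.scale_sum_right scaleQ_scaleQ bip_weight_def mult_ac)
    finally show "bip_weight (\<mu>, \<nu>) *\<^sub>Q ksum (\<lambda>_. 0) (bip_word (\<mu>, \<nu>)) ?K =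
      (\<Sum>(A, B)\<in>desc_pairs \<mu>. \<Sum>(C, D)\<in>desc_pairs \<nu>.
      (bip_weight (A, C) * bip_weight (B, D)) *\<^sub>Q ?K (bip_word (A, C)) (bip_word (B, D)))" .
  qed
  also have "\<dots> = (\<Sum>(x, y)\<in>split_bipartitions ?N. (bip_weight x * bip_weight y) *\<^sub>Q ?K (bip_word x) (bip_word y))"
    by (rule sum_bipartitions_split)
  also have "\<dots> = ksum (\<lambda>_. 1) us (\<lambda>A B. \<Sum>(x, y)\<in>split_bipartitions ?N.
      (bip_weight x * bip_weight y) *\<^sub>Q (F_word (bip_word x) A \<otimes> F_word (bip_word y) B))"
    by (simp only: case_prod_unfold ksum_sum ksum_scale)
  also have "\<dots> = ksum (\<lambda>_. 1) us (\<lambda>A B. F_star \<theta> (wedge A) \<otimes> F_star \<theta> (wedge B))"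
  proof (rule ksum_cong)
    fix A B assume eq: "mset A + mset B = mset us"
    have "length A + length B = ?N" using arg_cong[OF eq, of size] by simp
    then show "(\<Sum>(x, y)\<in>split_bipartitions ?N.
      (bip_weight x * bip_weight y) *\<^sub>Q (F_word (bip_word x) A \<otimes> F_word (bip_word y) B))
      = F_star \<theta> (wedge A) \<otimes> F_star \<theta> (wedge B)"
      by (rule sum_split_bipartitions_tensor)
  qed
  also have "\<dots> = tensor_map (F_star \<theta>) (F_star \<theta>) (ext_coprod (wedge us))"
    by (simp only: ext_coprod_wedge linear_ksum[OF linear_tensor_map[OF linear_F_star linear_F_star]]
        tensor_map_tensor[OF linear_F_star linear_F_star])
  finally show "S_coprod (F_star \<theta> (wedge us)) = tensor_map (F_star \<theta>) (F_star \<theta>) (ext_coprod (wedge us))" .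
qed

end

theorem proposition1p8:
  fixes \<theta> :: "nat \<Rightarrow> 'n::finite H ext \<Rightarrow> 'n ext_dual"
  assumes "wheel_identification \<theta>"
  shows "(\<forall>i. F_star \<theta> ` ext_part i \<subseteq> S_part i) \<and>
    (\<forall>g. invertible g \<longrightarrow> (\<forall>z. F_star \<theta> (gl_extU g z) = gl_S g (F_star \<theta> z))) \<and>
    coalgebra_map ext_coprod ext_counit S_coprod S_counit (F_star \<theta>)"
proof -
  interpret wheel \<theta> by unfold_locales (rule assms)
  show ?thesis
    using F_star_part F_star_gl F_star_coprod F_star_counit linear_F_star
    unfolding coalgebra_map_def by blast
qed

end
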